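(* Let $U$ be a word over the alphabet $\mathcal S\cup\mathcal C$. Then $U\in\mathcal L(\mathfrak S_{1,3}\circ\mathfrak S_{4,9}\circ\mathfrak S_{10,15}\circ\mathfrak C)$ if and only if $U\in\mathcal N$, i.e. if and only if $U$ is the normal form of some Clifford+$CS$ operator.
   Context: Groups: $X,Y,Z$ are the Pauli matrices, $H=\frac1{\sqrt2}\begin{bmatrix}1&1\\1&-1\end{bmatrix}$, $S=\mathrm{diag}(1,i)$, $CZ=\mathrm{diag}(1,1,1,-1)$, $CS=\mathrm{diag}(1,1,1,i)$. $\mathcal C$ is the two-qubit Clifford group, generated by $H\otimes I$, $I\otimes H$, $S\otimes I$, $I\otimes S$, $CZ$ (a finite group with 92160 elements). $\mathcal G$ (Clifford+$CS$ operators) is generated by $\mathcal C$ and $CS$. For commuting Hermitian two-qubit Paulis $P,Q$ let $R(P,Q)=\exp\left(\frac{i\pi}{2}\left(\frac{I-P}{2}\right)\left(\frac{I-Q}{2}\right)\right)$. Let $\mathcal S=\{\mathcal S_1,\dots,\mathcal S_{15}\}$, where $\mathcal S_j=R(P_j,Q_j)$ and, writing $AB$ for $A\otimes B$, the pairs $(P_j,Q_j)$ are in order: $(XI,IX),(YI,IY),(ZI,IZ),(YI,IZ),(ZI,IY),(ZI,IX),(XI,IZ),(XI,IY),(YI,IX),(XX,YY),(XX,ZY),(ZX,YY),(YX,XY),(ZX,XY),(YX,ZY)$. $SO(6)$ representation: with $e_1,\dots,e_4$ the standard basis of $\mathbb C^4$, order the orthonormal basis of $\bigwedge^2\mathbb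 C^4$ as $B_1=\frac{i}{\sqrt2}(e_1\wedge e_2-e_3\wedge e_4)$, $B_2=\frac{1}{\sqrt2}(e_1\wedge e_2+e_3\wedge e_4)$, $B_3=\frac{i}{\sqrt2}(e_2\wedge e_3-e_1\wedge e_4)$, $B_4=\frac{1}{\sqrt2}(e_2\wedge e_4+e_3\wedge e_1)$, $B_5=\frac{i}{\sqrt2}(e_2\wedge e_4-e_3\wedge e_1)$, $B_6=\frac{1}{\sqrt2}(e_2\wedge e_3+e_1\wedge e_4)$. For $U\in SU(4)$, $\overline U\in SO(6)$ is the matrix in this basis of $v\wedge w\mapsto(Uv)\wedge(Uw)$; for general $U\in U(4)$ first multiply by a phase to get determinant 1 ($\overline U$ is then defined up to an irrelevant sign). Let $\mathcal D=\{\frac{1}{\sqrt2^{\,k}}M\in SO(6):k\in\mathbb N,M\in\mathbb Z^{6\times 6}\}$, which contains $\overline U$ for all $U\in\mathcal G$. For $V\in\mathcal D$, $\mathrm{lde}(V)$ is the least $\ell\in\mathbb N$ with $\sqrt2^{\,\ell}V$ integral. The pattern $\mathsf p(V)$ is the partition of $\{1,\dots,6\}$ in which $i,j$ lie in the same block iff rows $i$ and $j$ of $\sqrt2^{\,\mathrm{lde}(V)}V$ agree modulo 2. The patterns $\mathsf p(\overline{\mathcal S_j})$, $j=1,\dots,15$, are (writing $ab|cd|ef$ for $\{\{a,b\},\{c,d\},\{e,f\}\}$): $14|23|56$, $13|25|46$, $12|36|45$, $13|26|45$, $12|35|46$, $12|34|56$, $16|23|45$, $15|23|46$, $13|24|56$,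 $14|25|36$, $14|26|35$, $16|25|34$, $15|24|36$, $15|26|34$, $16|24|35$. Normal forms: for $U\in\mathcal G$ start with $V=\overline U$; while $\mathrm{lde}(V)>0$, take the element $\mathcal S_j$ of lowest index $j$ with $\mathrm{lde}(\overline{\mathcal S_j}^{\,T}V)=\mathrm{lde}(V)-1$ (one always exists), record it, and replace $V$ by $\overline{\mathcal S_j}^{\,T}V$. If $R_1,\dots,R_k$ are the recorded elements in order, then $C=(R_1\cdots R_k)^{-1}U\in\mathcal C$ and the normal form of $U$ is the word $R_1\cdots R_kC$ over $\mathcal S\cup\mathcal C$ (the last letter is always a letter of $\mathcal C$, possibly the identity). $\mathcal N$ is the set of all normal forms. Automata: a nondeterministic finite automaton is $(\Sigma,Q,\mathrm{In},\mathrm{Fin},\delta)$ with alphabet $\Sigma$, states $Q$, sets of initial and final states $\mathrm{In},\mathrm{Fin}\subseteq Q$, and transition function $\delta:Q\times(\Sigma\cup\{\varepsilon\})\to\mathscr P(Q)$; $\mathcal L(A)$ is the set of words accepted by $A$ (some path from an initial to a final state reads the word, $\varepsilon$-moves reading nothing). The concatenation $A\circ A'$ has the disjoint union of states, the initial states of $A$, the final states of $A'$, all transitions of $A$ and $A'$, and additional $\varepsilon$-transitions from every final state of $A$ to every initial state of $A'$. All automata here have alphabet $\Sigma=\mathcal S\cup\mathcal C$. With $[n,m]=\{n,\dots,m\}$, $[m]=[1,m]$: - $\mathfrak C$: enumerate $\mathcal C=\{\mathcal C_1,\dots,\mathcal C_K\}$, $K=|\mathcal C|$; states $[0,K]$,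 initial states $\{0\}$, final states $[K]$, $\delta(0,\mathcal C_j)=\{j\}$ and $\delta=\varnothing$ otherwise. - $\mathfrak S_{n,m}$: states $[m]$, initial states $[n,m]$, final states $[m]$, $\delta(s,\mathcal S_s)=\{t\in[m]:\mathsf p(\overline{\mathcal S_s})\cap\mathsf p(\overline{\mathcal S_t})=\varnothing\}$ (no common block) and $\delta=\varnothing$ otherwise. *)

theory Defs
  imports "HOL-Analysis.Analysis" "HOL-Algebra.Generated_Groups"
begin

section \<open>Operators\<close>

type_synonym qubit_op = "complex^2^2"
type_synonym op2 = "complex^4^4"

definition mscale :: "complex \<Rightarrow> complex^'n^'m \<Rightarrow> complex^'n^'m" where
  "mscale z A = (\<chi> i j. z * A $ i $ j)"

definition dagger :: "complex^'n^'m \<Rightarrow> complex^'m^'n" where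
  "dagger A = (\<chi> i j. cnj (A $ j $ i))"

definition unitary :: "complex^'n^'n \<Rightarrow> bool" where
  "unitary A \<longleftrightarrow> dagger A ** A = mat 1 \<and> A ** dagger A = mat 1"

text \<open>
  The product \<open>*\<close> on \<open>complex^'n^'n\<close> is componentwise, so the library's \<open>exp\<close> and \<open>^\<close>
  are not available for matrices.
\<close>

definition mpow :: "complex^'n^'n \<Rightarrow> nat \<Rightarrow> complex^'n^'n" where
  "mpow A n = (((**) A) ^^ n) (mat 1)"

definition mexp :: "complex^'n^'n \<Rightarrow> complex^'n^'n" where
  "mexp A = (\<Sum>n. (1 / fact n) *\<^sub>R mpow A n)"

text \<open>
  The indices \<open>1,2,3,4\<close> stand for \<open>00,01,10,11\<close>. (In the types \<open>2\<close>, \<open>4\<close> and \<open>6\<close>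
  the top index is the same element as \<open>0\<close>.)
\<close>

definition hi_bit :: "4 \<Rightarrow> 2" where "hi_bit i = (if i = 1 \<or> i = 2 then 1 else 2)"
definition lo_bit :: "4 \<Rightarrow> 2" where "lo_bit i = (if i = 1 \<or> i = 3 then 1 else 2)"

definition kron :: "qubit_op \<Rightarrow> qubit_op \<Rightarrow> op2" where
  "kron A B = (\<chi> i j. A $ hi_bit i $ hi_bit j * B $ lo_bit i $ lo_bit j)"

definition diag4 :: "complex \<Rightarrow> complex \<Rightarrow> complex \<Rightarrow> complex \<Rightarrow> op2" where
  "diag4 a b c d = (\<chi> i j. if i = j then vector [a, b, c, d] $ i else 0)"

abbreviation Id2 :: qubit_op where "Id2 \<equiv> mat 1"
definition PX :: qubit_op where "PX = vector [vector [0, 1], vector [1, 0]]"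
definition PY :: qubit_op where "PY = vector [vector [0, -\<i>], vector [\<i>, 0]]"
definition PZ :: qubit_op where "PZ = vector [vector [1, 0], vector [0, -1]]"
definition gateH :: qubit_op where
  "gateH = mscale (1 / of_real (sqrt 2)) (vector [vector [1, 1], vector [1, -1]])"
definition gateS :: qubit_op where "gateS = vector [vector [1, 0], vector [0, \<i>]]"
definition gateCZ :: op2 where "gateCZ = diag4 1 1 1 (-1)"
definition gateCS :: op2 where "gateCS = diag4 1 1 1 \<i>"

definition U4 :: "op2 monoid" where
  "U4 = \<lparr>carrier = {A. unitary A}, mult = (**), one = mat 1\<rparr>"

lemma dagger_mult: "dagger (A ** B) = dagger B ** dagger A"
  by (simp add: dagger_def matrix_matrix_mult_def vec_eq_iff mult.commute)

lemma dagger_dagger [simp]: "dagger (dagger A) = A"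
  by (simp add: dagger_def vec_eq_iff)

lemma group_U4: "group U4"
proof (rule groupI)
  fix x y assume "x \<in> carrier U4" "y \<in> carrier U4"
  then have x: "dagger x ** x = mat 1" "x ** dagger x = mat 1"
    and y: "dagger y ** y = mat 1" "y ** dagger y = mat 1"
    by (auto simp: U4_def unitary_def)
  have "dagger (x ** y) ** (x ** y) = dagger y ** (dagger x ** x) ** y"
    by (simp add: dagger_mult matrix_mul_assoc)
  moreover have "(x ** y) ** dagger (x ** y) = x ** (y ** dagger y) ** dagger x"
    by (simp add: dagger_mult matrix_mul_assoc)
  ultimately show "x \<otimes>\<^bsub>U4\<^esub> y \<in> carrier U4"
    using x y by (simp add: U4_def unitary_def)
next
  have "dagger (mat 1 :: op2) = mat 1"
    by (auto simp: dagger_def mat_def vec_eq_iff)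
  then show "\<one>\<^bsub>U4\<^esub> \<in> carrier U4"
    by (simp add: U4_def unitary_def)
next
  fix x assume "x \<in> carrier U4"
  then show "\<exists>y\<in>carrier U4. y \<otimes>\<^bsub>U4\<^esub> x = \<one>\<^bsub>U4\<^esub>"
    by (intro bexI[of _ "dagger x"]) (auto simp: U4_def unitary_def)
qed (auto simp: U4_def matrix_mul_assoc)

definition clifford :: "op2 set" where
  "clifford =
     generate U4 {kron gateH Id2, kron Id2 gateH, kron gateS Id2, kron Id2 gateS, gateCZ}"

definition clifford_CS :: "op2 set" where
  "clifford_CS = generate U4 (clifford \<union> {gateCS})"

definition rotR :: "op2 \<Rightarrow> op2 \<Rightarrow> op2" where
  "rotR P Q = mexp (mscale (\<i> * of_real pi / 2)
     (mscale (1 / 2) (mat 1 - P) ** mscale (1 / 2) (mat 1 - Q)))"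

definition pauli_pairs :: "(op2 \<times> op2) list" where
  "pauli_pairs =
    [(kron PX Id2, kron Id2 PX), (kron PY Id2, kron Id2 PY), (kron PZ Id2, kron Id2 PZ),
     (kron PY Id2, kron Id2 PZ), (kron PZ Id2, kron Id2 PY), (kron PZ Id2, kron Id2 PX),
     (kron PX Id2, kron Id2 PZ), (kron PX Id2, kron Id2 PY), (kron PY Id2, kron Id2 PX),
     (kron PX PX, kron PY PY), (kron PX PX, kron PZ PY), (kron PZ PX, kron PY PY),
     (kron PY PX, kron PX PY), (kron PZ PX, kron PX PY), (kron PY PX, kron PZ PY)]"

text \<open>Meaningful for \<open>j \<in> {1..15}\<close>.\<close>

definition Sgen :: "nat \<Rightarrow> op2" where
  "Sgen j = (case pauli_pairs ! (j - 1) of (P, Q) \<Rightarrow> rotR P Q)"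

definition alphabet :: "op2 set" where
  "alphabet = Sgen ` {1..15} \<union> clifford"


section \<open>The representation in \<open>SO(6)\<close>\<close>

text \<open>
  The exterior square of \<open>complex^4\<close> is realised by the antisymmetric matrices, \<open>v \<and> w\<close> being
  \<open>v w\<^sup>T - w v\<^sup>T\<close>. The induced action of \<open>U\<close> is then \<open>T \<mapsto> U T U\<^sup>T\<close>, by \<open>ext2_wedge\<close>.
\<close>

definition wedge :: "complex^4 \<Rightarrow> complex^4 \<Rightarrow> complex^4^4" (infixl \<open>\<and>\<^sub>v\<close> 70) where
  "v \<and>\<^sub>v w = (\<chi> a b. v $ a * w $ b - w $ a * v $ b)"

definition ext2 :: "op2 \<Rightarrow> complex^4^4 \<Rightarrow> complex^4^4" where
  "ext2 U T = U ** T ** transpose U"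

lemma ext2_wedge: "ext2 U (v \<and>\<^sub>v w) = (U *v v) \<and>\<^sub>v (U *v w)"
  by (simp add: ext2_def wedge_def vec_eq_iff matrix_matrix_mult_def matrix_vector_mult_def
      transpose_def sum_4 algebra_simps)

abbreviation bas :: "4 \<Rightarrow> complex^4" where "bas a \<equiv> axis a 1"

definition Bvec :: "6 \<Rightarrow> complex^4^4" where
  "Bvec i = vector
    [mscale (\<i> / of_real (sqrt 2)) (bas 1 \<and>\<^sub>v bas 2 - bas 3 \<and>\<^sub>v bas 4),
     mscale (1 / of_real (sqrt 2)) (bas 1 \<and>\<^sub>v bas 2 + bas 3 \<and>\<^sub>v bas 4),
     mscale (\<i> / of_real (sqrt 2)) (bas 2 \<and>\<^sub>v bas 3 - bas 1 \<and>\<^sub>v bas 4),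
     mscale (1 / of_real (sqrt 2)) (bas 2 \<and>\<^sub>v bas 4 + bas 3 \<and>\<^sub>v bas 1),
     mscale (\<i> / of_real (sqrt 2)) (bas 2 \<and>\<^sub>v bas 4 - bas 3 \<and>\<^sub>v bas 1),
     mscale (1 / of_real (sqrt 2)) (bas 2 \<and>\<^sub>v bas 3 + bas 1 \<and>\<^sub>v bas 4)] $ i"

text \<open>\<open>V\<close> is the (real) matrix of \<open>ext2 U\<close> in the basis \<open>Bvec\<close>.\<close>

definition represents :: "real^6^6 \<Rightarrow> op2 \<Rightarrow> bool" where
  "represents V U \<longleftrightarrow> (\<forall>j. ext2 U (Bvec j) = (\<Sum>i\<in>UNIV. V $ i $ j *\<^sub>R Bvec i))"

text \<open>
  For \<open>U \<in> U(4)\<close> the phase \<open>z\<close> is unique up to a fourth root of unity, hence the matrix is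
  unique up to sign; the choice made here affects neither \<open>lde\<close> nor \<open>pattern\<close> below.
\<close>

definition so6 :: "op2 \<Rightarrow> real^6^6" where
  "so6 U = (SOME V. \<exists>z. cmod z = 1 \<and> det (mscale z U) = 1 \<and> represents V (mscale z U))"

text \<open>
  \<open>lde\<close> and \<open>pattern\<close> are meant for matrices \<open>V\<close> such that \<open>sqrt 2 ^ l * V\<close> is integral
  for some \<open>l\<close>.
\<close>

definition lde :: "real^6^6 \<Rightarrow> nat" where
  "lde V = (LEAST l. \<forall>i j. sqrt 2 ^ l * V $ i $ j \<in> \<int>)"

definition pattern :: "real^6^6 \<Rightarrow> 6 set set" where
  "pattern V = UNIV // {(i, j). \<forall>k. \<exists>z::int.
     sqrt 2 ^ lde V * V $ i $ k - sqrt 2 ^ lde V * V $ j $ k = 2 * of_int z}"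


section \<open>Normal forms\<close>

text \<open>\<open>recorded V Rs\<close>: the greedy reduction started at \<open>V\<close> stops and records the letters \<open>Rs\<close>.\<close>

inductive recorded :: "real^6^6 \<Rightarrow> op2 list \<Rightarrow> bool" where
  stop: "lde V = 0 \<Longrightarrow> recorded V []"
| step: "lde V > 0 \<Longrightarrow> j \<in> {1..15}
    \<Longrightarrow> lde (transpose (so6 (Sgen j)) ** V) = lde V - 1
    \<Longrightarrow> (\<forall>i\<in>{1..<j}. lde (transpose (so6 (Sgen i)) ** V) \<noteq> lde V - 1)
    \<Longrightarrow> recorded (transpose (so6 (Sgen j)) ** V) Rs
    \<Longrightarrow> recorded V (Sgen j # Rs)"

definition word_prod :: "op2 list \<Rightarrow> op2" where
  "word_prod Rs = foldr (**) Rs (mat 1)"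

definition is_normal_form :: "op2 list \<Rightarrow> op2 \<Rightarrow> bool" where
  "is_normal_form w U \<longleftrightarrow>
     (\<exists>Rs. recorded (so6 U) Rs \<and> w = Rs @ [matrix_inv (word_prod Rs) ** U])"

definition normal_forms :: "op2 list set" where
  "normal_forms = {w. \<exists>U\<in>clifford_CS. is_normal_form w U}"


section \<open>Nondeterministic finite automata\<close>

text \<open>In \<open>delta\<close>, the label \<open>None\<close> is \<open>\<epsilon>\<close>.\<close>

record ('a, 'q) nfa =
  alph :: "'a set"
  states :: "'q set"
  initial :: "'q set"
  final :: "'q set"
  delta :: "'q \<Rightarrow> 'a option \<Rightarrow> 'q set"

definition wf_nfa :: "('a, 'q) nfa \<Rightarrow> bool" where
  "wf_nfa A \<longleftrightarrow> finite (states A) \<and> initial A \<subseteq> states A \<and> final A \<subseteq> states A \<and>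
     (\<forall>q x. delta A q x \<subseteq> states A) \<and>
     (\<forall>q x. delta A q x \<noteq> {} \<longrightarrow> q \<in> states A \<and> (\<forall>a. x = Some a \<longrightarrow> a \<in> alph A))"

inductive nfa_path :: "('a, 'q) nfa \<Rightarrow> 'q \<Rightarrow> 'a list \<Rightarrow> 'q \<Rightarrow> bool" for A where
  refl: "q \<in> states A \<Longrightarrow> nfa_path A q [] q"
| eps: "r \<in> delta A q None \<Longrightarrow> nfa_path A r w t \<Longrightarrow> nfa_path A q w t"
| letter: "r \<in> delta A q (Some a) \<Longrightarrow> nfa_path A r w t \<Longrightarrow> nfa_path A q (a # w) t"

definition language :: "('a, 'q) nfa \<Rightarrow> 'a list set" where
  "language A = {w \<in> lists (alph A). \<exists>q\<in>initial A. \<exists>t\<in>final A. nfa_path A q w t}"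

fun conc_trans ::
  "('a, 'q) nfa \<Rightarrow> ('a, 'r) nfa \<Rightarrow> 'q + 'r \<Rightarrow> 'a option \<Rightarrow> ('q + 'r) set" where
  "conc_trans A A' (Inl q) x =
     Inl ` delta A q x \<union> (if x = None \<and> q \<in> final A then Inr ` initial A' else {})"
| "conc_trans A A' (Inr q) x = Inr ` delta A' q x"

text \<open>Concatenation is used for automata over the same alphabet only.\<close>

definition nfa_conc :: "('a, 'q) nfa \<Rightarrow> ('a, 'r) nfa \<Rightarrow> ('a, 'q + 'r) nfa"
  (infixl \<open>\<circ>\<^sub>A\<close> 65) where
  "A \<circ>\<^sub>A A' = \<lparr>alph = alph A \<union> alph A', states = states A <+> states A',
     initial = Inl ` initial A, final = Inr ` final A', delta = conc_trans A A'\<rparr>"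

text \<open>The parameter \<open>c\<close> is an enumeration of \<open>clifford\<close> by \<open>{1..card clifford}\<close>.\<close>

definition clifford_nfa :: "(nat \<Rightarrow> op2) \<Rightarrow> (op2, nat) nfa" where
  "clifford_nfa c = \<lparr>alph = alphabet, states = {0..card clifford}, initial = {0},
     final = {1..card clifford},
     delta = (\<lambda>s x. {j \<in> {1..card clifford}. s = 0 \<and> x = Some (c j)})\<rparr>"

definition syllable_nfa :: "nat \<Rightarrow> nat \<Rightarrow> (op2, nat) nfa" where
  "syllable_nfa n m = \<lparr>alph = alphabet, states = {1..m}, initial = {n..m}, final = {1..m},
     delta = (\<lambda>s x. if s \<in> {1..m} \<and> x = Some (Sgen s)
       then {t \<in> {1..m}. pattern (so6 (Sgen s)) \<inter> pattern (so6 (Sgen t)) = {}} else {})\<rparr>"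

lemma wf_clifford_nfa:
  assumes "bij_betw c {1..card clifford} clifford"
  shows "wf_nfa (clifford_nfa c)"
  using bij_betw_apply[OF assms] by (auto simp: wf_nfa_def clifford_nfa_def alphabet_def)

lemma wf_syllable_nfa: "1 \<le> n \<Longrightarrow> m \<le> 15 \<Longrightarrow> wf_nfa (syllable_nfa n m)"
  by (auto simp: wf_nfa_def syllable_nfa_def alphabet_def split: if_splits)

lemma wf_nfa_conc:
  assumes "wf_nfa A" "wf_nfa A'"
  shows "wf_nfa (A \<circ>\<^sub>A A')"
proof -
  have "conc_trans A A' q x \<subseteq> states A <+> states A'" for q x
  proof (cases q)
    case (Inl a)
    have "delta A a x \<subseteq> states A" "initial A' \<subseteq> states A'"
      using assms unfolding wf_nfa_def by blast+
    then show ?thesis using Inl by auto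
  next
    case (Inr b)
    have "delta A' b x \<subseteq> states A'"
      using assms unfolding wf_nfa_def by blast
    then show ?thesis using Inr by auto
  qed
  moreover have "q \<in> states A <+> states A' \<and> (\<forall>a. x = Some a \<longrightarrow> a \<in> alph A \<union> alph A')"
    if "conc_trans A A' q x \<noteq> {}" for q x
  proof (cases q)
    case (Inl a)
    have "final A \<subseteq> states A"
      and "delta A a x \<noteq> {} \<longrightarrow> a \<in> states A \<and> (\<forall>b. x = Some b \<longrightarrow> b \<in> alph A)"
      using assms unfolding wf_nfa_def by blast+
    then show ?thesis using that Inl by (auto split: if_splits)
  next
    case (Inr b)
    have "delta A' b x \<noteq> {} \<longrightarrow> b \<in> states A' \<and> (\<forall>a. x = Some a \<longrightarrow> a \<in> alph A')"
      using assms unfolding wf_nfa_def by blast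
    then show ?thesis using that Inr by auto
  qed
  moreover have "finite (states A <+> states A')" "Inl ` initial A \<subseteq> states A <+> states A'"
    "Inr ` final A' \<subseteq> states A <+> states A'"
    using assms by (auto simp: wf_nfa_def)
  ultimately show ?thesis
    unfolding wf_nfa_def nfa_conc_def nfa.simps by blast
qed

end

theory Submission
  imports Defs
begin

text \<open>
  Multiplying \<open>V\<close>, of denominator exponent \<open>l\<close>, by the representation of \<open>Sgen s\<close> adds to the
  residue modulo 2 of each row of \<open>sqrt 2 ^ l * V\<close> the residue of its partner in the \<open>s\<close>-th
  perfect matching, and multiplication by the transpose lowers the exponent iff matched rows
  already agree modulo 2. So the greedy reduction of a word depends only on the partition of
  the rows into residue classes. Reading a word from right to left one starts from a signed
  permutation; the next class partition is either the three blocks of the last letter or one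
  block against the other four rows, and the lowest applicable letter is always the one just
  written exactly as long as the word stays in the language. This is a check over 30 states.
  Two further facts are needed. An operator of exponent 0 is Clifford: its matrix is reduced
  to the identity by quarter turns in adjacent coordinates, which are Clifford, and the
  remaining phase is an eighth root of unity because the determinant detects the parity of the
  number of \<open>gateCS\<close> factors. And \<open>Sgen s\<close> is a Clifford+CS operator: if \<open>C\<close> is a Clifford
  quarter turn carrying the \<open>j\<close>-th matching to the \<open>i\<close>-th, then \<open>(Sgen i)\<^sup>-\<^sup>1 C Sgen j\<close> has
  exponent 0.
\<close>

section \<open>The exterior square in coordinates\<close>

text \<open>Two perfect matchings without a common block form a 6-cycle. If the row classes are the
  blocks of \<open>t\<close>, adding partners along \<open>s\<close> therefore gives three distinct
  sums, one per block of \<open>s\<close>. With exactly one common block the union is that block and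
  a 4-cycle: the common block sums to 0 and the two other blocks of \<open>s\<close> to one and the
  same nonzero residue. A three-block partition is refined by a single matching, so the order of the
  letters is irrelevant there. One block against four rows is refined by all three matchings
  containing the block, and the greedy rule takes the lowest; the bounds on letters in the phases
  encode when the letter just written is that lowest one. The SO(6) matrix does not see phases:
  exp(i pi/8) times the identity has exponent 0 but is not Clifford. Hence integrality is always
  used together with a condition on the determinant. Moreover \<open>so6\<close> is a choice up to
  sign, so statements are made for the relation \<open>so6_rep\<close>, and exponents, residues and
  reductions are shown to be insensitive to the sign.\<close>

lemma exhaust_6:
  fixes x :: 6
  shows "x = 1 \<or> x = 2 \<or> x = 3 \<or> x = 4 \<or> x = 5 \<or> x = 6"
proof (induct x)
  case (of_int z)
  then have "z = 0 \<or> z = 1 \<or> z = 2 \<or> z = 3 \<or> z = 4 \<or> z = 5" by fastforce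
  then show ?case by auto
qed

lemma forall_6: "(\<forall>i::6. P i) \<longleftrightarrow> P 1 \<and> P 2 \<and> P 3 \<and> P 4 \<and> P 5 \<and> P 6"
  by (metis exhaust_6)

lemma UNIV_6: "UNIV = {1, 2, 3, 4, 5, 6::6}"
  using exhaust_6 by auto

lemma sum_6: "sum f (UNIV::6 set) = f 1 + f 2 + f 3 + f 4 + f 5 + f 6"
  unfolding UNIV_6 by (simp add: ac_simps)

lemma vector_4 [simp]:
  "(vector [x,y,z,w] ::('a::zero)^4)$1 = x"
  "(vector [x,y,z,w] ::('a::zero)^4)$2 = y"
  "(vector [x,y,z,w] ::('a::zero)^4)$3 = z"
  "(vector [x,y,z,w] ::('a::zero)^4)$4 = w"
  unfolding vector_def by simp_all

lemma vector_6 [simp]: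
  "(vector [x1,x2,x3,x4,x5,x6] ::('a::zero)^6)$1 = x1"
  "(vector [x1,x2,x3,x4,x5,x6] ::('a::zero)^6)$2 = x2"
  "(vector [x1,x2,x3,x4,x5,x6] ::('a::zero)^6)$3 = x3"
  "(vector [x1,x2,x3,x4,x5,x6] ::('a::zero)^6)$4 = x4"
  "(vector [x1,x2,x3,x4,x5,x6] ::('a::zero)^6)$5 = x5"
  "(vector [x1,x2,x3,x4,x5,x6] ::('a::zero)^6)$6 = x6"
  unfolding vector_def by simp_all

definition minor2 :: "'a::comm_ring_1^4^4 \<Rightarrow> 4 \<Rightarrow> 4 \<Rightarrow> 4 \<Rightarrow> 4 \<Rightarrow> 'a" where
  "minor2 A a b c d = A $ a $ c * A $ b $ d - A $ a $ d * A $ b $ c"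

text \<open>Laplace expansion along the first two rows. Determinants and the exterior square are
  thus computed from the same minors, in which a scalar factor enters through its square.\<close>

lemma det_4:
  "det (A::'a::comm_ring_1^4^4) =
     minor2 A 1 2 1 2 * minor2 A 3 4 3 4 - minor2 A 1 2 1 3 * minor2 A 3 4 2 4
   + minor2 A 1 2 1 4 * minor2 A 3 4 2 3 + minor2 A 1 2 2 3 * minor2 A 3 4 1 4
   - minor2 A 1 2 2 4 * minor2 A 3 4 1 3 + minor2 A 1 2 3 4 * minor2 A 3 4 1 2"
proof -
  have f1: "finite {2::4, 3, 4}" "1 \<notin> {2::4, 3, 4}"
    by auto
  have f2: "finite {3::4, 4}" "2 \<notin> {3::4, 4}"
    by auto
  have f3: "finite {4::4}" "3 \<notin> {4::4}"
    by auto
  show ?thesis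
    unfolding det_def UNIV_4
    unfolding sum_over_permutations_insert[OF f1]
    unfolding sum_over_permutations_insert[OF f2]
    unfolding sum_over_permutations_insert[OF f3]
    unfolding permutes_sing
    apply (simp add: sign_swap_id permutation_swap_id permutation_compose sign_compose swap_id_eq)
    apply (simp add: minor2_def)
    by (simp add: algebra_simps)
qed

lemma mscale_nth [simp]: "mscale z A $ i $ j = z * A $ i $ j"
  by (simp add: mscale_def)

lemma Bvec_nth:
  "Bvec 1 = mscale (\<i> / of_real (sqrt 2)) (bas 1 \<and>\<^sub>v bas 2 - bas 3 \<and>\<^sub>v bas 4)"
  "Bvec 2 = mscale (1 / of_real (sqrt 2)) (bas 1 \<and>\<^sub>v bas 2 + bas 3 \<and>\<^sub>v bas 4)"
  "Bvec 3 = mscale (\<i> / of_real (sqrt 2)) (bas 2 \<and>\<^sub>v bas 3 - bas 1 \<and>\<^sub>v bas 4)"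
  "Bvec 4 = mscale (1 / of_real (sqrt 2)) (bas 2 \<and>\<^sub>v bas 4 + bas 3 \<and>\<^sub>v bas 1)"
  "Bvec 5 = mscale (\<i> / of_real (sqrt 2)) (bas 2 \<and>\<^sub>v bas 4 - bas 3 \<and>\<^sub>v bas 1)"
  "Bvec 6 = mscale (1 / of_real (sqrt 2)) (bas 2 \<and>\<^sub>v bas 3 + bas 1 \<and>\<^sub>v bas 4)"
  by (simp_all add: Bvec_def)

text \<open>
  Entry \<open>(a, b)\<close> of the image of \<open>sqrt 2 * Bvec j\<close> under \<open>ext2 U\<close>, where \<open>p c d\<close> is the minor
  of \<open>U\<close> with rows \<open>a, b\<close> and columns \<open>c, d\<close>.
\<close>

definition bcoord :: "(4 \<Rightarrow> 4 \<Rightarrow> complex) \<Rightarrow> 6 \<Rightarrow> complex" where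
  "bcoord p j = vector [\<i> * (p 1 2 - p 3 4), p 1 2 + p 3 4, \<i> * (p 2 3 - p 1 4),
      p 2 4 - p 1 3, \<i> * (p 2 4 + p 1 3), p 2 3 + p 1 4] $ j"

lemma ext2_Bvec_nth:
  "ext2 U (Bvec j) $ a $ b = bcoord (minor2 U a b) j / of_real (sqrt 2)"
  using exhaust_6[of j]
  by (elim disjE; simp add: ext2_def Bvec_nth wedge_def minor2_def bcoord_def
       matrix_matrix_mult_def transpose_def sum_4 axis_def field_simps)

lemma sum_Bvec_nth:
  "(\<Sum>i\<in>UNIV. f i *\<^sub>R Bvec i) $ 1 $ 2 = (\<i> * f 1 + f 2) / of_real (sqrt 2)"
  "(\<Sum>i\<in>UNIV. f i *\<^sub>R Bvec i) $ 3 $ 4 = (f 2 - \<i> * f 1) / of_real (sqrt 2)"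
  "(\<Sum>i\<in>UNIV. f i *\<^sub>R Bvec i) $ 2 $ 3 = (\<i> * f 3 + f 6) / of_real (sqrt 2)"
  "(\<Sum>i\<in>UNIV. f i *\<^sub>R Bvec i) $ 1 $ 4 = (f 6 - \<i> * f 3) / of_real (sqrt 2)"
  "(\<Sum>i\<in>UNIV. f i *\<^sub>R Bvec i) $ 2 $ 4 = (f 4 + \<i> * f 5) / of_real (sqrt 2)"
  "(\<Sum>i\<in>UNIV. f i *\<^sub>R Bvec i) $ 1 $ 3 = (\<i> * f 5 - f 4) / of_real (sqrt 2)"
  by (simp_all add: sum_6 Bvec_nth wedge_def axis_def scaleR_conv_of_real[where 'a=complex]
      field_simps)

lemma antisym_eq_iff:
  fixes S T :: "complex^4^4"
  assumes "\<And>a b. S $ b $ a = - S $ a $ b" "\<And>a b. T $ b $ a = - T $ a $ b"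
  shows "S = T \<longleftrightarrow> S$1$2 = T$1$2 \<and> S$3$4 = T$3$4 \<and> S$2$3 = T$2$3 \<and> S$1$4 = T$1$4
     \<and> S$2$4 = T$2$4 \<and> S$1$3 = T$1$3"
proof -
  have d: "S $ a $ a = T $ a $ a" for a
    using assms(1)[of a a] assms(2)[of a a] by simp
  show ?thesis
    unfolding vec_eq_iff forall_4 using d
    by (auto simp: assms(1)[of 1 2] assms(1)[of 1 3] assms(1)[of 1 4] assms(1)[of 2 3]
        assms(1)[of 2 4]
       assms(1)[of 3 4] assms(2)[of 1 2] assms(2)[of 1 3] assms(2)[of 1 4] assms(2)[of 2 3]
       assms(2)[of 2 4] assms(2)[of 3 4])
qed

text \<open>Both sides of the defining identity are antisymmetric, so six entries decide.
  Complementary positions involve the same two basis vectors: 1 and 2 at 12 and 34, 3 and 6 at 23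
  and 14, 4 and 5 at 24 and 13.\<close>

lemma represents_iff:
  "represents V U \<longleftrightarrow> (\<forall>j.
     bcoord (minor2 U 1 2) j = \<i> * V $ 1 $ j + V $ 2 $ j \<and>
     bcoord (minor2 U 3 4) j = V $ 2 $ j - \<i> * V $ 1 $ j \<and>
     bcoord (minor2 U 2 3) j = \<i> * V $ 3 $ j + V $ 6 $ j \<and>
     bcoord (minor2 U 1 4) j = V $ 6 $ j - \<i> * V $ 3 $ j \<and>
     bcoord (minor2 U 2 4) j = V $ 4 $ j + \<i> * V $ 5 $ j \<and>
     bcoord (minor2 U 1 3) j = \<i> * V $ 5 $ j - V $ 4 $ j)"
proof -
  have 0: "bcoord (minor2 U b a) j = - bcoord (minor2 U a b) j" for a b j
    using exhaust_6[of j] by (elim disjE) (simp_all add: bcoord_def minor2_def algebra_simps)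
  have 1: "ext2 U (Bvec j) $ b $ a = - ext2 U (Bvec j) $ a $ b" for j a b
    unfolding ext2_Bvec_nth 0[of b a j] by simp
  have 3: "Bvec j $ b $ a = - Bvec j $ a $ b" for j a b
    using exhaust_6[of j] by (elim disjE) (simp_all add: Bvec_nth wedge_def algebra_simps)
  have 2: "(\<Sum>i\<in>UNIV. V $ i $ j *\<^sub>R Bvec i) $ b $ a = - (\<Sum>i\<in>UNIV. V $ i $ j *\<^sub>R Bvec i) $ a $ b"
    for j a b
    unfolding sum_component vector_scaleR_component 3[of _ b a] by (simp add: sum_negf)
  show ?thesis
    unfolding represents_def antisym_eq_iff[OF 1 2] ext2_Bvec_nth sum_Bvec_nth
    by simp
qed

text \<open>The relation from which \<open>so6\<close> chooses a value. It is compatible with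
  products and inverses, whereas the chosen matrices multiply only up to sign.\<close>

definition so6_rep :: "op2 \<Rightarrow> real^6^6 \<Rightarrow> bool" where
  "so6_rep U V \<longleftrightarrow> (\<exists>z. cmod z = 1 \<and> det (mscale z U) = 1 \<and> represents V (mscale z U))"

text \<open>\<open>represents\<close> entry by entry, with \<open>c\<close> in the role of the squared phase.\<close>

definition rep_eqs :: "complex \<Rightarrow> op2 \<Rightarrow> real^6^6 \<Rightarrow> bool" where
  "rep_eqs c U V \<longleftrightarrow> (\<forall>j.
     c * bcoord (minor2 U 1 2) j = \<i> * V $ 1 $ j + V $ 2 $ j \<and>
     c * bcoord (minor2 U 3 4) j = V $ 2 $ j - \<i> * V $ 1 $ j \<and>
     c * bcoord (minor2 U 2 3) j = \<i> * V $ 3 $ j + V $ 6 $ j \<and>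
     c * bcoord (minor2 U 1 4) j = V $ 6 $ j - \<i> * V $ 3 $ j \<and>
     c * bcoord (minor2 U 2 4) j = V $ 4 $ j + \<i> * V $ 5 $ j \<and>
     c * bcoord (minor2 U 1 3) j = \<i> * V $ 5 $ j - V $ 4 $ j)"

lemma minor2_mscale: "minor2 (mscale z U) a b = (\<lambda>c d. z^2 * minor2 U a b c d)"
  by (simp add: minor2_def fun_eq_iff power2_eq_square algebra_simps)

lemma bcoord_scale: "bcoord (\<lambda>c d. k * p c d) j = k * bcoord p j"
  using exhaust_6[of j] by (elim disjE) (simp_all add: bcoord_def algebra_simps)

lemma represents_mscale: "represents V (mscale z U) \<longleftrightarrow> rep_eqs (z^2) U V"
  by (simp add: represents_iff rep_eqs_def minor2_mscale bcoord_scale)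

lemma det_mscale: "det (mscale z (U::op2)) = z^4 * det U"
  by (simp add: det_4 minor2_mscale) (simp add: algebra_simps power_numeral_reduce)

lemma so6_rep_iff:
  "so6_rep U V \<longleftrightarrow> (\<exists>z. cmod z = 1 \<and> z^4 * det U = 1 \<and> rep_eqs (z^2) U V)"
  by (simp add: so6_rep_def det_mscale represents_mscale)

text \<open>The entries of \<open>V\<close> are real, so the real and imaginary parts of the
  equations give them separately.\<close>

lemma rep_eqs_unique:
  assumes "rep_eqs c U V" "rep_eqs c U V'"
  shows "V = V'"
proof -
  have "V $ i $ j = V' $ i $ j" for i j
    using assms exhaust_6[of i] unfolding rep_eqs_def complex_eq_iff
    by (elim disjE; drule_tac x=j in spec; drule_tac x=j in spec; simp)
  then show ?thesis by (simp add: vec_eq_iff)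
qed

lemma rep_eqs_minus: "rep_eqs c U V \<Longrightarrow> rep_eqs (- c) U (- V)"
  unfolding rep_eqs_def by (simp add: algebra_simps minus_equation_iff)

text \<open>The determinant fixes the fourth power of the phase, hence its square up to sign, and
  the matrix depends on the phase only through this square.\<close>

lemma so6_rep_unique:
  assumes "so6_rep U V" "so6_rep U V'"
  shows "V' = V \<or> V' = - V"
proof -
  obtain z where z: "z^4 * det U = 1" "rep_eqs (z^2) U V"
    using assms(1) by (auto simp: so6_rep_iff)
  obtain w where w: "w^4 * det U = 1" "rep_eqs (w^2) U V'"
    using assms(2) by (auto simp: so6_rep_iff)
  have "(w^2)^2 = (z^2)^2"
    using z(1) w(1) by (metis mult_cancel_right mult_zero_right power_mult numeral_Bit0
        numeral_times_numeral
      semiring_norm(11) zero_neq_one power_even_eq power2_eq_square mult_2)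
  then have "w^2 = z^2 \<or> w^2 = - (z^2)"
    by (rule power2_eq_iff[THEN iffD1])
  then show ?thesis
    using z(2) w(2) rep_eqs_minus rep_eqs_unique by metis
qed

lemma so6_rep_minus: "so6_rep U V \<Longrightarrow> so6_rep U (- V)"
proof -
  assume "so6_rep U V"
  then obtain z where z: "cmod z = 1" "z^4 * det U = 1" "rep_eqs (z^2) U V"
    by (auto simp: so6_rep_iff)
  have "cmod (\<i> * z) = 1" "(\<i> * z)^4 * det U = 1" "rep_eqs ((\<i> * z)^2) U (- V)"
    using z rep_eqs_minus[OF z(3)] by (auto simp: norm_mult power_mult_distrib)
  then show ?thesis unfolding so6_rep_iff by blast
qed

lemma so6_rep_so6: "so6_rep U V \<Longrightarrow> so6_rep U (so6 U)"
  unfolding so6_def so6_rep_def[symmetric] by (rule someI)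

lemma so6_cases: "so6_rep U V \<Longrightarrow> so6 U = V \<or> so6 U = - V"
  by (rule so6_rep_unique[OF _ so6_rep_so6])

section \<open>Products and inverses in the representation\<close>

lemma mscale_mscale [simp]: "mscale z (mscale w A) = mscale (z * w) A"
  by (simp add: vec_eq_iff mult.assoc)

lemma mscale_1 [simp]: "mscale 1 A = A"
  by (simp add: vec_eq_iff)

lemma mscale_mult_left: "mscale z A ** B = mscale z (A ** B)"
  by (simp add: vec_eq_iff matrix_matrix_mult_def sum_distrib_left mult.assoc)

lemma mscale_mult_right: "A ** mscale z B = mscale z (A ** B)"
  by (simp add: vec_eq_iff matrix_matrix_mult_def sum_distrib_left mult.left_commute)

lemma ext2_mult: "ext2 (U ** W) T = ext2 U (ext2 W T)"
  by (simp add: ext2_def matrix_transpose_mul matrix_mul_assoc)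

lemma scaleR_mscale: "r *\<^sub>R A = mscale (of_real r) A"
  by (simp add: vec_eq_iff scaleR_conv_of_real[where 'a=complex])

lemma ext2_mscale: "ext2 U (mscale z T) = mscale z (ext2 U T)"
  by (simp add: ext2_def mscale_mult_left mscale_mult_right)

lemma matrix_add_rdistrib: "((A::'a::semiring_1^'n^'m) + B) ** C = A ** C + B ** C"
  by (simp add: vec_eq_iff matrix_matrix_mult_def sum.distrib distrib_right)

lemma ext2_add: "ext2 U (S + T) = ext2 U S + ext2 U T"
  by (simp add: ext2_def matrix_add_ldistrib matrix_add_rdistrib)

lemma linear_ext2: "linear (ext2 U)"
  by (rule linearI) (simp_all add: ext2_add scaleR_mscale ext2_mscale)

lemma ext2_combination:
  assumes "represents V U"
  shows "ext2 U (\<Sum>k\<in>UNIV. c k *\<^sub>R Bvec k) = (\<Sum>i\<in>UNIV. (\<Sum>k\<in>UNIV. V $ i $ k * c k) *\<^sub>R Bvec i)"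
proof -
  have "ext2 U (\<Sum>k\<in>UNIV. c k *\<^sub>R Bvec k) = (\<Sum>k\<in>UNIV. c k *\<^sub>R ext2 U (Bvec k))"
    by (simp add: linear_sum[OF linear_ext2] linear_cmul[OF linear_ext2])
  also have "\<dots> = (\<Sum>k\<in>UNIV. \<Sum>i\<in>UNIV. (V $ i $ k * c k) *\<^sub>R Bvec i)"
    using assms by (simp add: represents_def scaleR_sum_right mult.commute)
  also have "\<dots> = (\<Sum>i\<in>UNIV. (\<Sum>k\<in>UNIV. V $ i $ k * c k) *\<^sub>R Bvec i)"
    by (subst sum.swap) (simp add: scaleR_sum_left)
  finally show ?thesis .
qed

lemma represents_mult:
  assumes "represents V U" "represents V' U'"
  shows "represents (V ** V') (U ** U')"
  unfolding represents_def ext2_mult using assms(2) ext2_combination[OF assms(1)]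
  by (simp add: represents_def matrix_matrix_mult_def)

lemma so6_rep_mult:
  assumes "so6_rep U V" "so6_rep U' V'"
  shows "so6_rep (U ** U') (V ** V')"
proof -
  obtain z w where z: "cmod z = 1" "det (mscale z U) = 1" "represents V (mscale z U)"
    and w: "cmod w = 1" "det (mscale w U') = 1" "represents V' (mscale w U')"
    using assms unfolding so6_rep_def by blast
  have e: "mscale (z * w) (U ** U') = mscale z U ** mscale w U'"
    by (simp add: mscale_mult_left mscale_mult_right mult.commute)
  have "cmod (z * w) = 1" "det (mscale (z * w) (U ** U')) = 1"
    "represents (V ** V') (mscale (z * w) (U ** U'))"
    unfolding e using z w by (auto simp: norm_mult det_mul represents_mult)
  then show ?thesis unfolding so6_rep_def by blast
qed

lemma ext2_mat1: "ext2 (mat 1) T = T"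
  by (simp add: ext2_def)

lemma represents_mat1: "represents (mat 1) (mat 1)"
  unfolding represents_def ext2_mat1
      by (simp add: mat_def if_distrib[of "\<lambda>x. x *\<^sub>R _"] cong: if_cong)

lemma so6_rep_mat1: "so6_rep (mat 1) (mat 1)"
  unfolding so6_rep_def using represents_mat1 by (intro exI[of _ 1]) simp

lemma det_dagger: "det (dagger U) = cnj (det (U::op2))"
proof -
  have "dagger U = transpose (\<chi> i j. cnj (U $ i $ j))"
    by (simp add: dagger_def transpose_def vec_eq_iff)
  then have "det (dagger U) = det ((\<chi> i j. cnj (U $ i $ j))::op2)"
    by (simp add: det_transpose)
  also have "\<dots> = cnj (det U)"
    by (simp add: det_4 minor2_def)
  finally show ?thesis .
qed

lemma dagger_mscale: "dagger (mscale z U) = mscale (cnj z) (dagger U)"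
  by (simp add: dagger_def vec_eq_iff)

lemma unitary_mscale: "cmod z = 1 \<Longrightarrow> unitary U \<Longrightarrow> unitary (mscale z U)"
  using complex_norm_square[of z]
      by (simp add: unitary_def dagger_mscale mscale_mult_left mscale_mult_right mult.commute)

text \<open>By orthogonality \<open>U\<close> carries the combination with coefficients from row
  \<open>j\<close> of \<open>V\<close> to \<open>Bvec j\<close>; applying \<open>dagger U\<close> to
  this gives column \<open>j\<close> of the transpose.\<close>

lemma represents_dagger:
  assumes "represents V U" "unitary U" "orthogonal_matrix V"
  shows "represents (transpose V) (dagger U)"
  unfolding represents_def
proof
  fix j
  have VV: "V ** transpose V = mat 1"
    using assms(3) by (simp add: orthogonal_matrix_def)
  have "(\<Sum>k\<in>UNIV. V $ i $ k * V $ j $ k) = (if i = j then 1 else 0)" for i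
    using arg_cong[OF VV, of "\<lambda>M. M $ i $ j"]
    by (simp add: matrix_matrix_mult_def transpose_def mat_def)
  then have "ext2 U (\<Sum>k\<in>UNIV. V $ j $ k *\<^sub>R Bvec k) = Bvec j"
    by (simp add: ext2_combination[OF assms(1)] if_distrib[of "\<lambda>x. x *\<^sub>R _"] cong: if_cong)
  then have "ext2 (dagger U) (Bvec j) = ext2 (dagger U ** U) (\<Sum>k\<in>UNIV. V $ j $ k *\<^sub>R Bvec k)"
    by (simp add: ext2_mult)
  then show "ext2 (dagger U) (Bvec j) = (\<Sum>i\<in>UNIV. transpose V $ i $ j *\<^sub>R Bvec i)"
    using assms(2) by (simp add: unitary_def ext2_mat1 transpose_def)
qed

lemma so6_rep_dagger:
  assumes "so6_rep U V" "unitary U" "orthogonal_matrix V"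
  shows "so6_rep (dagger U) (transpose V)"
proof -
  obtain z where z: "cmod z = 1" "det (mscale z U) = 1" "represents V (mscale z U)"
    using assms unfolding so6_rep_def by blast
  have "cmod (cnj z) = 1" "det (mscale (cnj z) (dagger U)) = 1"
    "represents (transpose V) (mscale (cnj z) (dagger U))"
    using z represents_dagger[OF z(3) unitary_mscale[OF z(1) assms(2)] assms(3)]
      det_dagger[of "mscale z U"]
    by (auto simp: dagger_mscale)
  then show ?thesis unfolding so6_rep_def by blast
qed

text \<open>Prepares the computation of the kernel, where every basis vector except
  \<open>Bvec 4\<close> is known to be fixed. The fixed ones yield four basic wedges separately; of
  the remaining two only this difference, a multiple of \<open>Bvec 5\<close>, is available.\<close>

lemma wedge_bas_Bvec:
  "bas 1 \<and>\<^sub>v bas 2 = mscale (1 / of_real (sqrt 2)) (Bvec 2 + mscale (-\<i>) (Bvec 1))"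
  "bas 3 \<and>\<^sub>v bas 4 = mscale (1 / of_real (sqrt 2)) (Bvec 2 + mscale \<i> (Bvec 1))"
  "bas 2 \<and>\<^sub>v bas 3 = mscale (1 / of_real (sqrt 2)) (Bvec 6 + mscale (-\<i>) (Bvec 3))"
  "bas 1 \<and>\<^sub>v bas 4 = mscale (1 / of_real (sqrt 2)) (Bvec 6 + mscale \<i> (Bvec 3))"
  "bas 2 \<and>\<^sub>v bas 4 - bas 3 \<and>\<^sub>v bas 1 = mscale (- \<i> * of_real (sqrt 2)) (Bvec 5)"
  by (simp_all add: Bvec_nth vec_eq_iff wedge_def axis_def field_simps flip: of_real_mult)

text \<open>The entrywise conjugate of a unitary matrix inverts its transpose. Multiplying by it on
  the right turns the quadratic condition on \<open>U\<close> into one that is linear in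
  \<open>U\<close> and its conjugate.\<close>

lemma ext2_fixedD:
  assumes "unitary U" "ext2 U T = T"
  shows "(\<Sum>k\<in>UNIV. U $ a $ k * T $ k $ b) = (\<Sum>k\<in>UNIV. T $ a $ k * cnj (U $ k $ b))"
proof -
  define W where "W = (\<chi> i j. cnj (U $ i $ j))"
  have "transpose U ** W = transpose (dagger U ** U)"
    by (simp add: W_def vec_eq_iff transpose_def dagger_def matrix_matrix_mult_def mult.commute)
  then have W: "transpose U ** W = mat 1"
    using assms(1) by (simp add: unitary_def)
  have "U ** T = U ** T ** (transpose U ** W)" by (simp add: W)
  also have "\<dots> = T ** W"
    using assms(2) by (simp add: ext2_def matrix_mul_assoc)
  finally have "(U ** T) $ a $ b = (T ** W) $ a $ b" by simp
  then show ?thesis by (simp add: matrix_matrix_mult_def W_def)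
qed

text \<open>
  Besides computing the kernel of the representation, this excludes the orthogonal matrices of
  determinant \<open>- 1\<close>; index 4 is the end of the chain of coordinates used in the reduction
  below.
\<close>

lemma represents_diag_kernel:
  fixes s :: real
  assumes "unitary U" and rep: "\<And>j. j \<noteq> 4 \<Longrightarrow> ext2 U (Bvec j) = Bvec j"
      "ext2 U (Bvec 4) = s *\<^sub>R Bvec 4"
  shows "s = 1 \<and> (\<exists>z. U = mscale z (mat 1) \<and> cmod z = 1)"
proof -
  note fx = ext2_fixedD[OF assms(1)]
  have f: "ext2 U (bas 1 \<and>\<^sub>v bas 2) = bas 1 \<and>\<^sub>v bas 2" "ext2 U (bas 3 \<and>\<^sub>v bas 4) = bas 3 \<and>\<^sub>v bas 4"
    "ext2 U (bas 2 \<and>\<^sub>v bas 3) = bas 2 \<and>\<^sub>v bas 3" "ext2 U (bas 1 \<and>\<^sub>v bas 4) = bas 1 \<and>\<^sub>v bas 4"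
    "ext2 U (bas 2 \<and>\<^sub>v bas 4 - bas 3 \<and>\<^sub>v bas 1) = bas 2 \<and>\<^sub>v bas 4 - bas 3 \<and>\<^sub>v bas 1"
    unfolding wedge_bas_Bvec ext2_mscale ext2_add by (simp_all add: rep(1))
  note e = fx[OF f(1)] fx[OF f(2)] fx[OF f(3)] fx[OF f(4)] fx[OF f(5)]
  note simps = sum_4 wedge_def axis_def
  \<comment> \<open>The positions are chosen so that the right-hand side vanishes and a single entry
    of \<open>U\<close> survives on the left, or conversely.\<close>
  have off: "U $ 3 $ 1 = 0" "U $ 4 $ 1 = 0" "U $ 3 $ 2 = 0" "U $ 4 $ 2 = 0"
      "U $ 2 $ 1 = 0" "U $ 1 $ 2 = 0" "U $ 1 $ 3 = 0" "U $ 2 $ 3 = 0" "U $ 1 $ 4 = 0"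
          "U $ 2 $ 4 = 0"
      "U $ 3 $ 4 = 0" "U $ 4 $ 3 = 0"
    using e(1)[of 3 2] e(1)[of 4 2] e(1)[of 3 1] e(1)[of 4 1] e(2)[of 1 4] e(2)[of 2 4]
        e(2)[of 1 3] e(2)[of 2 3]
      e(3)[of 1 3] e(4)[of 2 4] e(3)[of 4 2] e(4)[of 3 1]
    by (simp_all add: simps)
  \<comment> \<open>The first four equations leave a diagonal z, cnj z, z, cnj z; the fifth makes z
    real.\<close>
  have d: "U $ 1 $ 1 = cnj (U $ 2 $ 2)" "U $ 3 $ 3 = cnj (U $ 4 $ 4)" "U $ 2 $ 2 = cnj (U $ 3 $ 3)"
     "U $ 1 $ 1 = cnj (U $ 4 $ 4)" "U $ 2 $ 2 = cnj (U $ 4 $ 4)"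
    using e(1)[of 1 2] e(2)[of 3 4] e(3)[of 2 3] e(4)[of 1 4] e(5)[of 2 4]
    by (simp_all add: simps)
  define z where "z = U $ 1 $ 1"
  have z: "U $ 1 $ 1 = z" "U $ 2 $ 2 = z" "U $ 3 $ 3 = z" "U $ 4 $ 4 = z" "cnj z = z"
    using d by (auto simp: z_def)
  have U: "U = mscale z (mat 1)"
    by (simp add: vec_eq_iff forall_4 mat_def off z)
  have "dagger U ** U = mat 1" using assms(1) by (simp add: unitary_def)
  then have "(dagger U ** U) $ 1 $ 1 = 1" by (simp add: mat_def)
  then have zz: "z * z = 1"
    by (simp add: dagger_def matrix_matrix_mult_def sum_4 off z)
  then have "cmod z = 1" by (metis norm_mult norm_one norm_ge_zero power2_eq_1_iff
      power2_eq_square abs_norm_cancel abs_1 abs_minus)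
  moreover have "s *\<^sub>R Bvec 4 = mscale (z * z) (Bvec 4)"
    unfolding rep(2)[symmetric] U
        by (simp add: ext2_def mscale_mult_left mscale_mult_right transpose_def)
       (simp add: vec_eq_iff mat_def matrix_matrix_mult_def sum_4 forall_4)
  then have "(s *\<^sub>R Bvec 4) $ 2 $ 4 = Bvec 4 $ 2 $ 4" by (simp add: zz)
  then have "s = 1" by (simp add: Bvec_nth wedge_def axis_def scaleR_conv_of_real[where 'a=complex])
  ultimately show ?thesis using U by blast
qed

section \<open>The generators\<close>

text \<open>Only the square \<open>c\<close> of the phase enters the equations, and any square root
  of it is a witness. This keeps roots of \<open>c\<close> out of the calculations with
  gates.\<close>

lemma so6_repI:
  assumes "cmod c = 1" "c^2 * det U = 1" "rep_eqs c U V"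
  shows "so6_rep U V"
proof -
  have "cmod (csqrt c) = 1"
    using assms(1) by simp
  moreover have "csqrt c ^ 4 = c^2"
    by (metis power2_csqrt power_mult numeral_Bit0 mult_2)
  ultimately show ?thesis
    unfolding so6_rep_iff using assms by (intro exI[of _ "csqrt c"]) simp
qed

lemma rep_eqs_scale:
  assumes "rep_eqs c U V"
  shows "rep_eqs (of_real r * c) U (r *\<^sub>R V)"
  unfolding rep_eqs_def mult.assoc
  by (simp add: assms[unfolded rep_eqs_def, rule_format]) (simp add: algebra_simps)

fun mate :: "('a \<times> 'a) list \<Rightarrow> 'a \<Rightarrow> 'a" where
  "mate [] i = i"
| "mate ((a, b) # l) i = (if i = a then b else if i = b then a else mate l i)"

fun orient :: "('a \<times> 'a) list \<Rightarrow> 'a \<Rightarrow> int" where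
  "orient [] i = 0"
| "orient ((a, b) # l) i = (if i = a then 1 else if i = b then - 1 else orient l i)"

definition rotM :: "(6 \<times> 6) list \<Rightarrow> real^6^6" where
  "rotM l = (\<chi> i j. if j = i then 1 else if j = mate l i then of_int (orient l i) else 0)"

text \<open>
  \<open>sqrt 2\<close> times the matrix of \<open>Sgen s\<close> is \<open>1 + J\<close>, where \<open>J\<close> is the antisymmetric matrix with
  entries \<open>1\<close> at the pairs of the \<open>s\<close>-th list. Its underlying matching is the pattern of \<open>Sgen
  s\<close>.
\<close>

definition arcs_list :: "(6 \<times> 6) list list" where
  "arcs_list =
    [[(3,2), (4,1), (6,5)],
     [(1,3), (4,6), (5,2)],
     [(2,1), (5,4), (6,3)],
     [(1,3), (5,4), (6,2)],
     [(2,1), (4,6), (5,3)],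
     [(2,1), (4,3), (6,5)],
     [(3,2), (5,4), (6,1)],
     [(3,2), (4,6), (5,1)],
     [(1,3), (4,2), (6,5)],
     [(1,4), (2,5), (3,6)],
     [(1,4), (3,5), (6,2)],
     [(2,5), (3,4), (6,1)],
     [(1,5), (2,4), (6,3)],
     [(1,5), (2,6), (3,4)],
     [(1,6), (2,4), (3,5)]]"

definition arcs :: "nat \<Rightarrow> (6 \<times> 6) list" where
  "arcs s = arcs_list ! (s - 1)"

lemma kron_nth: "kron A B $ i $ j = A $ hi_bit i $ hi_bit j * B $ lo_bit i $ lo_bit j"
  by (simp add: kron_def)

lemma bit_simps: "hi_bit 1 = 1" "hi_bit 2 = 1" "hi_bit 3 = 2" "hi_bit 4 = 2" "lo_bit 1 = 1"
    "lo_bit 2 = 2" "lo_bit 3 = 1" "lo_bit 4 = 2"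
  by (simp_all add: hi_bit_def lo_bit_def)

lemma pauli_nth: "PX $ 1 $ 1 = 0" "PX $ 1 $ 2 = 1" "PX $ 2 $ 1 = 1" "PX $ 2 $ 2 = 0"
 "PY $ 1 $ 1 = 0" "PY $ 1 $ 2 = -\<i>" "PY $ 2 $ 1 = \<i>" "PY $ 2 $ 2 = 0"
 "PZ $ 1 $ 1 = 1" "PZ $ 1 $ 2 = 0" "PZ $ 2 $ 1 = 0" "PZ $ 2 $ 2 = -1"
 "Id2 $ 1 $ 1 = 1" "Id2 $ 1 $ 2 = 0" "Id2 $ 2 $ 1 = 0" "Id2 $ 2 $ 2 = 1"
 by (simp_all add: PX_def PY_def PZ_def mat_def)

text \<open>Closed form of \<open>rotR\<close> for commuting involutions: for a projector B, exp(c
  B) = 1 + (exp c - 1) B, here with exp c = \<open>\<i>\<close>. The two factors 1/2 of the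
  projector make up the denominator 4.\<close>

definition Sproj :: "op2 \<Rightarrow> op2 \<Rightarrow> op2" where
  "Sproj P Q = mat 1 + mscale ((\<i> - 1) / 4) ((mat 1 - P) ** (mat 1 - Q))"

lemma Sproj_nth: "Sproj P Q $ i $ j = (if i = j then 1 else 0) + (\<i> - 1) / 4 * (\<Sum>k\<in>UNIV. ((if i =
    k then 1 else 0) - P $ i $ k) * ((if k = j then 1 else 0) - Q $ k $ j))"
  by (simp add: Sproj_def mat_def matrix_matrix_mult_def)

lemma all_entries:
  fixes U :: "'a^4^4"
  assumes "\<And>i j. U $ i $ j = f i j"
  shows "U $ 1 $ 1 = f 1 1"
    "U $ 1 $ 2 = f 1 2"
    "U $ 1 $ 3 = f 1 3"
    "U $ 1 $ 4 = f 1 4"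
    "U $ 2 $ 1 = f 2 1"
    "U $ 2 $ 2 = f 2 2"
    "U $ 2 $ 3 = f 2 3"
    "U $ 2 $ 4 = f 2 4"
    "U $ 3 $ 1 = f 3 1"
    "U $ 3 $ 2 = f 3 2"
    "U $ 3 $ 3 = f 3 3"
    "U $ 3 $ 4 = f 3 4"
    "U $ 4 $ 1 = f 4 1"
    "U $ 4 $ 2 = f 4 2"
    "U $ 4 $ 3 = f 4 3"
    "U $ 4 $ 4 = f 4 4"
  using assms by simp_all

text \<open>Packing each entry by its real and imaginary part lets simplification evaluate the Pauli
  cases to explicit numbers once, so that the later checks only substitute constants.\<close>

lemma Sproj_nth_Complex: "Sproj A B $ i $ j = Complex (Re ((if i =
    j then 1 else 0) + (\<i> - 1) / 4 * (
      ((if i = 1 then 1 else 0) - A $ i $ 1) * ((if 1 = j then 1 else 0) - B $ 1 $ j) +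
      ((if i = 2 then 1 else 0) - A $ i $ 2) * ((if 2 = j then 1 else 0) - B $ 2 $ j) +
      ((if i = 3 then 1 else 0) - A $ i $ 3) * ((if 3 = j then 1 else 0) - B $ 3 $ j) +
      ((if i = 4 then 1 else 0) - A $ i $ 4) * ((if 4 = j then 1 else 0) - B $ 4 $ j))))
    (Im ((if i = j then 1 else 0) + (\<i> - 1) / 4 * (
      ((if i = 1 then 1 else 0) - A $ i $ 1) * ((if 1 = j then 1 else 0) - B $ 1 $ j) +
      ((if i = 2 then 1 else 0) - A $ i $ 2) * ((if 2 = j then 1 else 0) - B $ 2 $ j) +
      ((if i = 3 then 1 else 0) - A $ i $ 3) * ((if 3 = j then 1 else 0) - B $ 3 $ j) +
      ((if i = 4 then 1 else 0) - A $ i $ 4) * ((if 4 = j then 1 else 0) - B $ 4 $ j))))"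
  unfolding Sproj_nth sum_4 by (rule complex.collapse[symmetric])

lemmas Sproj_entries = all_entries[OF Sproj_nth_Complex]

lemmas Sproj_pauli_entries =
  Sproj_entries[where A = "kron PX Id2" and B = "kron Id2 PX"]
  Sproj_entries[where A = "kron PY Id2" and B = "kron Id2 PY"]
  Sproj_entries[where A = "kron PZ Id2" and B = "kron Id2 PZ"]
  Sproj_entries[where A = "kron PY Id2" and B = "kron Id2 PZ"]
  Sproj_entries[where A = "kron PZ Id2" and B = "kron Id2 PY"]
  Sproj_entries[where A = "kron PZ Id2" and B = "kron Id2 PX"]
  Sproj_entries[where A = "kron PX Id2" and B = "kron Id2 PZ"]
  Sproj_entries[where A = "kron PX Id2" and B = "kron Id2 PY"]
  Sproj_entries[where A = "kron PY Id2" and B = "kron Id2 PX"]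
  Sproj_entries[where A = "kron PX PX" and B = "kron PY PY"]
  Sproj_entries[where A = "kron PX PX" and B = "kron PZ PY"]
  Sproj_entries[where A = "kron PZ PX" and B = "kron PY PY"]
  Sproj_entries[where A = "kron PY PX" and B = "kron PX PY"]
  Sproj_entries[where A = "kron PZ PX" and B = "kron PX PY"]
  Sproj_entries[where A = "kron PY PX" and B = "kron PZ PY"]

lemmas Sproj_pauli_nth = Sproj_pauli_entries[unfolded kron_nth bit_simps pauli_nth, simplified]

lemma cases_15:
  assumes "s \<in> {1..15::nat}"
  shows "s = 1 \<or> s = 2 \<or> s = 3 \<or> s = 4 \<or> s = 5 \<or> s = 6 \<or> s = 7 \<or> s = 8 \<or> s = 9 \<or> s = 10
    \<or> s = 11 \<or> s = 12 \<or> s = 13 \<or> s = 14 \<or> s = 15"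
  using assms unfolding atLeastAtMost_iff by presburger

lemma Sproj_det_all: "list_all (\<lambda>(P, Q). det (Sproj P Q) = \<i>) pauli_pairs"
  unfolding pauli_pairs_def list.pred_inject prod.case
  by (intro conjI TrueI; unfold det_4 minor2_def Sproj_pauli_nth; simp add: complex_eq_iff)

text \<open>As the determinant is \<open>\<i>\<close>, the squared phase has to be (1 - i) / sqrt 2
  up to sign. Multiplying both the phase and the matrix by sqrt 2 leaves a check over Gaussian
  rationals.\<close>

lemma Sproj_rep_eqs_all:
  "list_all (\<lambda>(l, P, Q). rep_eqs (1 - \<i>) (Sproj P Q) (rotM l)) (zip arcs_list pauli_pairs)"
  unfolding pauli_pairs_def arcs_list_def zip_Cons_Cons zip_Nil list.pred_inject prod.case
  by (intro conjI TrueI; unfold rep_eqs_def forall_6 bcoord_def vector_6 minor2_def Sproj_pauli_nth;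
      simp add: complex_eq_iff rotM_def)

lemma Sproj_rep:
  assumes "s \<in> {1..15}" "pauli_pairs ! (s - 1) = (P, Q)"
  shows "det (Sproj P Q) = \<i>" "rep_eqs (1 - \<i>) (Sproj P Q) (rotM (arcs s))"
proof -
  have l: "s - 1 < length pauli_pairs" "s - 1 < length arcs_list"
    using assms(1) by (auto simp: pauli_pairs_def arcs_list_def)
  show "det (Sproj P Q) = \<i>"
    using Sproj_det_all l assms(2) by (fastforce simp: list_all_length)
  have "case zip arcs_list pauli_pairs ! (s - 1) of (l, P,
      Q) \<Rightarrow> rep_eqs (1 - \<i>) (Sproj P Q) (rotM l)"
    using Sproj_rep_eqs_all l unfolding list_all_length by simp
  then show "rep_eqs (1 - \<i>) (Sproj P Q) (rotM (arcs s))"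
    using l assms(2) by (simp add: arcs_def)
qed

section \<open>Exponentials of products of commuting projectors\<close>

lemma matrix_diff_ldistrib: "(A::'a::ring_1^'n^'m) ** (B - C) = A ** B - A ** C"
  by (simp add: vec_eq_iff matrix_matrix_mult_def sum_subtractf right_diff_distrib)

lemma matrix_diff_rdistrib: "((A::'a::ring_1^'n^'m) - B) ** C = A ** C - B ** C"
  by (simp add: vec_eq_iff matrix_matrix_mult_def sum_subtractf left_diff_distrib)

lemma mpow_idempotent:
  assumes "A ** A = A"
  shows "mpow (mscale c A) n = (if n = 0 then mat 1 else mscale (c ^ n) A)"
proof (induction n)
  case (Suc n)
  have "mpow (mscale c A) (Suc n) = mscale c A ** mpow (mscale c A) n"
    by (simp add: mpow_def)
  with Suc show ?case
    using assms by (simp add: mscale_mult_left mscale_mult_right)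
qed (simp add: mpow_def)

lemma mexp_idempotent:
  fixes A :: "complex^'n^'n"
  assumes "A ** A = A"
  shows "mexp (mscale c A) = mat 1 + mscale (exp c - 1) A"
proof -
  have "linear (\<lambda>z. mscale z A)"
    by (rule linearI) (simp_all add: vec_eq_iff algebra_simps)
  then have "bounded_linear (\<lambda>z. mscale z A)"
    by (simp add: linear_conv_bounded_linear)
  from bounded_linear.sums[OF this exp_converges]
  have "(\<lambda>n. mscale (c ^ n /\<^sub>R fact n) A) sums mscale (exp c) A" .
  \<comment> \<open>The power of exponent 0 is the identity instead of \<open>A\<close>; the extra
    term at index 0 corrects this.\<close>
  from sums_add[OF sums_single[of 0 "\<lambda>_. mat 1 - A"] this]
  have "(\<lambda>n. (1 / fact n) *\<^sub>R mpow (mscale c A) n) sums (mat 1 - A + mscale (exp c) A)"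
    by (rule sums_cong[THEN iffD1, rotated])
       (auto simp: mpow_idempotent[OF assms] scaleR_mscale divide_simps
           scaleR_conv_of_real[where 'a=complex])
  then show ?thesis
    by (simp add: mexp_def sums_unique[symmetric] vec_eq_iff algebra_simps)
qed

lemma involution_projector:
  fixes P :: "complex^'n^'n"
  assumes "P ** P = mat 1"
  shows "(mat 1 - P) ** (mat 1 - P) = mscale 2 (mat 1 - P)"
  unfolding matrix_diff_ldistrib matrix_diff_rdistrib using assms
  by (simp add: vec_eq_iff)

lemma commuting_projectors:
  fixes P Q :: op2
  assumes "P ** P = mat 1" "Q ** Q = mat 1" "P ** Q = Q ** P"
  defines "A \<equiv> (mat 1 - P) ** (mat 1 - Q)"
  shows "A ** A = mscale 4 A" "A = (mat 1 - Q) ** (mat 1 - P)"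
proof -
  show c: "A = (mat 1 - Q) ** (mat 1 - P)"
    unfolding A_def matrix_diff_ldistrib matrix_diff_rdistrib using assms(3) by simp
  have "A ** A = (mat 1 - P) ** ((mat 1 - Q) ** (mat 1 - Q)) ** (mat 1 - P)"
    by (subst (2) c) (simp add: A_def matrix_mul_assoc)
  also have "\<dots> = mscale 2 (A ** (mat 1 - P))"
    by (simp add: involution_projector[OF assms(2)] A_def mscale_mult_left mscale_mult_right)
  also have "\<dots> = mscale 4 A"
    unfolding c by (simp add: involution_projector[OF assms(1)] mscale_mult_right flip:
        matrix_mul_assoc)
  finally show "A ** A = mscale 4 A" .
qed

lemma rotR_eq_Sproj:
  assumes "P ** P = mat 1" "Q ** Q = mat 1" "P ** Q = Q ** P"
  shows "rotR P Q = Sproj P Q"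
proof -
  define B where "B = mscale (1/2) (mat 1 - P) ** mscale (1/2) (mat 1 - Q)"
  have B: "B = mscale (1/4) ((mat 1 - P) ** (mat 1 - Q))"
    by (simp add: B_def mscale_mult_left mscale_mult_right)
  have "B ** B = B"
    unfolding B using commuting_projectors(1)[OF assms]
        by (simp add: mscale_mult_left mscale_mult_right)
  moreover have "exp (\<i> * of_real pi / 2) = \<i>"
    using cis_pi_half by (simp add: cis_conv_exp mult.commute)
  ultimately have "rotR P Q = mat 1 + mscale (\<i> - 1) B"
    by (simp add: rotR_def mexp_idempotent flip: B_def)
  then show ?thesis
    by (simp add: B Sproj_def)
qed

lemma dagger_mat1 [simp]: "dagger (mat 1) = mat 1"
  by (simp add: dagger_def mat_def vec_eq_iff)

lemma dagger_add: "dagger (A + B) = dagger A + dagger B"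
  by (simp add: dagger_def vec_eq_iff)

lemma dagger_diff: "dagger (A - B) = dagger A - dagger B"
  by (simp add: dagger_def vec_eq_iff)

lemma unitary_Sproj:
  assumes "P ** P = mat 1" "Q ** Q = mat 1" "P ** Q = Q ** P" "dagger P = P" "dagger Q = Q"
  shows "unitary (Sproj P Q)"
proof -
  define A where "A = (mat 1 - P) ** (mat 1 - Q)"
  have A: "A ** A = mscale 4 A" "dagger A = A"
    using commuting_projectors[OF assms(1-3)] assms(4,5)
    by (simp_all add: A_def dagger_mult dagger_diff)
  have "dagger (Sproj P Q) = mat 1 + mscale ((- \<i> - 1) / 4) A"
    by (simp add: Sproj_def dagger_add dagger_mscale A(2) flip: A_def)
  moreover have "Sproj P Q = mat 1 + mscale ((\<i> - 1) / 4) A"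
    by (simp add: Sproj_def A_def)
  moreover have "(mat 1 + mscale a A) ** (mat 1 + mscale b A) =
      mat 1 + mscale (a + b + 4 * a * b) A" for a b
    unfolding matrix_add_ldistrib matrix_add_rdistrib
    by (simp add: mscale_mult_left mscale_mult_right A(1)) (simp add: vec_eq_iff algebra_simps)
  moreover have "mscale 0 A = 0" by (simp add: vec_eq_iff)
  moreover have "(\<i> - 1) / 4 + (- \<i> - 1) / 4 + 4 * ((\<i> - 1) / 4) * ((- \<i> - 1) / 4) = 0"
      "(- \<i> - 1) / 4 + (\<i> - 1) / 4 + 4 * ((- \<i> - 1) / 4) * ((\<i> - 1) / 4) = 0"
    by (simp_all add: complex_eq_iff)
  ultimately show ?thesis
    unfolding unitary_def by (metis add.right_neutral)
qed

lemma kron_mult: "kron A B ** kron C D = kron (A ** C) (B ** D)"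
  by (simp add: vec_eq_iff forall_4 kron_nth bit_simps matrix_matrix_mult_def sum_4 sum_2
      algebra_simps)

lemma kron_mscale [simp]: "kron (mscale a A) B = mscale a (kron A B)"
    "kron A (mscale a B) = mscale a (kron A B)"
  by (simp_all add: vec_eq_iff kron_nth)

lemma kron_mat1: "kron (mat 1) (mat 1) = mat 1"
  by (simp add: vec_eq_iff forall_4 kron_nth bit_simps mat_def)

lemma dagger_kron: "dagger (kron A B) = kron (dagger A) (dagger B)"
  by (simp add: vec_eq_iff dagger_def kron_nth)

lemma pauli_mult:
  "PX ** PX = mat 1" "PY ** PY = mat 1" "PZ ** PZ = mat 1"
  "PY ** PX = mscale (- 1) (PX ** PY)" "PZ ** PX = mscale (- 1) (PX ** PZ)"
  "PZ ** PY = mscale (- 1) (PY ** PZ)"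
  "dagger PX = PX" "dagger PY = PY" "dagger PZ = PZ"
  by (simp_all add: vec_eq_iff forall_2 matrix_matrix_mult_def sum_2 pauli_nth mat_def dagger_def)

lemma pauli_pairs_props:
  "list_all (\<lambda>(P, Q). P ** P = mat 1 \<and> Q ** Q = mat 1 \<and> P ** Q = Q ** P \<and> dagger P = P \<and>
      dagger Q = Q)
     pauli_pairs"
  by (simp add: pauli_pairs_def kron_mult pauli_mult kron_mat1 dagger_kron mscale_mult_left
      mscale_mult_right)

definition smat :: "nat \<Rightarrow> real^6^6" where
  "smat s = (1 / sqrt 2) *\<^sub>R rotM (arcs s)"

lemma Sgen_rep:
  assumes "s \<in> {1..15}"
  shows "unitary (Sgen s)" "det (Sgen s) = \<i>" "so6_rep (Sgen s) (smat s)"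
proof -
  obtain P Q where PQ: "pauli_pairs ! (s - 1) = (P, Q)" by fastforce
  have "s - 1 < length pauli_pairs"
    using assms by (auto simp: pauli_pairs_def)
  then have p: "P ** P = mat 1" "Q ** Q = mat 1" "P ** Q = Q ** P" "dagger P = P" "dagger Q = Q"
    using pauli_pairs_props PQ by (auto simp: list_all_length)
  have S: "Sgen s = Sproj P Q"
    unfolding Sgen_def PQ prod.case by (rule rotR_eq_Sproj[OF p(1-3)])
  show "unitary (Sgen s)" unfolding S by (rule unitary_Sproj[OF p])
  show d: "det (Sgen s) = \<i>" unfolding S by (rule Sproj_rep(1)[OF assms PQ])
  have "rep_eqs (of_real (1 / sqrt 2) * (1 - \<i>)) (Sgen s) (smat s)"
    unfolding S smat_def by (rule rep_eqs_scale[OF Sproj_rep(2)[OF assms PQ]])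
  moreover have "cmod (1 - \<i>) = sqrt 2" by (simp add: cmod_def)
  then have "cmod (of_real (1 / sqrt 2) * (1 - \<i>)) = 1"
    by (simp add: norm_mult norm_divide)
  moreover have "(of_real (1 / sqrt 2) * (1 - \<i>))^2 * det (Sgen s) = 1"
    unfolding d by (simp add: power_mult_distrib power_divide flip: of_real_power) (simp add:
        power2_eq_square algebra_simps)
  ultimately show "so6_rep (Sgen s) (smat s)"
    by (intro so6_repI)
qed

section \<open>Clifford operators\<close>

text \<open>
  The determinant condition is what later restricts phases to eighth roots of unity: the
  Clifford gates have determinant \<open>1\<close> or \<open>- 1\<close>, whereas \<open>gateCS\<close> has determinant \<open>\<i>\<close>.
\<close>

definition so6_level :: "nat \<Rightarrow> op2 \<Rightarrow> bool" where
  "so6_level l U \<longleftrightarrow> unitary U \<and> det U ^ 2 = (- 1) ^ l \<and>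
     (\<exists>V. so6_rep U V \<and> orthogonal_matrix V \<and> (\<forall>i j. sqrt 2 ^ l * V $ i $ j \<in> \<int>))"

lemma unitary_mult: "unitary U \<Longrightarrow> unitary (W::op2) \<Longrightarrow> unitary (U ** W)"
  using monoid.m_closed[OF group.is_monoid[OF group_U4], of U W] by (simp add: U4_def)

lemma unitary_dagger: "unitary U \<Longrightarrow> unitary (dagger U)"
  by (simp add: unitary_def)

lemma so6_level_mult:
  assumes "so6_level l U" "so6_level l' U'"
  shows "so6_level (l + l') (U ** U')"
proof -
  obtain V where V: "so6_rep U V" "orthogonal_matrix V" "\<And>i j. sqrt 2 ^ l * V $ i $ j \<in> \<int>"
    using assms(1) by (auto simp: so6_level_def)
  obtain V' where V': "so6_rep U' V'" "orthogonal_matrix V'" "\<And>i j. sqrt 2 ^ l' * V' $ i $ j \<in> \<int>"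
    using assms(2) by (auto simp: so6_level_def)
  have "sqrt 2 ^ (l + l') * (V ** V') $ i $ j \<in> \<int>" for i j
  proof -
    have "sqrt 2 ^ (l + l') * (V ** V') $ i $ j
        = (\<Sum>k\<in>UNIV. (sqrt 2 ^ l * V $ i $ k) * (sqrt 2 ^ l' * V' $ k $ j))"
      by (simp add: matrix_matrix_mult_def sum_distrib_left power_add mult_ac)
    also have "\<dots> \<in> \<int>"
      by (rule Ints_sum, rule Ints_mult[OF V(3) V'(3)])
    finally show ?thesis .
  qed
  then have "\<exists>X. so6_rep (U ** U') X \<and> orthogonal_matrix X \<and> (\<forall>i j.
      sqrt 2 ^ (l + l') * X $ i $ j \<in> \<int>)"
    using so6_rep_mult[OF V(1) V'(1)] orthogonal_matrix_mul[OF V(2) V'(2)] by blast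
  then show ?thesis
    using assms by (simp add: so6_level_def unitary_mult det_mul power_mult_distrib power_add)
qed

lemma so6_level_dagger:
  assumes "so6_level l U"
  shows "so6_level l (dagger U)"
proof -
  obtain V where V: "so6_rep U V" "orthogonal_matrix V" "\<And>i j. sqrt 2 ^ l * V $ i $ j \<in> \<int>"
    using assms by (auto simp: so6_level_def)
  have U: "unitary U" "det U ^ 2 = (- 1) ^ l" using assms by (auto simp: so6_level_def)
  have "so6_rep (dagger U) (transpose V)" "orthogonal_matrix (transpose V)"
    "\<forall>i j. sqrt 2 ^ l * transpose V $ i $ j \<in> \<int>"
    using so6_rep_dagger[OF V(1) U(1) V(2)] V(2) orthogonal_matrix_transpose
    by (blast, blast, simp add: transpose_def V(3))
  moreover have "det (dagger U) ^ 2 = (- 1) ^ l"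
    using U(2) by (metis det_dagger complex_cnj_power complex_cnj_minus complex_cnj_one)
  ultimately show ?thesis
    using unitary_dagger[OF U(1)] unfolding so6_level_def by blast
qed

lemma so6_level_mat1: "so6_level 0 (mat 1)"
proof -
  have "\<forall>i j. sqrt 2 ^ 0 * (mat 1 :: real^6^6) $ i $ j \<in> \<int>" by (simp add: mat_def)
  then show ?thesis
    unfolding so6_level_def using so6_rep_mat1 orthogonal_matrix_id
    by (intro conjI exI[of _ "mat 1"]) (simp_all add: unitary_def)
qed

lemma inv_U4: "unitary U \<Longrightarrow> inv\<^bsub>U4\<^esub> U = dagger U"
  by (rule group.inv_equality[OF group_U4]) (auto simp: U4_def unitary_def)

lemma mult_U4 [simp]: "U \<otimes>\<^bsub>U4\<^esub> W = U ** W" "\<one>\<^bsub>U4\<^esub> = mat 1" "carrier U4 = {A. unitary A}"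
  by (simp_all add: U4_def)

text \<open>The set \<open>L\<close> of admissible levels is {0} for the Clifford group and
  everything for Clifford+CS, so that one induction serves both.\<close>

lemma generate_U4_level:
  assumes "U \<in> generate U4 S" "\<And>x. x \<in> S \<Longrightarrow> \<exists>l\<in>L. so6_level l x"
    and "0 \<in> L" "\<And>l l'. l \<in> L \<Longrightarrow> l' \<in> L \<Longrightarrow> l + l' \<in> L"
  shows "\<exists>l\<in>L. so6_level l U"
  using assms(1)
proof induction
  case one
  then show ?case using so6_level_mat1 assms(3) by auto
next
  case (incl h)
  then show ?case using assms(2) by auto
next
  case (inv h)
  then obtain l where "l \<in> L" "so6_level l h" using assms(2) by blast
  then show ?case using so6_level_dagger inv_U4 by (metis so6_level_def)
next
  case (eng h1 h2)
  then show ?case using so6_level_mult assms(4) by (metis mult_U4(1))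
qed

definition rot90 :: "6 \<Rightarrow> 6 \<Rightarrow> real^6^6" where
  "rot90 a b = (\<chi> i j. if i = a then (if j = b then 1 else 0)
     else if i = b then (if j = a then - 1 else 0) else if i = j then 1 else 0)"

definition HI_mat :: "real^6^6" where
  "HI_mat = vector [vector [0, 0, -1, 0, 0, 0], vector [0, 1, 0, 0, 0, 0], vector [-1, 0, 0, 0, 0,
      0],
     vector [0, 0, 0, -1, 0, 0], vector [0, 0, 0, 0, -1, 0], vector [0, 0, 0, 0, 0, -1]]"

definition IH_mat :: "real^6^6" where
  "IH_mat = vector [vector [-1, 0, 0, 0, 0, 0], vector [0, -1, 0, 0, 0, 0], vector [0, 0, -1, 0,
      0, 0],
     vector [0, 0, 0, 0, 0, -1], vector [0, 0, 0, 0, 1, 0], vector [0, 0, 0, -1, 0, 0]]"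

definition CZ_mat :: "real^6^6" where
  "CZ_mat = vector [vector [0, -1, 0, 0, 0, 0], vector [1, 0, 0, 0, 0, 0], vector [0, 0, 0, 0, 0,
      -1],
     vector [0, 0, 0, 0, -1, 0], vector [0, 0, 0, 1, 0, 0], vector [0, 0, 1, 0, 0, 0]]"

lemma Clifford_gate_nth:
  "gateS $ 1 $ 1 = 1" "gateS $ 1 $ 2 = 0" "gateS $ 2 $ 1 = 0" "gateS $ 2 $ 2 = \<i>"
  "gateCZ $ i $ j = (if i = j then if i = 4 then - 1 else 1 else 0)"
  using exhaust_4[of i] by (auto simp: gateS_def gateCZ_def diag4_def)

definition hadamard :: qubit_op where "hadamard = vector [vector [1, 1], vector [1, -1]]"

lemma gateH_hadamard: "gateH = mscale (1 / of_real (sqrt 2)) hadamard"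
  by (simp add: gateH_def hadamard_def)

lemma hadamard_nth: "hadamard $ 1 $ 1 = 1" "hadamard $ 1 $ 2 = 1" "hadamard $ 2 $ 1 = 1"
    "hadamard $ 2 $ 2 = - 1"
  by (simp_all add: hadamard_def)

lemma rep_eqs_mscale: "rep_eqs c (mscale w U) V = rep_eqs (c * w^2) U V"
  by (simp add: rep_eqs_def minor2_mscale bcoord_scale mult.assoc)

lemma sqrt2_power [simp]: "complex_of_real (sqrt 2) ^ 2 = 2" "complex_of_real (sqrt 2) ^ 4 = 4"
  using power_mult[of "sqrt 2" 2 2] by (simp_all flip: of_real_power)

lemma sqrt2_mult [simp]:
  "complex_of_real (sqrt 2) * complex_of_real (sqrt 2) = 2"
  "complex_of_real (sqrt 2) * (complex_of_real (sqrt 2) * z) = 2 * z"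
  by (simp_all flip: of_real_mult mult.assoc)

text \<open>The squared phase must be inverse to a square root of the determinant: 1 for the
  Hadamard gates, of determinant 1, and \<open>- \<i>\<close> for the others, of determinant -1.
  Taking \<open>\<i>\<close> would negate the matrix.\<close>

lemma gates_rep:
  "so6_rep (kron gateH Id2) HI_mat" "so6_rep (kron Id2 gateH) IH_mat"
  "so6_rep (kron gateS Id2) (rot90 2 1)" "so6_rep (kron Id2 gateS) (rot90 5 4)"
  "so6_rep gateCZ CZ_mat"
proof -
  show "so6_rep (kron gateH Id2) HI_mat"
  proof (rule so6_repI[of 1])
    show "rep_eqs 1 (kron gateH Id2) HI_mat"
      unfolding gateH_hadamard kron_mscale rep_eqs_mscale
      by (simp add: rep_eqs_def forall_6 bcoord_def minor2_def kron_nth bit_simps hadamard_nth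
          pauli_nth
          HI_mat_def power_divide)
  qed (simp_all add: gateH_hadamard det_mscale det_4 minor2_def kron_nth bit_simps hadamard_nth
      pauli_nth power_divide)
  show "so6_rep (kron Id2 gateH) IH_mat"
  proof (rule so6_repI[of 1])
    show "rep_eqs 1 (kron Id2 gateH) IH_mat"
      unfolding gateH_hadamard kron_mscale rep_eqs_mscale
      by (simp add: rep_eqs_def forall_6 bcoord_def minor2_def kron_nth bit_simps hadamard_nth
          pauli_nth
          IH_mat_def power_divide)
  qed (simp_all add: gateH_hadamard det_mscale det_4 minor2_def kron_nth bit_simps hadamard_nth
      pauli_nth power_divide)
  show "so6_rep (kron gateS Id2) (rot90 2 1)"
    by (rule so6_repI[of "- \<i>"])
       (simp_all add: rep_eqs_def forall_6 bcoord_def det_4 minor2_def kron_nth bit_simps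
           Clifford_gate_nth pauli_nth rot90_def)
  show "so6_rep (kron Id2 gateS) (rot90 5 4)"
    by (rule so6_repI[of "- \<i>"])
       (simp_all add: rep_eqs_def forall_6 bcoord_def det_4 minor2_def kron_nth bit_simps
           Clifford_gate_nth pauli_nth rot90_def)
  show "so6_rep gateCZ CZ_mat"
    by (rule so6_repI[of "- \<i>"])
       (simp_all add: rep_eqs_def forall_6 bcoord_def det_4 minor2_def Clifford_gate_nth CZ_mat_def)
qed

lemma gate_mats_orthogonal:
  "orthogonal_matrix HI_mat" "orthogonal_matrix IH_mat" "orthogonal_matrix CZ_mat"
  "orthogonal_matrix (rot90 2 1)" "orthogonal_matrix (rot90 5 4)"
  by (simp_all add: orthogonal_matrix vec_eq_iff forall_6 matrix_matrix_mult_def sum_6 transpose_def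
      mat_def HI_mat_def IH_mat_def CZ_mat_def rot90_def)

lemma gate_mats_integral:
  "HI_mat $ i $ j \<in> \<int>" "IH_mat $ i $ j \<in> \<int>" "CZ_mat $ i $ j \<in> \<int>" "rot90 a b $ i $ j \<in> \<int>"
proof -
  have "\<forall>i j. HI_mat $ i $ j \<in> \<int> \<and> IH_mat $ i $ j \<in> \<int> \<and> CZ_mat $ i $ j \<in> \<int>"
    by (simp add: forall_6 HI_mat_def IH_mat_def CZ_mat_def)
  then show "HI_mat $ i $ j \<in> \<int>" "IH_mat $ i $ j \<in> \<int>" "CZ_mat $ i $ j \<in> \<int>" by auto
qed (simp add: rot90_def)

lemma gates_unitary:
  "unitary (kron gateH Id2)" "unitary (kron Id2 gateH)" "unitary (kron gateS Id2)"
      "unitary (kron Id2 gateS)"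
  "unitary gateCZ"
proof -
  have "hadamard ** hadamard = mat 2" "dagger hadamard = hadamard"
    by (simp_all add: vec_eq_iff forall_2 matrix_matrix_mult_def sum_2 hadamard_nth mat_def
        dagger_def)
  moreover have "mscale (1 / 2) (mat 2) = (mat 1 :: qubit_op)"
    by (simp add: vec_eq_iff mat_def)
  ultimately have H: "gateH ** gateH = mat 1" "dagger gateH = gateH"
    by (simp_all add: gateH_hadamard dagger_mscale mscale_mult_left mscale_mult_right
        power2_eq_square[symmetric] power_divide)
  have S: "gateS ** dagger gateS = mat 1" "dagger gateS ** gateS = mat 1"
    by (simp_all add: vec_eq_iff forall_2 matrix_matrix_mult_def sum_2 Clifford_gate_nth mat_def
        dagger_def)
  show "unitary (kron gateH Id2)" "unitary (kron Id2 gateH)" "unitary (kron gateS Id2)"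
      "unitary (kron Id2 gateS)"
    by (simp_all add: unitary_def dagger_kron kron_mult H S kron_mat1)
  show "unitary gateCZ"
    by (simp add: unitary_def vec_eq_iff forall_4 matrix_matrix_mult_def sum_4 Clifford_gate_nth
        mat_def dagger_def)
qed

lemma gates_det:
  "det (kron gateH Id2) ^ 2 = 1" "det (kron Id2 gateH) ^ 2 = 1" "det (kron gateS Id2) ^ 2 = 1"
  "det (kron Id2 gateS) ^ 2 = 1" "det gateCZ ^ 2 = 1"
proof -
  have "det (kron gateH Id2) = 1" "det (kron Id2 gateH) = 1" "det (kron gateS Id2) = - 1"
    "det (kron Id2 gateS) = - 1" "det gateCZ = - 1"
  by (simp_all add: gateH_hadamard det_mscale det_4 minor2_def kron_nth bit_simps hadamard_nth
      pauli_nth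
      Clifford_gate_nth power_divide)
  then show "det (kron gateH Id2) ^ 2 = 1" "det (kron Id2 gateH) ^ 2 = 1"
      "det (kron gateS Id2) ^ 2 = 1"
    "det (kron Id2 gateS) ^ 2 = 1" "det gateCZ ^ 2 = 1" by simp_all
qed

lemma so6_level_0I:
  assumes "so6_rep U V" "unitary U" "det U ^ 2 = 1" "orthogonal_matrix V" "\<And>i j. V $ i $ j \<in> \<int>"
  shows "so6_level 0 U"
  using assms unfolding so6_level_def by auto

lemma gates_level:
  "so6_level 0 (kron gateH Id2)" "so6_level 0 (kron Id2 gateH)" "so6_level 0 (kron gateS Id2)"
  "so6_level 0 (kron Id2 gateS)" "so6_level 0 gateCZ"
  using so6_level_0I[OF gates_rep(1) gates_unitary(1) gates_det(1) gate_mats_orthogonal(1)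
      gate_mats_integral(1)]
    so6_level_0I[OF gates_rep(2) gates_unitary(2) gates_det(2) gate_mats_orthogonal(2)
        gate_mats_integral(2)]
    so6_level_0I[OF gates_rep(3) gates_unitary(3) gates_det(3) gate_mats_orthogonal(4)
        gate_mats_integral(4)]
    so6_level_0I[OF gates_rep(4) gates_unitary(4) gates_det(4) gate_mats_orthogonal(5)
        gate_mats_integral(4)]
    so6_level_0I[OF gates_rep(5) gates_unitary(5) gates_det(5) gate_mats_orthogonal(3)
        gate_mats_integral(3)]
  by blast+

lemma clifford_level:
  assumes "U \<in> clifford"
  shows "so6_level 0 U"
proof -
  have "\<exists>l\<in>{0}. so6_level l U"
    using assms unfolding clifford_def
    by (rule generate_U4_level) (use gates_level in auto)
  then show ?thesis by simp
qed

section \<open>Clifford operators as signed permutations of the six axes\<close>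

definition clifford_mat :: "real^6^6 \<Rightarrow> bool" where
  "clifford_mat V \<longleftrightarrow> (\<exists>C\<in>clifford. so6_rep C V)"

lemma clifford_mat_mult: "clifford_mat V \<Longrightarrow> clifford_mat W \<Longrightarrow> clifford_mat (V ** W)"
  unfolding clifford_mat_def clifford_def by (metis generate.eng so6_rep_mult mult_U4(1))

lemma clifford_mat_minus: "clifford_mat V \<Longrightarrow> clifford_mat (- V)"
  unfolding clifford_mat_def using so6_rep_minus by blast

lemma clifford_mat_1: "clifford_mat (mat 1)"
  unfolding clifford_mat_def clifford_def by (metis generate.one so6_rep_mat1 mult_U4(2))

lemma clifford_mat_gates: "clifford_mat HI_mat" "clifford_mat IH_mat" "clifford_mat (rot90 2 1)"
    "clifford_mat (rot90 5 4)" "clifford_mat CZ_mat"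
  unfolding clifford_mat_def clifford_def using gates_rep by (auto intro!: bexI generate.incl)

lemma so6_rep_level_props:
  assumes "so6_level l U" "so6_rep U V"
  shows "orthogonal_matrix V" "sqrt 2 ^ l * V $ i $ j \<in> \<int>"
proof -
  obtain W where W: "so6_rep U W" "orthogonal_matrix W" "\<And>i j. sqrt 2 ^ l * W $ i $ j \<in> \<int>"
    using assms(1) by (auto simp: so6_level_def)
  have V: "V = W \<or> V = - W" using so6_rep_unique[OF W(1) assms(2)] .
  have "transpose (- W) = - transpose W"
    by (simp add: transpose_def vec_eq_iff)
  moreover have "(- transpose W) ** (- W) = transpose W ** W"
    by (simp add: vec_eq_iff matrix_matrix_mult_def)
  ultimately show "orthogonal_matrix V"
    using V W(2) by (auto simp: orthogonal_matrix)
  show "sqrt 2 ^ l * V $ i $ j \<in> \<int>"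
    using V W(3)[of i j] by (auto)
qed

lemma clifford_mat_props:
  assumes "clifford_mat V"
  shows "orthogonal_matrix V" "V $ i $ j \<in> \<int>"
  using assms so6_rep_level_props[OF clifford_level] unfolding clifford_mat_def by (blast, force)

text \<open>Conjugation by a Hadamard gate turns a phase gate on Z into one on X, and CZ times the
  phase gates on both qubits is diag(1, i, i, 1), the phase gate on ZZ. The sign in the last
  equation is the ambiguity of the representation.\<close>

lemma rot90_conjugates:
  "HI_mat ** (rot90 2 1 ** HI_mat) = rot90 3 2" "IH_mat ** (rot90 5 4 ** IH_mat) = rot90 6 5"
  "- (CZ_mat ** (rot90 2 1 ** rot90 5 4)) = rot90 3 6"
  by (simp_all add: vec_eq_iff forall_6 matrix_matrix_mult_def sum_6 rot90_def HI_mat_def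
      IH_mat_def CZ_mat_def)

lemma matrix_vector_axis: "((A::real^6^6) *v axis j 1) $ i = A $ i $ j"
  by (simp add: matrix_vector_mult_basis column_def)

lemma axis_component: "axis k x $ i = (if i = k then x else 0)"
  by (simp add: axis_def)

lemma rot90_axis:
  assumes "a \<noteq> b"
  shows "rot90 a b *v axis a 1 = - axis b 1" "rot90 a b *v axis b 1 = axis a 1"
    "c \<noteq> a \<Longrightarrow> c \<noteq> b \<Longrightarrow> rot90 a b *v axis c 1 = axis c 1"
  using assms by (auto simp: vec_eq_iff matrix_vector_axis rot90_def axis_component)

text \<open>
  In the order 1, 2, 3, 6, 5, 4, the quarter turns in consecutive coordinates come from phase
  gates on the Pauli operators ZI, XI, ZZ, IX and IZ.
\<close>

definition path_axis :: "nat \<Rightarrow> real^6" where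
  "path_axis n = axis ([1, 2, 3, 6, 5, 4] ! n) 1"

lemma mult_minus_vec: "(A::real^6^6) *v (- x) = - (A *v x)"
  by (simp add: vec_eq_iff matrix_vector_mult_def sum_negf)

lemma less_5_cases: "n < (5::nat) \<Longrightarrow> n = 0 \<or> n = 1 \<or> n = 2 \<or> n = 3 \<or> n = 4"
  by presburger

lemma less_6_cases: "n < (6::nat) \<Longrightarrow> n = 0 \<or> n = 1 \<or> n = 2 \<or> n = 3 \<or> n = 4 \<or> n = 5"
  by presburger

lemma path_axis_eq_iff: "m < 6 \<Longrightarrow> n < 6 \<Longrightarrow> path_axis m = path_axis n \<longleftrightarrow> m = n"
  using less_6_cases[of m] less_6_cases[of n] by (auto simp: path_axis_def axis_eq_axis)

lemma path_axis_surj: "\<exists>n<6. axis k 1 = path_axis n"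
proof -
  have "path_axis 0 = axis 1 1" "path_axis 1 = axis 2 1" "path_axis 2 = axis 3 1"
      "path_axis 5 = axis 4 1" "path_axis 4 = axis 5 1"
    "path_axis 3 = axis 6 1"
    by (simp_all add: path_axis_def)
  then have "axis k 1 = path_axis 0 \<or> axis k 1 = path_axis 1 \<or> axis k 1 = path_axis 2 \<or> axis k 1 =
      path_axis 3 \<or>
      axis k 1 = path_axis 4 \<or> axis k 1 = path_axis 5"
    using exhaust_6[of k] by auto
  moreover have "(0::nat) < 6" "(1::nat) < 6" "(2::nat) < 6" "(3::nat) < 6" "(4::nat) < 6"
      "(5::nat) < 6"
    by simp_all
  ultimately show ?thesis by blast
qed

text \<open>The sign is left open because the available quarter turns run along the path in either
  direction. For both signs the square of \<open>R\<close> negates the two axes.\<close>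

definition swaps :: "nat \<Rightarrow> real^6^6 \<Rightarrow> bool" where
  "swaps n R \<longleftrightarrow> (\<exists>s\<in>{1,-1}. R *v path_axis n = s *\<^sub>R path_axis (Suc n) \<and> R *v path_axis (Suc n) =
      - s *\<^sub>R path_axis n) \<and>
     (\<forall>m<6. m \<noteq> n \<longrightarrow> m \<noteq> Suc n \<longrightarrow> R *v path_axis m = path_axis m)"

lemma rot90_swaps:
  assumes "Suc n < 6" "a \<noteq> b" "{axis a 1, axis b 1} = {path_axis n, path_axis (Suc n)}"
  shows "swaps n (rot90 a b)"
proof -
  have "R *v path_axis m = path_axis m" if "R = rot90 a b" "m < 6" "m \<noteq> n" "m \<noteq> Suc n" for m R
  proof -
    have "path_axis m \<noteq> axis a 1" "path_axis m \<noteq> axis b 1"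
      using assms(1,3) that path_axis_eq_iff[of m n] path_axis_eq_iff[of m "Suc n"]
          by (auto simp: doubleton_eq_iff)
    then show ?thesis
      using rot90_axis(3)[OF assms(2), of "[1, 2, 3, 6, 5, 4] ! m"]
          unfolding that(1) path_axis_def by metis
  qed
  moreover have "path_axis n = axis a 1 \<and> path_axis (Suc n) = axis b 1 \<or> path_axis n = axis b 1 \<and>
      path_axis (Suc n) = axis a 1"
    using assms(3) by (auto simp: doubleton_eq_iff)
  ultimately show ?thesis
    unfolding swaps_def using rot90_axis(1,2)[OF assms(2)] by auto
qed

lemma clifford_mat_adjacent:
  "clifford_mat (rot90 2 1)" "clifford_mat (rot90 3 2)" "clifford_mat (rot90 3 6)"
      "clifford_mat (rot90 6 5)" "clifford_mat (rot90 5 4)"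
  unfolding rot90_conjugates[symmetric]
      by (intro clifford_mat_mult clifford_mat_minus clifford_mat_gates)+

lemma clifford_mat_swap:
  assumes "n < 5"
  shows "\<exists>R. clifford_mat R \<and> swaps n R"
proof -
  have "swaps 0 (rot90 2 1)" "swaps 1 (rot90 3 2)" "swaps 2 (rot90 3 6)" "swaps 3 (rot90 6 5)"
    "swaps 4 (rot90 5 4)"
    by (rule rot90_swaps; auto simp: path_axis_def)+
  then show ?thesis
    using less_5_cases[OF assms] clifford_mat_adjacent by blast
qed

text \<open>Bubbling down: a quarter turn in the plane of axes \<open>m\<close> and
  \<open>Suc m\<close> brings the latter to the former up to sign and touches no axis below
  \<open>n\<close>.\<close>

lemma clifford_mat_move:
  assumes "n \<le> m" "m < 6"
  shows "\<exists>W. clifford_mat W \<and> (\<forall>i<n. W *v path_axis i = path_axis i) \<and> (W *v path_axis m =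
      path_axis n \<or> W *v path_axis m = - path_axis n)"
  using assms
proof (induction m rule: dec_induct)
  case base
  show ?case using clifford_mat_1 by (intro exI[of _ "mat 1"]) simp
next
  case (step m)
  then obtain W where W: "clifford_mat W" "\<forall>i<n. W *v path_axis i = path_axis i"
      "W *v path_axis m = path_axis n \<or> W *v path_axis m = - path_axis n"
    by auto
  obtain R where R: "clifford_mat R" "swaps m R" using clifford_mat_swap[of m] step.prems by auto
  have "\<forall>i<n. (W ** R) *v path_axis i = path_axis i"
    using W(2) R(2) step.hyps step.prems by (simp add: swaps_def flip: matrix_vector_mul_assoc)
  moreover have "(W ** R) *v path_axis (Suc m) = path_axis n \<or> (W ** R) *v path_axis (Suc m) =
      - path_axis n"
    using W(3) R(2) by (auto simp: swaps_def mult_minus_vec simp flip: matrix_vector_mul_assoc)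
  ultimately show ?case using clifford_mat_mult[OF W(1) R(1)] by blast
qed

text \<open>A wrong sign is repaired by the square of the quarter turn in the plane of axes
  \<open>n\<close> and \<open>Suc n\<close>; this needs a successor on the path, whence
  \<open>n < 5\<close>.\<close>

lemma clifford_mat_move_signed:
  assumes "n \<le> m" "m < 6" "n < 5" "v = path_axis m \<or> v = - path_axis m"
  shows "\<exists>W. clifford_mat W \<and> (\<forall>i<n. W *v path_axis i = path_axis i) \<and> W *v v = path_axis n"
proof -
  obtain W where W: "clifford_mat W" "\<forall>i<n. W *v path_axis i = path_axis i"
      "W *v path_axis m = path_axis n \<or> W *v path_axis m = - path_axis n"
    using clifford_mat_move[OF assms(1,2)] by blast
  then have "W *v v = path_axis n \<or> W *v v = - path_axis n"
    using assms(4) by (auto simp: mult_minus_vec)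
  then show ?thesis
  proof
    assume "W *v v = path_axis n"
    with W show ?thesis by blast
  next
    assume v: "W *v v = - path_axis n"
    obtain R where R: "clifford_mat R" "swaps n R" using clifford_mat_swap[OF assms(3)] by blast
    have "(R ** R ** W) *v v = path_axis n"
      using R(2) v by (auto simp: swaps_def mult_minus_vec simp flip: matrix_vector_mul_assoc)
    moreover have "\<forall>i<n. (R ** R ** W) *v path_axis i = path_axis i"
      using R(2) W(2) assms(3) by (simp add: swaps_def flip: matrix_vector_mul_assoc)
    ultimately show ?thesis using clifford_mat_mult[OF clifford_mat_mult[OF R(1) R(1)] W(1)]
        by blast
  qed
qed

text \<open>Squares of integers that add up to 1: one of them is 1 and the others vanish.\<close>

lemma integral_unit_column:
  fixes V :: "real^6^6"
  assumes "orthogonal_matrix V" "\<And>i j. V $ i $ j \<in> \<int>"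
  shows "\<exists>k. V *v axis j 1 = axis k 1 \<or> V *v axis j 1 = - axis k (1::real)"
proof -
  have "\<exists>z::int. V $ i $ j = of_int z" for i using assms(2)[of i j] by (auto elim: Ints_cases)
  then obtain z where z: "\<And>i. V $ i $ j = of_int (z i)" by metis
  have "(transpose V ** V) $ j $ j = 1"
    using assms(1) by (simp add: orthogonal_matrix mat_def)
  then have "(\<Sum>i\<in>UNIV. V $ i $ j * V $ i $ j) = 1"
    by (simp add: matrix_matrix_mult_def transpose_def)
  then have "of_int (\<Sum>i\<in>UNIV. z i * z i) = (1::real)"
    by (simp add: z)
  then have s: "(\<Sum>i\<in>UNIV. z i * z i) = 1"
    by (simp only: of_int_eq_1_iff)
  then obtain k where k: "z k * z k \<noteq> 0"
    by (metis sum.neutral zero_neq_one)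
  have "z k * z k + (\<Sum>i\<in>UNIV - {k}. z i * z i) = 1"
    using s by (simp add: sum.remove[of UNIV k])
  moreover have "0 \<le> (\<Sum>i\<in>UNIV - {k}. z i * z i)" by (simp add: sum_nonneg)
  moreover have "z k * z k \<ge> 1" using k by (smt (verit) zero_le_square)
  ultimately have "z k * z k = 1" "(\<Sum>i\<in>UNIV - {k}. z i * z i) = 0" by linarith+
  then have "z k = 1 \<or> z k = - 1" "\<And>i. i \<noteq> k \<Longrightarrow> z i = 0"
    by (auto simp: sum_nonneg_eq_0_iff square_eq_1_iff)
  then have "V *v axis j 1 = axis k 1 \<or> V *v axis j 1 = - axis k 1"
    by (auto simp: vec_eq_iff matrix_vector_axis axis_component z)
  then show ?thesis by blast
qed

lemma orthogonal_matrix_inj: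
  assumes "orthogonal_matrix (V::real^6^6)" "V *v x = V *v y"
  shows "x = y"
proof -
  have "transpose V *v (V *v x) = transpose V *v (V *v y)" using assms(2) by simp
  then show ?thesis using assms(1) by (simp add: matrix_vector_mul_assoc orthogonal_matrix)
qed

lemma path_axis_minus: "path_axis m \<noteq> - path_axis n"
  by (auto simp: path_axis_def axis_def vec_eq_iff)

text \<open>Axis \<open>n\<close> goes to some axis \<open>m\<close> up to sign. By injectivity
  \<open>m\<close> is not among the axes already fixed, so it can be moved to position
  \<open>n\<close> without disturbing those. The last axis has no successor to repair its sign, so
  five axes is the most that is reached.\<close>

lemma clifford_mat_reduce:
  assumes "orthogonal_matrix V" "\<And>i j. V $ i $ j \<in> \<int>" "n \<le> 5"
  shows "\<exists>W. clifford_mat W \<and> (\<forall>i<n. (W ** V) *v path_axis i = path_axis i)"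
  using assms(3)
proof (induction n)
  case 0
  then show ?case using clifford_mat_1 by blast
next
  case (Suc n)
  then obtain W where W: "clifford_mat W" "\<forall>i<n. (W ** V) *v path_axis i = path_axis i" by auto
  let ?X = "W ** V"
  have o: "orthogonal_matrix ?X" using clifford_mat_props(1)[OF W(1)] assms(1)
      by (rule orthogonal_matrix_mul)
  have "?X $ i $ j \<in> \<int>" for i j
    unfolding matrix_matrix_mult_def using clifford_mat_props(2)[OF W(1)] assms(2)
    by (simp, intro Ints_sum Ints_mult) auto
  from integral_unit_column[OF o this] obtain m where m: "m < 6"
      "?X *v path_axis n = path_axis m \<or> ?X *v path_axis n = - path_axis m"
    unfolding path_axis_def[of n] using path_axis_surj by metis
  have "n \<le> m"
  proof (rule ccontr)
    assume "\<not> n \<le> m"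
    then have e: "?X *v path_axis m = path_axis m" using W(2) by simp
    then have "?X *v path_axis n = ?X *v path_axis m \<or> ?X *v path_axis n = ?X *v (- path_axis m)"
      using m(2) by (simp add: mult_minus_vec)
    then have "path_axis n = path_axis m \<or> path_axis n = - path_axis m"
      using orthogonal_matrix_inj[OF o] by blast
    then show False
      using path_axis_eq_iff[of n m] m(1) Suc.prems \<open>\<not> n \<le> m\<close> path_axis_minus by auto
  qed
  with clifford_mat_move_signed[OF this m(1) _ m(2)] Suc.prems
  obtain W' where W': "clifford_mat W'" "\<forall>i<n. W' *v path_axis i = path_axis i"
      "W' *v (?X *v path_axis n) = path_axis n"
    by auto
  have "\<forall>i<Suc n. (W' ** W ** V) *v path_axis i = path_axis i"
    using W(2) W'(2,3) by (auto simp: less_Suc_eq simp flip: matrix_vector_mul_assoc)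
  then show ?case using clifford_mat_mult[OF W'(1) W(1)] by blast
qed

lemma represents_column: "represents V U \<Longrightarrow> ext2 U (Bvec j) = (\<Sum>i\<in>UNIV.
    (V *v axis j 1) $ i *\<^sub>R Bvec i)"
  by (simp add: represents_def matrix_vector_axis)

lemma sum_axis_Bvec: "(\<Sum>i\<in>UNIV. (s *\<^sub>R axis j (1::real)) $ i *\<^sub>R Bvec i) = s *\<^sub>R Bvec j"
  by (simp add: axis_def if_distrib[of "\<lambda>x. x *\<^sub>R _"] if_distrib[of "\<lambda>x. _ * x"] cong: if_cong)

lemma clifford_group_mult: "U \<in> clifford \<Longrightarrow> W \<in> clifford \<Longrightarrow> U ** W \<in> clifford"
  unfolding clifford_def by (metis generate.eng mult_U4(1))

lemma clifford_unitary: "U \<in> clifford \<Longrightarrow> unitary U"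
  using clifford_level by (auto simp: so6_level_def)

lemma clifford_dagger: "U \<in> clifford \<Longrightarrow> dagger U \<in> clifford"
proof -
  assume U: "U \<in> clifford"
  have "{kron gateH Id2, kron Id2 gateH, kron gateS Id2, kron Id2 gateS, gateCZ} \<subseteq> carrier U4"
    using gates_unitary by simp
  from group.generate_m_inv_closed[OF group_U4 this] U
  have "inv\<^bsub>U4\<^esub> U \<in> clifford" unfolding clifford_def by blast
  then show ?thesis using inv_U4 clifford_unitary[OF U] by simp
qed

text \<open>The primitive eighth root of unity is produced by the relation that the cube of SH is a
  scalar.\<close>

lemma clifford_phase:
  assumes "z ^ 8 = 1"
  shows "mscale z (mat 1) \<in> clifford"
proof -
  define w where "w = exp (2 * of_real pi * \<i> / 8)"
  have w: "w = (1 + \<i>) / of_real (sqrt 2)"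
  proof -
    have w: "w = cis (pi / 4)" by (simp add: w_def cis_conv_exp mult_ac)
    have r: "sqrt 2 / 2 = 1 / sqrt 2" by (simp add: field_simps)
    show ?thesis
      unfolding w by (simp add: complex_eq_iff cos_45 sin_45 r)
  qed
  let ?g = "gateS ** gateH"
  have "?g ** (?g ** ?g) = mscale w (mat 1)"
    by (simp add: w vec_eq_iff forall_2 matrix_matrix_mult_def sum_2 Clifford_gate_nth
        gateH_hadamard hadamard_nth mat_def field_simps)
  moreover have "kron (?g ** (?g ** ?g)) Id2 = (kron gateS Id2 ** kron gateH Id2) **
      ((kron gateS Id2 ** kron gateH Id2) ** (kron gateS Id2 ** kron gateH Id2))"
    by (simp add: kron_mult)
  moreover have "kron gateS Id2 \<in> clifford" "kron gateH Id2 \<in> clifford"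
    unfolding clifford_def by (auto intro: generate.incl)
  ultimately have "kron (mscale w (mat 1)) Id2 \<in> clifford"
    by (metis clifford_group_mult)
  then have W: "mscale w (mat 1) \<in> clifford" by (simp add: kron_mat1)
  have pow: "mscale (w ^ n) (mat 1) \<in> clifford" for n
  proof (induction n)
    case 0
    show ?case unfolding clifford_def using generate.one[of U4] by simp
  next
    case (Suc n)
    then show ?case using clifford_group_mult[OF W Suc] by (simp add: mscale_mult_left)
  qed
  obtain j where "z = exp (2 * of_real pi * \<i> * of_nat j / of_nat 8)"
    using complex_roots_unity[of 8] assms by auto
  then have "z = w ^ j"
    by (simp add: w_def mult_ac flip: exp_of_nat_mult)
  then show ?thesis using pow by simp
qed

lemma square_eq_power_2:
  assumes "(z::int) * z = 2 ^ l"
  shows "even l"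
  using assms
proof (induction l arbitrary: z rule: less_induct)
  case (less l)
  show ?case
  proof (cases "l = 0")
    case False
    then have "even (z * z)" using less.prems by simp
    then obtain w where w: "z = 2 * w" by auto
    show ?thesis
    proof (cases "l = 1")
      case True
      with less.prems w show ?thesis by simp presburger
    next
      case False
      with \<open>l \<noteq> 0\<close> obtain k where k: "l = Suc (Suc k)" by (metis One_nat_def not0_implies_Suc)
      with less.prems w have "w * w = 2 ^ k" by simp
      with less.IH[of k w] k show ?thesis by simp
    qed
  qed simp
qed

lemma sqrt2_power_Ints:
  assumes "sqrt 2 ^ l \<in> \<int>"
  shows "even l"
proof -
  obtain z where z: "sqrt 2 ^ l = real_of_int z" using assms by (auto elim: Ints_cases)
  have "real_of_int (z * z) = (sqrt 2 * sqrt 2) ^ l"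
    by (simp only: of_int_mult power_mult_distrib flip: z)
  then have "real_of_int (z * z) = of_int (2 ^ l)" by simp
  then have "z * z = 2 ^ l" by (simp only: of_int_eq_iff)
  then show ?thesis by (rule square_eq_power_2)
qed

text \<open>An integral orthogonal matrix has an entry 1 or -1, so sqrt 2 ^ l itself is an integer.
  Evenness of the level then says that the determinant of \<open>U\<close> has square 1.\<close>

lemma integral_level_even:
  assumes "so6_level l U" "so6_rep U V" "\<And>i j. V $ i $ j \<in> \<int>"
  shows "even l"
proof -
  obtain k where "V *v axis 1 1 = axis k 1 \<or> V *v axis 1 1 = - axis k 1"
    using integral_unit_column[OF so6_rep_level_props(1)[OF assms(1,2)] assms(3)] by blast
  then have "(V *v axis 1 1) $ k = 1 \<or> (V *v axis 1 1) $ k = - 1"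
    by auto
  then have "V $ k $ 1 = 1 \<or> V $ k $ 1 = - 1" by (simp add: matrix_vector_axis)
  then show ?thesis
    using so6_rep_level_props(2)[OF assms(1,2), of k 1] sqrt2_power_Ints by auto
qed

lemma clifford_if_integral:
  assumes "so6_level l U" "so6_rep U V" "\<And>i j. V $ i $ j \<in> \<int>"
  shows "U \<in> clifford"
proof -
  have U: "unitary U" "det U ^ 2 = 1"
    using assms(1) integral_level_even[OF assms] by (auto simp: so6_level_def)
  note oV = so6_rep_level_props(1)[OF assms(1,2)]
  obtain W where W: "clifford_mat W" "\<forall>i<5. (W ** V) *v path_axis i = path_axis i"
    using clifford_mat_reduce[OF oV assms(3), of 5] by auto
  obtain C where C: "C \<in> clifford" "so6_rep C W" using W(1) by (auto simp: clifford_mat_def)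
  define D where "D = W ** V"
  have oD: "orthogonal_matrix D"
    unfolding D_def using clifford_mat_props(1)[OF W(1)] oV by (rule orthogonal_matrix_mul)
  have iD: "D $ i $ j \<in> \<int>" for i j
    unfolding D_def matrix_matrix_mult_def using clifford_mat_props(2)[OF W(1)] assms(3)
    by (simp, intro Ints_sum Ints_mult) auto
  have fixes_axis: "D *v path_axis i = path_axis i" if "i < 5" for i using W(2) that
      by (simp add: D_def)
  obtain m where m: "m < 6" "D *v path_axis 5 = path_axis m \<or> D *v path_axis 5 = - path_axis m"
    using integral_unit_column[OF oD iD] path_axis_surj unfolding path_axis_def[of 5] by metis
  have "m = 5"
  proof (rule ccontr)
    assume "m \<noteq> 5"
    then have "D *v path_axis 5 = D *v path_axis m \<or> D *v path_axis 5 = D *v (- path_axis m)"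
      using fixes_axis[of m] m by (simp add: mult_minus_vec)
    then have "path_axis 5 = path_axis m \<or> path_axis 5 = - path_axis m"
      using orthogonal_matrix_inj[OF oD] by blast
    then show False
      using path_axis_eq_iff[of 5 m] m(1) \<open>m \<noteq> 5\<close> path_axis_minus by auto
  qed
  then obtain s where s: "D *v axis 4 1 = s *\<^sub>R axis 4 1"
    using m(2) by (auto simp: path_axis_def intro: that[of 1] that[of "-1"])
  have "so6_rep (C ** U) D" unfolding D_def by (rule so6_rep_mult[OF C(2) assms(2)])
  then obtain z where z: "cmod z = 1" "represents D (mscale z (C ** U))"
    by (auto simp: so6_rep_def)
  have "ext2 (mscale z (C ** U)) (Bvec j) = Bvec j" if "j \<noteq> 4" for j
  proof -
    obtain n where n: "n < 6" "axis j (1::real) = path_axis n" using path_axis_surj by blast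
    then have "n \<noteq> 5" using that by (auto simp: path_axis_def axis_eq_axis)
    then have "D *v axis j 1 = 1 *\<^sub>R axis j 1" using n fixes_axis[of n] by simp
    then show ?thesis
      using represents_column[OF z(2), of j] sum_axis_Bvec[of 1 j] by simp
  qed
  moreover have "ext2 (mscale z (C ** U)) (Bvec 4) = s *\<^sub>R Bvec 4"
    using represents_column[OF z(2), of 4] unfolding s sum_axis_Bvec .
  moreover have uCU: "unitary (C ** U)"
    by (rule unitary_mult[OF clifford_unitary[OF C(1)] U(1)])
  ultimately obtain w where w: "mscale z (C ** U) = mscale w (mat 1)"
    using represents_diag_kernel[OF unitary_mscale[OF z(1) uCU]] by blast
  have "z \<noteq> 0" using z(1) by auto
  then have CU: "C ** U = mscale (w / z) (mat 1)"
    using arg_cong[OF w, of "mscale (1 / z)"] by simp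
  \<comment> \<open>A scalar has its fourth power as determinant, so squared determinant 1 makes the
    scalar an eighth root of unity.\<close>
  have "det C ^ 2 = 1" using clifford_level[OF C(1)] by (simp add: so6_level_def)
  then have "det (C ** U) ^ 2 = 1" using U(2) by (simp add: det_mul power_mult_distrib)
  then have "((w / z) ^ 4) ^ 2 = 1" by (simp add: CU det_mscale)
  then have "(w / z) ^ 8 = 1" by (simp flip: power_mult)
  then have "C ** U \<in> clifford" unfolding CU by (rule clifford_phase)
  then have "dagger C ** (C ** U) \<in> clifford"
    by (rule clifford_group_mult[OF clifford_dagger[OF C(1)]])
  then show ?thesis
    using clifford_unitary[OF C(1)] by (simp add: matrix_mul_assoc unitary_def)
qed

section \<open>Denominator exponents and row residues\<close>

definition matching :: "(6 \<times> 6) list \<Rightarrow> bool" where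
  "matching l \<longleftrightarrow> (\<forall>i. mate l (mate l i) = i \<and> mate l i \<noteq> i \<and> orient l (mate l i) = - orient l i \<and>
     (orient l i = 1 \<or> orient l i = - 1))"

lemma matching_arcs: "s \<in> {1..15} \<Longrightarrow> matching (arcs s)"
proof -
  assume "s \<in> {1..15}"
  then have "s - 1 < length arcs_list" by (auto simp: arcs_list_def)
  moreover have "list_all matching arcs_list"
    by (simp add: arcs_list_def matching_def forall_6)
  ultimately show ?thesis by (simp add: list_all_length arcs_def)
qed

lemma rotM_mult_nth:
  assumes "matching l"
  shows "(rotM l ** V) $ i $ k = V $ i $ k + of_int (orient l i) * V $ mate l i $ k"
    and "(transpose (rotM l) ** V) $ i $ k = V $ i $ k - of_int (orient l i) * V $ mate l i $ k"
proof -
  have m: "mate l i \<noteq> i" "mate l (mate l i) = i" "orient l (mate l i) = - orient l i"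
    using assms by (auto simp: matching_def)
  have mm: "i = mate l j \<longleftrightarrow> j = mate l i" for j
    using assms by (metis matching_def)
  have "rotM l $ i $ j * V $ j $ k = (if j = i then V $ i $ k else 0) +
      (if j = mate l i then of_int (orient l i) * V $ mate l i $ k else 0)" for j
    using m by (simp add: rotM_def)
  then show "(rotM l ** V) $ i $ k = V $ i $ k + of_int (orient l i) * V $ mate l i $ k"
    by (simp add: matrix_matrix_mult_def sum.distrib)
  have "rotM l $ j $ i * V $ j $ k = (if j = i then V $ i $ k else 0) +
      (if j = mate l i then - of_int (orient l i) * V $ mate l i $ k else 0)" for j
    using m mm[of j] by (simp add: rotM_def)
  then show "(transpose (rotM l) ** V) $ i $ k = V $ i $ k - of_int (orient l i) * V $ mate l i $ k"
    by (simp add: matrix_matrix_mult_def transpose_def sum.distrib)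
qed

lemma smat_mult_nth:
  assumes "s \<in> {1..15}"
  shows "sqrt 2 * (smat s ** V) $ i $ k =
      V $ i $ k + of_int (orient (arcs s) i) * V $ mate (arcs s) i $ k"
    and "sqrt 2 * (transpose (smat s) ** V) $ i $ k =
        V $ i $ k - of_int (orient (arcs s) i) * V $ mate (arcs s) i $ k"
proof -
  have "smat s ** V = (1 / sqrt 2) *\<^sub>R (rotM (arcs s) ** V)"
    "transpose (smat s) ** V = (1 / sqrt 2) *\<^sub>R (transpose (rotM (arcs s)) ** V)"
    by (simp_all add: smat_def vec_eq_iff matrix_matrix_mult_def transpose_def sum_distrib_left
        mult.assoc sum_divide_distrib)
  then show "sqrt 2 * (smat s ** V) $ i $ k =
      V $ i $ k + of_int (orient (arcs s) i) * V $ mate (arcs s) i $ k"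
    "sqrt 2 * (transpose (smat s) ** V) $ i $ k =
        V $ i $ k - of_int (orient (arcs s) i) * V $ mate (arcs s) i $ k"
    by (simp_all add: rotM_mult_nth[OF matching_arcs[OF assms]])
qed

text \<open>The antisymmetric part J of \<open>rotM\<close> squares to -1, because mates have
  opposite orientation; hence (1 - J)(1 + J) = 2. The calculation follows single rows, on which J
  acts by passing to the mate with a sign.\<close>

lemma smat_inverse:
  assumes "s \<in> {1..15}"
  shows "transpose (smat s) ** (smat s ** V) = V" "smat s ** (transpose (smat s) ** V) = V"
proof -
  let ?o = "\<lambda>i. of_int (orient (arcs s) i) :: real" and ?m = "mate (arcs s)"
  have m: "?m (?m i) = i" "?o (?m i) = - ?o i" "?o i * ?o i = 1" for i
    using matching_arcs[OF assms]
        by (auto simp: matching_def) (metis mult_1 of_int_1 square_eq_1_iff of_int_minus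
        mult_minus_left mult_minus_right minus_minus)
  note e = smat_mult_nth[OF assms]
  have "2 * (transpose (smat s) ** (smat s ** V)) $ i $ k = 2 * V $ i $ k" for i k
  proof -
    have "2 * (transpose (smat s) ** (smat s ** V)) $ i $ k =
        sqrt 2 * (sqrt 2 * (transpose (smat s) ** (smat s ** V)) $ i $ k)"
      by (simp flip: mult.assoc)
    also have "\<dots> = sqrt 2 * (smat s ** V) $ i $ k - ?o i * (sqrt 2 * (smat s ** V) $ ?m i $ k)"
      by (simp add: e(2) algebra_simps)
    also have "\<dots> = V $ i $ k + (?o i * ?o i) * V $ i $ k"
      by (simp add: e(1) m(1,2) algebra_simps)
    finally show ?thesis by (simp add: m(3))
  qed
  then show "transpose (smat s) ** (smat s ** V) = V" by (simp add: vec_eq_iff)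
  have "2 * (smat s ** (transpose (smat s) ** V)) $ i $ k = 2 * V $ i $ k" for i k
  proof -
    have "2 * (smat s ** (transpose (smat s) ** V)) $ i $ k =
        sqrt 2 * (sqrt 2 * (smat s ** (transpose (smat s) ** V)) $ i $ k)"
      by (simp flip: mult.assoc)
    also have "\<dots> = sqrt 2 * (transpose (smat s) ** V) $ i $ k + ?o i * (sqrt 2 * (transpose (smat
        s) ** V) $ ?m i $ k)"
      by (simp add: e(1) algebra_simps)
    also have "\<dots> = V $ i $ k + (?o i * ?o i) * V $ i $ k"
      by (simp add: e(2) m(1,2) algebra_simps)
    finally show ?thesis by (simp add: m(3))
  qed
  then show "smat s ** (transpose (smat s) ** V) = V" by (simp add: vec_eq_iff)
qed

lemma orthogonal_smat: "s \<in> {1..15} \<Longrightarrow> orthogonal_matrix (smat s)"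
  using smat_inverse(1)[of s "mat 1"] by (simp add: orthogonal_matrix)

lemma Sgen_level:
  assumes "s \<in> {1..15}"
  shows "so6_level 1 (Sgen s)"
proof -
  have "sqrt 2 ^ 1 * smat s $ i $ j \<in> \<int>" for i j
    using smat_mult_nth(1)[OF assms, of "mat 1" i j] unfolding matrix_mul_rid by (simp add: mat_def)
  then show ?thesis
    unfolding so6_level_def using Sgen_rep[OF assms] orthogonal_smat[OF assms] by auto
qed

lemma gateCS_eq: "gateCS = Sgen 3"
proof -
  have p: "kron PZ Id2 ** kron PZ Id2 = mat 1" "kron Id2 PZ ** kron Id2 PZ = mat 1"
    "kron PZ Id2 ** kron Id2 PZ = kron Id2 PZ ** kron PZ Id2"
    by (simp_all add: kron_mult pauli_mult kron_mat1)
  have "Sgen 3 = Sproj (kron PZ Id2) (kron Id2 PZ)"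
    by (simp add: Sgen_def pauli_pairs_def rotR_eq_Sproj[OF p])
  then show ?thesis
    by (simp add: vec_eq_iff forall_4 gateCS_def diag4_def Sproj_pauli_nth complex_eq_iff)
qed

lemma clifford_CS_level: "U \<in> clifford_CS \<Longrightarrow> \<exists>l. so6_level l U"
proof -
  assume "U \<in> clifford_CS"
  then have "\<exists>l\<in>UNIV. so6_level l U"
    unfolding clifford_CS_def
    by (rule generate_U4_level) (use clifford_level Sgen_level[of 3] in \<open>auto simp: gateCS_eq\<close>)
  then show ?thesis by blast
qed

text \<open>The residue of a row modulo 2 is encoded as the set of columns with odd entries, so that
  addition becomes symmetric difference. Integrality at exponent \<open>l\<close> is part of the
  relation, minimality of \<open>l\<close> is not.\<close>

definition residues :: "real^6^6 \<Rightarrow> nat \<Rightarrow> (6 \<Rightarrow> 6 set) \<Rightarrow> bool" where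
  "residues V l r \<longleftrightarrow> (\<exists>M. \<forall>i k. sqrt 2 ^ l * V $ i $ k = of_int (M i k) \<and> (k \<in> r i \<longleftrightarrow> odd (M i k)))"

lemma residues_unique: "residues V l r \<Longrightarrow> residues V l r' \<Longrightarrow> r = r'"
  unfolding residues_def by (auto simp: fun_eq_iff)

lemma residues_ex: "(\<forall>i j. sqrt 2 ^ l * V $ i $ j \<in> \<int>) \<longleftrightarrow> (\<exists>r. residues V l r)"
proof
  assume "\<forall>i j. sqrt 2 ^ l * V $ i $ j \<in> \<int>"
  then have "\<forall>i j. \<exists>z. sqrt 2 ^ l * V $ i $ j = of_int z" by (metis Ints_cases)
  then obtain M where M: "\<And>i j. sqrt 2 ^ l * V $ i $ j = of_int (M i j)" by metis
  then have "residues V l (\<lambda>i. {k. odd (M i k)})"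
    unfolding residues_def by (intro exI[of _ M]) simp
  then show "\<exists>r. residues V l r" by blast
qed (auto simp: residues_def)

lemma residues_minus: "residues V l r \<Longrightarrow> residues (- V) l r"
proof -
  assume "residues V l r"
  then obtain M where "\<And>i k. sqrt 2 ^ l * V $ i $ k = of_int (M i k) \<and> (k \<in> r i \<longleftrightarrow> odd (M i k))"
    by (auto simp: residues_def)
  then show ?thesis unfolding residues_def by (intro exI[of _ "\<lambda>i k. - M i k"]) simp
qed

text \<open>
  The exponents \<open>l\<close> with \<open>sqrt 2 ^ l * V\<close> integral all have the same parity, so they are not
  closed upwards; oddness of a single entry still forces minimality.
\<close>

lemma lde_eqI:
  assumes "residues V l r" "r i \<noteq> {}"
  shows "lde V = l"
  unfolding lde_def
proof (rule Least_equality)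
  show "\<forall>i j. sqrt 2 ^ l * V $ i $ j \<in> \<int>" using assms(1) residues_ex by blast
  obtain M where M: "\<And>i k. sqrt 2 ^ l * V $ i $ k = of_int (M i k) \<and> (k \<in> r i \<longleftrightarrow> odd (M i k))"
    using assms(1) by (auto simp: residues_def)
  obtain k where k: "odd (M i k)" using assms(2) M by blast
  fix l' assume "\<forall>i j. sqrt 2 ^ l' * V $ i $ j \<in> \<int>"
  then obtain z where z: "sqrt 2 ^ l' * V $ i $ k = of_int z" by (metis Ints_cases)
  show "l \<le> l'"
  proof (rule ccontr)
    assume "\<not> l \<le> l'"
    then obtain d where d: "l = Suc d + l'"
        by (metis add.commute add_Suc_right less_iff_Suc_add not_le)
    have "real_of_int (M i k) = sqrt 2 ^ Suc d * of_int z"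
      using M[of i k] z by (simp add: d power_add mult_ac flip: z)
    then have "real_of_int (M i k) * real_of_int (M i k) =
        (sqrt 2 * sqrt 2) ^ Suc d * (of_int z * of_int z)"
      by (simp only: power_mult_distrib mult_ac)
    also have "\<dots> = of_int (2 ^ Suc d * (z * z))" by simp
    finally have "M i k * M i k = 2 ^ Suc d * (z * z)"
        by (simp only: flip: of_int_mult of_int_eq_iff)
    then have "even (M i k * M i k)" by simp
    with k show False by simp
  qed
qed

text \<open>If all entries were even at the least exponent, that exponent could be lowered by 2. For
  exponents 0 and 1, where this is impossible, the norm of a row would make 4 divide 1 or 2.\<close>

lemma lde_residues:
  assumes "residues V l r" "orthogonal_matrix V"
  shows "\<exists>r'. residues V (lde V) r' \<and> (\<exists>i. r' i \<noteq> {})"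
proof -
  have "\<forall>i j. sqrt 2 ^ lde V * V $ i $ j \<in> \<int>"
    unfolding lde_def using assms(1) residues_ex
        by (intro LeastI_ex[of "\<lambda>l. \<forall>i j. sqrt 2 ^ l * V $ i $ j \<in> \<int>"]) blast
  then obtain r' where r': "residues V (lde V) r'" using residues_ex by blast
  then obtain M where M: "\<And>i k. sqrt 2 ^ lde V * V $ i $ k = of_int (M i k) \<and> (k \<in> r' i \<longleftrightarrow>
      odd (M i k))"
    by (auto simp: residues_def)
  have "\<exists>i. r' i \<noteq> {}"
  proof (rule ccontr)
    assume "\<not> (\<exists>i. r' i \<noteq> {})"
    then have "even (M i k)" for i k using M by auto
    then have N: "M i k = 2 * N i k" if "N = (\<lambda>i k. M i k div 2)" for i k N using that by simp
    define N where "N = (\<lambda>i k. M i k div 2)"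
    note N = N[OF N_def]
    then have e: "sqrt 2 ^ lde V * V $ i $ k = 2 * of_int (N i k)" for i k
      using M[of i k] by simp
    show False
    proof (cases "lde V \<ge> 2")
      case True
      then obtain d where d: "lde V = Suc (Suc d)" by (metis add_2_eq_Suc le_Suc_ex)
      have "sqrt 2 ^ d * V $ i $ k = of_int (N i k)" for i k
        using e[of i k] by (simp add: d flip: mult.assoc)
      then have "\<forall>i j. sqrt 2 ^ d * V $ i $ j \<in> \<int>" by simp
      then have "lde V \<le> d" unfolding lde_def by (rule Least_le)
      then show False using d by simp
    next
      case False
      then have l: "lde V = 0 \<or> lde V = 1" by auto
      have "(V ** transpose V) $ 1 $ 1 = 1"
        using assms(2) by (simp add: orthogonal_matrix_def mat_def)
      then have s: "(\<Sum>k\<in>UNIV. V $ 1 $ k * V $ 1 $ k) = 1"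
        by (simp add: matrix_matrix_mult_def transpose_def)
      have "(sqrt 2 ^ lde V * sqrt 2 ^ lde V) * (\<Sum>k\<in>UNIV. V $ 1 $ k * V $ 1 $ k)
          = (\<Sum>k\<in>UNIV. (sqrt 2 ^ lde V * V $ 1 $ k) * (sqrt 2 ^ lde V * V $ 1 $ k))"
        by (simp add: sum_distrib_left mult_ac)
      also have "\<dots> = of_int (4 * (\<Sum>k\<in>UNIV. N 1 k * N 1 k))"
        unfolding e by (simp add: sum_distrib_left mult_ac)
      finally have "of_int (4 * (\<Sum>k\<in>UNIV. N 1 k * N 1 k)) = (of_int (2 ^ lde V) :: real)"
        using l s by auto
      then have "4 * (\<Sum>k\<in>UNIV. N 1 k * N 1 k) = 2 ^ lde V" by (simp only: of_int_eq_iff)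
      then have "4 dvd (2::int) ^ lde V" by (metis dvd_triv_left)
      then show False using l by auto
    qed
  qed
  with r' show ?thesis by blast
qed

lemma residues_step:
  assumes "residues V l r" "s \<in> {1..15}"
  shows "residues (smat s ** V) (Suc l) (\<lambda>i. sym_diff (r i) (r (mate (arcs s) i)))"
    and "residues (transpose (smat s) ** V) (Suc l) (\<lambda>i. sym_diff (r i) (r (mate (arcs s) i)))"
proof -
  let ?o = "orient (arcs s)" and ?m = "mate (arcs s)"
  obtain M where M: "\<And>i k. sqrt 2 ^ l * V $ i $ k = of_int (M i k)" "\<And>i k. k \<in> r i \<longleftrightarrow> odd (M i k)"
    using assms(1) by (auto simp: residues_def)
  have o: "odd (?o i)" for i using matching_arcs[OF assms(2)] unfolding matching_def
      by (metis even_minus odd_one)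
  have "sqrt 2 ^ Suc l * (smat s ** V) $ i $ k = of_int (M i k + ?o i * M (?m i) k)"
    "sqrt 2 ^ Suc l * (transpose (smat s) ** V) $ i $ k = of_int (M i k - ?o i * M (?m i) k)"
        for i k
  proof -
    have "sqrt 2 ^ Suc l * (smat s ** V) $ i $ k = sqrt 2 ^ l * (sqrt 2 * (smat s ** V) $ i $ k)"
      "sqrt 2 ^ Suc l * (transpose (smat s) ** V) $ i $ k =
          sqrt 2 ^ l * (sqrt 2 * (transpose (smat s) ** V) $ i $ k)"
      by simp_all
    then show "sqrt 2 ^ Suc l * (smat s ** V) $ i $ k = of_int (M i k + ?o i * M (?m i) k)"
       "sqrt 2 ^ Suc l * (transpose (smat s) ** V) $ i $ k = of_int (M i k - ?o i * M (?m i) k)"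
      unfolding smat_mult_nth[OF assms(2)]
      by (simp_all add: algebra_simps flip: M(1))
  qed
  then show "residues (smat s ** V) (Suc l) (\<lambda>i. sym_diff (r i) (r (?m i)))"
    "residues (transpose (smat s) ** V) (Suc l) (\<lambda>i. sym_diff (r i) (r (?m i)))"
    unfolding residues_def
    by (intro exI[of _ "\<lambda>i k. M i k + ?o i * M (?m i) k"]
        exI[of _ "\<lambda>i k. M i k - ?o i * M (?m i) k"];
        use M(2) o in auto)+
qed

lemma lde_smat_mult:
  assumes "residues V l r" "s \<in> {1..15}" "r i \<noteq> r (mate (arcs s) i)"
  shows "lde (smat s ** V) = Suc l"
  by (rule lde_eqI[OF residues_step(1)[OF assms(1,2)], of i]) (use assms(3) in auto)

text \<open>Both directions go back from the product to \<open>V\<close>: the residue of a row of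
  \<open>V\<close> is the sum of a residue \<open>q\<close> and that of its mate. Such sums agree on
  matched rows, and they would all vanish if \<open>q\<close> did; so a nonzero row of
  \<open>V\<close> also yields an odd entry at exponent \<open>l - 1\<close>.\<close>

lemma lde_reduces_iff:
  assumes V: "orthogonal_matrix V" "residues V l r" "r i \<noteq> {}" and "l > 0" and s: "s \<in> {1..15}"
  shows "lde (transpose (smat s) ** V) = l - 1 \<longleftrightarrow> (\<forall>i. r i = r (mate (arcs s) i))"
proof
  let ?W = "transpose (smat s) ** V" and ?m = "mate (arcs s)"
  have o: "orthogonal_matrix ?W"
    using orthogonal_smat[OF s] V(1)
        by (simp add: orthogonal_matrix_mul orthogonal_matrix_transpose)
  have m: "?m (?m i) = i" for i using matching_arcs[OF s] by (simp add: matching_def)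
  show "\<forall>i. r i = r (?m i)" if lde: "lde ?W = l - 1"
  proof -
    obtain q where "residues ?W (l - 1) q"
      using lde_residues[OF residues_step(2)[OF V(2) s] o] unfolding lde by blast
    from residues_step(1)[OF this s] have "residues V l (\<lambda>i. sym_diff (q i) (q (?m i)))"
      using \<open>l > 0\<close> by (simp add: smat_inverse[OF s])
    from residues_unique[OF V(2) this] show ?thesis by (auto simp: m)
  qed
  show "lde ?W = l - 1" if a: "\<forall>i. r i = r (?m i)"
  proof -
    let ?o = "orient (arcs s)"
    obtain M where M: "\<And>i k. sqrt 2 ^ l * V $ i $ k = of_int (M i k)" "\<And>i k. k \<in> r i \<longleftrightarrow> odd (M i k)"
      using V(2) by (auto simp: residues_def)
    have "sqrt 2 ^ (l - 1) * ?W $ i $ k \<in> \<int>" for i k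
    proof -
      have "odd (?o i)" using matching_arcs[OF s] unfolding matching_def
          by (metis even_minus odd_one)
      then have "even (M i k - ?o i * M (?m i) k)"
        using a M(2)[of k i] M(2)[of k "?m i"] by auto
      then obtain z where z: "M i k - ?o i * M (?m i) k = 2 * z" by blast
      have "2 * (sqrt 2 ^ (l - 1) * ?W $ i $ k) = sqrt 2 ^ l * (sqrt 2 * ?W $ i $ k)"
        using \<open>l > 0\<close> by (cases l) auto
      also have "\<dots> = of_int (M i k - ?o i * M (?m i) k)"
        unfolding smat_mult_nth[OF s] by (simp add: algebra_simps flip: M(1))
      finally show ?thesis unfolding z by simp
    qed
    then obtain q where q: "residues ?W (l - 1) q" using residues_ex by blast
    from residues_step(1)[OF this s] have "residues V l (\<lambda>i. sym_diff (q i) (q (?m i)))"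
      using \<open>l > 0\<close> by (simp add: smat_inverse[OF s])
    from residues_unique[OF V(2) this] V(3) have "q i \<noteq> {} \<or> q (?m i) \<noteq> {}" by auto
    then show ?thesis using lde_eqI[OF q] by blast
  qed
qed

lemma pattern_eq:
  assumes "residues V (lde V) r"
  shows "pattern V = (\<lambda>i. {j. r j = r i}) ` UNIV"
proof -
  obtain M where M: "\<And>i k. sqrt 2 ^ lde V * V $ i $ k = of_int (M i k)"
      "\<And>i k. k \<in> r i \<longleftrightarrow> odd (M i k)"
    using assms by (auto simp: residues_def)
  have "(\<exists>z::int. sqrt 2 ^ lde V * V $ i $ k - sqrt 2 ^ lde V * V $ j $ k = 2 * of_int z)
      \<longleftrightarrow> (k \<in> r i \<longleftrightarrow> k \<in> r j)" for i j k
  proof -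
    have "sqrt 2 ^ lde V * V $ i $ k - sqrt 2 ^ lde V * V $ j $ k = 2 * of_int z
        \<longleftrightarrow> real_of_int (M i k - M j k) = of_int (2 * z)" for z
      by (simp add: M(1))
    then have "(\<exists>z::int. sqrt 2 ^ lde V * V $ i $ k - sqrt 2 ^ lde V * V $ j $ k = 2 * of_int z)
        \<longleftrightarrow> 2 dvd (M i k - M j k)"
      by (simp only: of_int_eq_iff dvd_def)
    then show ?thesis by (simp add: M(2))
  qed
  then have "pattern V = UNIV // {(i, j). \<forall>k. k \<in> r i \<longleftrightarrow> k \<in> r j}"
    by (simp add: pattern_def)
  also have "{(i, j). \<forall>k. k \<in> r i \<longleftrightarrow> k \<in> r j} = {(i, j). r i = r j}"
    by blast
  also have "UNIV // {(i, j). r i = r j} = (\<lambda>i. {j. r j = r i}) ` UNIV"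
    by (auto simp: quotient_def Image_def)
  finally show ?thesis .
qed

section \<open>The finite transition system\<close>

definition ix :: "nat \<Rightarrow> 6" where
  "ix n = [1, 2, 3, 4, 5, 6] ! n"

text \<open>Row \<open>s - 1\<close> lists the partners in the \<open>s\<close>-th matching; points are shifted to \<open>0, \<dots>, 5\<close>.\<close>

definition mates_list :: "nat list list" where
  "mates_list =
    [[3, 2, 1, 0, 5, 4],
     [2, 4, 0, 5, 1, 3],
     [1, 0, 5, 4, 3, 2],
     [2, 5, 0, 4, 3, 1],
     [1, 0, 4, 5, 2, 3],
     [1, 0, 3, 2, 5, 4],
     [5, 2, 1, 4, 3, 0],
     [4, 2, 1, 5, 0, 3],
     [2, 3, 0, 1, 5, 4],
     [3, 4, 5, 0, 1, 2],
     [3, 5, 4, 0, 2, 1],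
     [5, 4, 3, 2, 1, 0],
     [4, 3, 5, 1, 0, 2],
     [4, 5, 3, 2, 0, 1],
     [5, 3, 4, 1, 2, 0]]"

definition mates :: "nat \<Rightarrow> nat list" where
  "mates s = mates_list ! (s - 1)"

text \<open>Two perfect matchings have a common block iff some point has the same partner in both,
  so the partner lists are compared pointwise.\<close>

definition block_disjoint :: "nat \<Rightarrow> nat \<Rightarrow> bool" where
  "block_disjoint s t \<longleftrightarrow> list_all2 (\<noteq>) (mates s) (mates t)"

text \<open>
  Phases count down from 3 as a word is extended to the left: phase 3 words consist of
  consecutive block-disjoint letters, phase 2 is entered at the junction with the syllable
  over \<open>{10..15}\<close> and phase 1 at the junction with the one starting in \<open>{4..9}\<close>, in both cases
  through a common block. Phase 0 means rejection.
\<close>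

definition bound :: "nat \<Rightarrow> nat" where
  "bound p = (if p = 1 then 3 else if p = 2 then 9 else 15)"

definition next_phase :: "nat \<Rightarrow> nat \<Rightarrow> nat \<Rightarrow> nat" where
  "next_phase s t p = (if block_disjoint s t then (if s \<le> bound p then p else 0)
     else if p = 3 \<and> s \<le> 9 \<and> 10 \<le> t then 2
     else if 2 \<le> p \<and> s \<le> 3 \<and> 4 \<le> t \<and> t \<le> 9 then 1 else 0)"

text \<open>
  Residue classes are named by colours \<open>0, 1, 2\<close>. The symmetric difference of two classes is
  again determined by an integer, since distinct colours below 3 are determined by their sum.
\<close>

definition col_step :: "nat \<Rightarrow> nat list \<Rightarrow> nat list" where
  "col_step s c = map (\<lambda>(a, m). let b = c ! m in if a = b then 0 else a + b) (zip c (mates s))"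

definition refines :: "nat \<Rightarrow> nat list \<Rightarrow> bool" where
  "refines s c \<longleftrightarrow> list_all (\<lambda>(a, m). a = c ! m) (zip c (mates s))"

definition same_col :: "nat list \<Rightarrow> nat list \<Rightarrow> bool" where
  "same_col c d \<longleftrightarrow> (let zs = zip c d in list_all (\<lambda>(x, y). list_all (\<lambda>(u, v). (x = u) = (y =
      v)) zs) zs)"

text \<open>
  Phase, first letter and row colouring of the words that can occur: the closure of the 15
  one-letter words under \<open>next_phase\<close>.
\<close>

definition states_tab :: "(nat \<times> nat \<times> nat list) list" where
  "states_tab =
    [(1, 1, [0, 0, 0, 0, 1, 1]), (1, 1, [0, 1, 1, 0, 0, 0]), (1, 2, [0, 0, 0, 1, 0, 1]),
     (1, 2, [0, 1, 0, 1, 1, 1]), (1, 3, [0, 0, 0, 1, 1, 0]), (1, 3, [0, 0, 1, 1, 1, 1]),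
     (2, 1, [0, 1, 1, 0, 1, 1]), (2, 2, [0, 1, 0, 0, 1, 0]), (2, 3, [0, 0, 1, 0, 0, 1]),
     (2, 4, [0, 1, 0, 0, 0, 1]), (2, 5, [0, 0, 1, 0, 1, 0]), (2, 6, [0, 0, 1, 1, 0, 0]),
     (2, 7, [0, 1, 1, 1, 1, 0]), (2, 8, [0, 1, 1, 1, 0, 1]), (2, 9, [0, 1, 0, 1, 0, 0]),
     (3, 1, [0, 1, 1, 0, 2, 2]), (3, 2, [0, 1, 0, 2, 1, 2]), (3, 3, [0, 0, 1, 2, 2, 1]),
     (3, 4, [0, 1, 0, 2, 2, 1]), (3, 5, [0, 0, 1, 2, 1, 2]), (3, 6, [0, 0, 1, 1, 2, 2]),
     (3, 7, [0, 1, 1, 2, 2, 0]), (3, 8, [0, 1, 1, 2, 0, 2]), (3, 9, [0, 1, 0, 1, 2, 2]),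
     (3, 10, [0, 1, 2, 0, 1, 2]), (3, 11, [0, 1, 2, 0, 2, 1]), (3, 12, [0, 1, 2, 2, 1, 0]),
     (3, 13, [0, 1, 2, 1, 0, 2]), (3, 14, [0, 1, 2, 2, 0, 1]), (3, 15, [0, 1, 2, 1, 2, 0])]"

text \<open>Nested conditionals, because \<open>code_simp\<close> evaluates both sides of a conjunction.\<close>

definition state_ok :: "nat \<times> nat \<times> nat list \<Rightarrow> nat \<Rightarrow> bool" where
  "state_ok = (\<lambda>(p, t, c) s. let c' = col_step s c; q = next_phase s t p in
     if (if refines s c then False else \<not> list_ex (\<lambda>j. refines j c') [1..<s])
     then if q = 0 then False
       else list_ex (\<lambda>(p', t', d). if p' = q then
           if t' = s then same_col d c' else False else False) states_tab
     else q = 0)"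

lemma states_tab_closed: "list_all (\<lambda>x. list_all (state_ok x) [1..<16]) states_tab"
  by code_simp

lemma states_tab_wf: "list_all (\<lambda>(p, t, c). length c = 6 \<and> list_all (\<lambda>x. x \<le> 2) c) states_tab"
  by (simp add: states_tab_def)

text \<open>After one letter the classes are the blocks of its matching. The list of minima names
  each block by its smaller point, and \<open>same_col\<close> absorbs the renaming to colours below
  3.\<close>

lemma states_tab_init:
  "list_all (\<lambda>s. list_ex (\<lambda>(p, t, c). if p = 3 then if t = s then
       if same_col c (map (\<lambda>(a, b). min a b) (zip [0, 1, 2, 3, 4, 5] (mates s)))
       then \<not> list_ex (\<lambda>j. refines j c) [1..<s] else False else False else False) states_tab)
           [1..<16]"
  by code_simp

lemma ix_surj: "\<exists>n<6. x = ix n"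
proof -
  have "ix 0 = 1" "ix 1 = 2" "ix 2 = 3" "ix 3 = 4" "ix 4 = 5" "ix 5 = 6" by (simp_all add: ix_def)
  then have "x = ix 0 \<or> x = ix 1 \<or> x = ix 2 \<or> x = ix 3 \<or> x = ix 4 \<or> x = ix 5"
    using exhaust_6[of x] by auto
  moreover have "(0::nat) < 6" "(1::nat) < 6" "(2::nat) < 6" "(3::nat) < 6" "(4::nat) < 6"
      "(5::nat) < 6"
    by simp_all
  ultimately show ?thesis by blast
qed

lemma all_ix: "(\<forall>x. P x) \<longleftrightarrow> (\<forall>n<6. P (ix n))"
  using ix_surj by metis

lemma ix_eq_iff: "m < 6 \<Longrightarrow> n < 6 \<Longrightarrow> ix m = ix n \<longleftrightarrow> m = n"
  using less_6_cases[of m] less_6_cases[of n] by (auto simp: ix_def)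

lemma mates_ix:
  assumes "s \<in> {1..15}"
  shows "length (mates s) = 6" "n < 6 \<Longrightarrow> mates s ! n < 6"
      "n < 6 \<Longrightarrow> mate (arcs s) (ix n) = ix (mates s ! n)"
proof -
  have l: "s - 1 < length arcs_list" "s - 1 < length mates_list"
    using assms by (auto simp: arcs_list_def mates_list_def)
  have "list_all (\<lambda>(l, m). map (mate l) [1, 2, 3, 4, 5, 6] = map ix m \<and> length m = 6 \<and>
      list_all (\<lambda>x. x < 6) m)
      (zip arcs_list mates_list)"
    by (simp add: arcs_list_def mates_list_def ix_def)
  then have *: "map (mate (arcs s)) [1, 2, 3, 4, 5, 6] = map ix (mates s) \<and> length (mates s) = 6 \<and>
      list_all (\<lambda>x. x < 6) (mates s)"
    using l unfolding list_all_length by (auto simp: arcs_def mates_def)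
  then show "length (mates s) = 6" "n < 6 \<Longrightarrow> mates s ! n < 6" by (auto simp: list_all_length)
  assume n: "n < 6"
  have "mate (arcs s) (ix n) = map (mate (arcs s)) [1, 2, 3, 4, 5, 6] ! n"
    using n by (subst nth_map) (simp_all add: ix_def)
  also have "\<dots> = map ix (mates s) ! n"
    using * by (simp only:)
  also have "\<dots> = ix (mates s ! n)"
    using * n by (simp only: nth_map)
  finally show "mate (arcs s) (ix n) = ix (mates s ! n)" .
qed

lemma block_disjoint_iff:
  assumes "s \<in> {1..15}" "t \<in> {1..15}"
  shows "block_disjoint s t \<longleftrightarrow> (\<forall>x. mate (arcs s) x \<noteq> mate (arcs t) x)"
  unfolding all_ix block_disjoint_def list_all2_conv_all_nth
  using mates_ix[OF assms(1)] mates_ix[OF assms(2)] ix_eq_iff by auto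

text \<open>Only coincidence of values is recorded; colour 0 may well stand for a nonzero
  residue.\<close>

definition colours :: "(6 \<Rightarrow> 'a) \<Rightarrow> nat list \<Rightarrow> bool" where
  "colours r c \<longleftrightarrow> length c = 6 \<and> (\<forall>i<6. \<forall>j<6. r (ix i) = r (ix j) \<longleftrightarrow> c ! i = c ! j)"

lemma refines_iff:
  assumes "colours r c" "s \<in> {1..15}"
  shows "refines s c \<longleftrightarrow> (\<forall>x. r x = r (mate (arcs s) x))"
  unfolding all_ix refines_def list_all_length
  using assms(1) mates_ix[OF assms(2)] by (auto simp: colours_def)

lemma colours_same_col:
  assumes "colours r c" "same_col d c" "length d = 6"
  shows "colours r d"
proof -
  have "(d ! i = d ! j) = (c ! i = c ! j)" if "i < 6" "j < 6" for i j
  proof -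
    have l: "i < length (zip d c)" "j < length (zip d c)" using assms(1,3) that
        by (auto simp: colours_def)
    have "case zip d c ! i of (x, y) \<Rightarrow> list_all (\<lambda>(u, v). (x = u) = (y = v)) (zip d c)"
      using assms(2) l(1) unfolding same_col_def Let_def by (metis list_all_length)
    then have "list_all (\<lambda>(u, v). (d ! i = u) = (c ! i = v)) (zip d c)" using l(1) by simp
    then have "case zip d c ! j of (u, v) \<Rightarrow> (d ! i = u) = (c ! i = v)"
      using l(2) by (metis list_all_length)
    then show ?thesis using l(2) by simp
  qed
  then show ?thesis using assms(1,3) by (auto simp: colours_def)
qed

definition add_mate :: "nat \<Rightarrow> (6 \<Rightarrow> 6 set) \<Rightarrow> 6 \<Rightarrow> 6 set" where
  "add_mate s r = (\<lambda>i. sym_diff (r i) (r (mate (arcs s) i)))"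

text \<open>Among three values, two pairs of distinct ones always share a value. Cancelling it
  reduces equality of the sums to equality of the pairs, so no linear independence of the residues
  is required.\<close>

lemma sym_diff_colour:
  fixes a b c d :: nat and A B C D :: "'a set"
  assumes "a \<le> 2" "b \<le> 2" "c \<le> 2" "d \<le> 2"
    and eq: "A = B \<longleftrightarrow> a = b" "A = C \<longleftrightarrow> a = c" "A = D \<longleftrightarrow> a = d"
      "B = C \<longleftrightarrow> b = c" "B = D \<longleftrightarrow> b = d" "C = D \<longleftrightarrow> c = d"
  shows "sym_diff A B = sym_diff C D \<longleftrightarrow>
    (if a = b then 0 else a + b) = (if c = d then 0 else c + d)"
proof (cases "a = b \<or> c = d")
  case True
  then show ?thesis using eq(1,6) by auto
next
  case False
  have "a \<in> {0, 1, 2}" "b \<in> {0, 1, 2}" "c \<in> {0, 1, 2}" "d \<in> {0, 1, 2}"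
    using assms(1-4) by auto
  then have *: "a + b = c + d \<longleftrightarrow> a = c \<and> b = d \<or> a = d \<and> b = c" "a = c \<or> a = d \<or> b = c \<or> b = d"
    using False by auto
  have s: "sym_diff X Y = sym_diff X Z \<longleftrightarrow> Y = Z" "sym_diff X Y = sym_diff Y X" for X Y Z :: "'a set"
    by blast+
  have "sym_diff A B = sym_diff C D \<longleftrightarrow> A = C \<and> B = D \<or> A = D \<and> B = C"
    using *(2) unfolding eq[symmetric] by (metis s)
  then show ?thesis using False *(1) eq by simp
qed

lemma colours_add_mate:
  assumes "colours r c" "list_all (\<lambda>x. x \<le> 2) c" "s \<in> {1..15}"
  shows "colours (add_mate s r) (col_step s c)"
proof -
  have l: "length c = 6" and e: "\<And>i j. i < 6 \<Longrightarrow> j < 6 \<Longrightarrow> r (ix i) = r (ix j) \<longleftrightarrow> c ! i = c ! j"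
    using assms(1) by (auto simp: colours_def)
  have b: "\<And>i. i < 6 \<Longrightarrow> c ! i \<le> 2" using assms(2) l by (simp add: list_all_length)
  note m = mates_ix[OF assms(3)]
  have n: "col_step s c ! i = (if c ! i =
      c ! (mates s ! i) then 0 else c ! i + c ! (mates s ! i))" if "i < 6" for i
    using that l m(1) by (simp add: col_step_def Let_def)
  have "add_mate s r (ix i) = add_mate s r (ix j) \<longleftrightarrow> col_step s c ! i = col_step s c ! j"
    if "i < 6" "j < 6" for i j
    unfolding n[OF that(1)] n[OF that(2)] add_mate_def m(3)[OF that(1)] m(3)[OF that(2)]
    by (rule sym_diff_colour) (use that m(2) b e in auto)
  moreover have "length (col_step s c) = 6" using l m(1) by (simp add: col_step_def)
  ultimately show ?thesis by (simp add: colours_def)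
qed

definition in_state :: "nat \<Rightarrow> nat \<Rightarrow> (6 \<Rightarrow> 6 set) \<Rightarrow> bool" where
  "in_state p t r \<longleftrightarrow> (\<exists>c. (p, t, c) \<in> set states_tab \<and> colours r c)"

text \<open>Here \<open>r\<close> belongs to the matrix before multiplication by letter
  \<open>s\<close>. The first condition makes the exponent rise, so that \<open>s\<close> can be
  removed again; the second says that no letter of lower index lowers the exponent of the
  product.\<close>

definition greedy_step :: "nat \<Rightarrow> (6 \<Rightarrow> 6 set) \<Rightarrow> bool" where
  "greedy_step s r \<longleftrightarrow> (\<exists>x. r x \<noteq> r (mate (arcs s) x)) \<and>
     (\<forall>j\<in>{1..<s}. \<exists>x. add_mate s r x \<noteq> add_mate s r (mate (arcs j) x))"

lemma in_state_step:
  assumes "in_state p t r" "s \<in> {1..15}"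
  shows "greedy_step s r \<longleftrightarrow> next_phase s t p \<noteq> 0"
    and "next_phase s t p \<noteq> 0 \<Longrightarrow> in_state (next_phase s t p) s (add_mate s r)"
proof -
  obtain c where c: "(p, t, c) \<in> set states_tab" "colours r c" using assms(1)
      by (auto simp: in_state_def)
  have wf: "list_all (\<lambda>x. x \<le> 2) c" using states_tab_wf c(1) by (auto simp: list_all_iff)
  have "state_ok (p, t, c) s" using states_tab_closed c(1) assms(2) by (auto simp: list_all_iff)
  note ok = this[unfolded state_ok_def prod.case Let_def]
  note col = colours_add_mate[OF c(2) wf assms(2)]
  have g: "greedy_step s r \<longleftrightarrow> (if refines s c then False else \<not> list_ex (\<lambda>j.
      refines j (col_step s c)) [1..<s])"
  proof -
    have "refines j (col_step s c) \<longleftrightarrow> (\<forall>x. add_mate s r x = add_mate s r (mate (arcs j) x))"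
        if "j \<in> {1..<s}" for j
      using refines_iff[OF col, of j] that assms(2) by simp
    then show ?thesis
      using refines_iff[OF c(2) assms(2)] by (auto simp: greedy_step_def list_ex_iff)
  qed
  show "greedy_step s r \<longleftrightarrow> next_phase s t p \<noteq> 0"
    unfolding g using ok by (auto split: if_splits)
  show "in_state (next_phase s t p) s (add_mate s r)" if "next_phase s t p \<noteq> 0"
  proof -
    have "list_ex (\<lambda>(p', t', d). if p' = next_phase s t p then if t' =
        s then same_col d (col_step s c) else False else False) states_tab"
      using ok that by (auto split: if_splits)
    then obtain d where d: "(next_phase s t p, s, d) \<in> set states_tab" "same_col d (col_step s c)"
      by (auto simp: list_ex_iff split: if_splits)
    have "length d = 6" using states_tab_wf d(1) by (auto simp: list_all_iff)
    with colours_same_col[OF col d(2)] d(1) show ?thesis by (auto simp: in_state_def)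
  qed
qed

text \<open>What the first letter requires of the residues at exponent 0: a sum of two rows
  determines the pair, so that adding partners produces the blocks of the matching as
  classes.\<close>

definition independent :: "(6 \<Rightarrow> 6 set) \<Rightarrow> bool" where
  "independent r \<longleftrightarrow> (\<forall>a b. a \<noteq> b \<longrightarrow> r a \<noteq> r b) \<and>
     (\<forall>a b c d. a \<noteq> b \<longrightarrow> c \<noteq> d \<longrightarrow> sym_diff (r a) (r b) = sym_diff (r c) (r d) \<longrightarrow> {a, b} = {c, d})"

lemma independent_step:
  assumes "independent r" "s \<in> {1..15}"
  shows "greedy_step s r" "in_state 3 s (add_mate s r)"
proof -
  have m: "mate (arcs s) (mate (arcs s) x) = x" "mate (arcs s) x \<noteq> x" for x
    using matching_arcs[OF assms(2)] by (auto simp: matching_def)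
  have "s \<in> set [1..<16]" using assms(2) by auto
  then obtain c where c: "(3, s, c) \<in> set states_tab" "\<not> list_ex (\<lambda>j. refines j c) [1..<s]"
    "same_col c (map (\<lambda>(a, b). min a b) (zip [0, 1, 2, 3, 4, 5] (mates s)))"
  proof -
    have "list_ex (\<lambda>(p, t, c). if p = 3 then if t = s then
       if same_col c (map (\<lambda>(a, b). min a b) (zip [0, 1, 2, 3, 4, 5] (mates s)))
       then \<not> list_ex (\<lambda>j. refines j c) [1..<s] else False else False else False) states_tab"
      using states_tab_init \<open>s \<in> set [1..<16]\<close> unfolding list_all_iff by blast
    then show ?thesis using that unfolding list_ex_iff[of _ states_tab] by (auto split: if_splits)
  qed
  have "length c = 6" using states_tab_wf c(1) by (auto simp: list_all_iff)
  let ?d = "map (\<lambda>(a, b). min a b) (zip [0, 1, 2, 3, 4, 5] (mates s))"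
  note mi = mates_ix[OF assms(2)]
  have up: "[0, 1, 2, 3, 4, 5] = [0..<6]" by (simp add: upt_rec)
  have "add_mate s r x = add_mate s r y \<longleftrightarrow> y = x \<or> y = mate (arcs s) x" for x y
  proof
    assume "add_mate s r x = add_mate s r y"
    then have "{x, mate (arcs s) x} = {y, mate (arcs s) y}"
      using assms(1) m unfolding independent_def add_mate_def by metis
    then show "y = x \<or> y = mate (arcs s) x" by auto
  qed (auto simp: add_mate_def m)
  moreover have "?d ! i = ?d ! j \<longleftrightarrow> j = i \<or> j = mates s ! i" if "i < 6" "j < 6" for i j
  proof -
    have inv: "mates s ! (mates s ! k) = k" "mates s ! k \<noteq> k" if "k < 6" for k
      using m[of "ix k"] mi(2,3) that ix_eq_iff by metis+
    have "?d ! k = min k (mates s ! k)" if "k < 6" for k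
      unfolding up using that mi(1) by simp
    then have e: "?d ! i = min i (mates s ! i)" "?d ! j = min j (mates s ! j)" using that by blast+
    show ?thesis
    proof
      assume "?d ! i = ?d ! j"
      then have "i = j \<or> i = mates s ! j \<or> mates s ! i = j \<or> mates s ! i = mates s ! j"
        unfolding e by (auto simp: min_def split: if_splits)
      then show "j = i \<or> j = mates s ! i" using inv that by metis
    next
      assume "j = i \<or> j = mates s ! i"
      then show "?d ! i = ?d ! j" unfolding e using inv(1)[OF that(1)] by (auto simp: min.commute)
    qed
  qed
  ultimately have "colours (add_mate s r) ?d"
    unfolding colours_def by (simp add: mi ix_eq_iff)
  from colours_same_col[OF this c(3) \<open>length c = 6\<close>] have col: "colours (add_mate s r) c" .
  then show "in_state 3 s (add_mate s r)" using c(1) by (auto simp: in_state_def)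
  have "\<exists>x. add_mate s r x \<noteq> add_mate s r (mate (arcs j) x)" if "j \<in> {1..<s}" for j
    using refines_iff[OF col, of j] c(2) that assms(2) by (auto simp: list_ex_iff)
  moreover have "r 1 \<noteq> r (mate (arcs s) 1)" using assms(1) m(2)[of 1] by (metis independent_def)
  ultimately show "greedy_step s r" by (auto simp: greedy_step_def)
qed

fun phase :: "nat list \<Rightarrow> nat" where
  "phase [] = 3"
| "phase [s] = 3"
| "phase (s # t # js) = (if phase (t # js) = 0 then 0 else next_phase s t (phase (t # js)))"

fun word_state :: "nat list \<Rightarrow> (6 \<Rightarrow> 6 set) \<Rightarrow> bool" where
  "word_state [] r \<longleftrightarrow> independent r"
| "word_state (s # js) r \<longleftrightarrow> in_state (phase (s # js)) s r"

lemma word_state_step: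
  assumes "word_state js r" "phase js \<noteq> 0" "s \<in> {1..15}"
  shows "greedy_step s r \<longleftrightarrow> phase (s # js) \<noteq> 0"
    and "phase (s # js) \<noteq> 0 \<Longrightarrow> word_state (s # js) (add_mate s r)"
proof -
  have "(greedy_step s r \<longleftrightarrow> phase (s # js) \<noteq> 0) \<and> (phase (s # js) \<noteq> 0 \<longrightarrow>
      word_state (s # js) (add_mate s r))"
  proof (cases js)
    case Nil
    then show ?thesis using independent_step[of r s] assms by simp
  next
    case (Cons t js')
    then show ?thesis using in_state_step[of "phase js" t r s] assms by simp
  qed
  then show "greedy_step s r \<longleftrightarrow> phase (s # js) \<noteq> 0"
    "phase (s # js) \<noteq> 0 \<Longrightarrow> word_state (s # js) (add_mate s r)" by auto
qed

text \<open>
  Orthonormality is used modulo 2: an even combination of rows has even inner product with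
  each row.
\<close>

lemma integral_independent:
  assumes "orthogonal_matrix V" "residues V 0 r"
  shows "independent r"
proof -
  obtain M where M: "\<And>i k. V $ i $ k = of_int (M i k)" "\<And>i k. k \<in> r i \<longleftrightarrow> odd (M i k)"
    using assms(2) by (auto simp: residues_def)
  have o: "(\<Sum>k\<in>UNIV. M a k * M b k) = (if a = b then 1 else 0)" for a b
  proof -
    have "(V ** transpose V) $ a $ b = (if a = b then 1 else 0)"
      using assms(1) by (simp add: orthogonal_matrix_def mat_def)
    then have "of_int (\<Sum>k\<in>UNIV. M a k * M b k) = (of_int (if a = b then 1 else 0) :: real)"
      by (simp add: matrix_matrix_mult_def transpose_def M(1))
    then show ?thesis by (simp only: of_int_eq_iff)
  qed
  have "r a \<noteq> r b" if "a \<noteq> b" for a b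
  proof
    assume "r a = r b"
    then have "even (M a k * (M a k + M b k))" for k using M(2)[of k a] M(2)[of k b] by auto
    then have "even (\<Sum>k\<in>UNIV. M a k * (M a k + M b k))" by (simp add: dvd_sum)
    then show False using o[of a a] o[of a b] that by (simp add: distrib_left sum.distrib)
  qed
  moreover have not_in: "a \<in> {c, d}" if "a \<noteq> b" "sym_diff (r a) (r b) = sym_diff (r c) (r d)"
      for a b c d
  proof (rule ccontr)
    assume n: "a \<notin> {c, d}"
    have "even (M a k * (M a k + M b k + (M c k + M d k)))" for k
      using that(2) M(2)[of k a] M(2)[of k b] M(2)[of k c] M(2)[of k d] by (auto simp: set_eq_iff)
    then have "even (\<Sum>k\<in>UNIV. M a k * (M a k + M b k + (M c k + M d k)))" by (simp add: dvd_sum)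
    then show False
      using o[of a a] o[of a b] o[of a c] o[of a d] that(1) n
          by (simp add: distrib_left sum.distrib)
  qed
  have "{a, b} = {c, d}" if "a \<noteq> b" "sym_diff (r a) (r b) = sym_diff (r c) (r d)" for a b c d
  proof -
    have "b \<in> {c, d}" using not_in[of b a c d] that by (metis Un_commute)
    then show ?thesis using not_in[OF that] that(1) by auto
  qed
  ultimately show ?thesis unfolding independent_def by blast
qed

section \<open>Signs, and the greedy reduction along a word\<close>

lemma lde_minus [simp]: "lde (- V) = lde V"
  by (simp add: lde_def)

lemma matrix_mult_minus: "(A::real^6^6) ** (- B) = - (A ** B)" "(- A) ** B = - (A ** B)"
  by (simp_all add: vec_eq_iff matrix_matrix_mult_def sum_negf)

lemma transpose_minus: "transpose (- A) = - transpose (A::real^6^6)"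
  by (simp add: transpose_def vec_eq_iff)

text \<open>Makes the recorded letters independent of the sign chosen in \<open>so6\<close>, both
  for the operator and for the letters.\<close>

lemma recorded_minus: "recorded V Rs \<Longrightarrow> recorded (- V) Rs"
proof (induction rule: recorded.induct)
  case (stop V)
  then show ?case by (intro recorded.stop) simp
next
  case (step V j Rs)
  then show ?case by (intro recorded.step) (simp_all add: matrix_mult_minus)
qed

lemma so6_Sgen: "s \<in> {1..15} \<Longrightarrow> so6 (Sgen s) = smat s \<or> so6 (Sgen s) = - smat s"
  using so6_cases[OF Sgen_rep(3)] .

lemma so6_Sgen_mult:
  assumes "s \<in> {1..15}"
  shows "transpose (so6 (Sgen s)) ** V = transpose (smat s) ** V \<or>
    transpose (so6 (Sgen s)) ** V = - (transpose (smat s) ** V)"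
  using so6_Sgen[OF assms] by (auto simp: transpose_minus matrix_mult_minus)

lemma lde_so6_Sgen_mult:
  "s \<in> {1..15} \<Longrightarrow> lde (transpose (so6 (Sgen s)) ** V) = lde (transpose (smat s) ** V)"
  using so6_Sgen_mult[of s V] by auto

lemma residues_sign:
  assumes "A = B \<or> A = - B"
  shows "residues A l r \<longleftrightarrow> residues B l r"
  using assms residues_minus[of A l r] residues_minus[of B l r] by auto

lemma word_prod_simps [simp]: "word_prod [] = mat 1" "word_prod (R # Rs) = R ** word_prod Rs"
  by (simp_all add: word_prod_def)

text \<open>The hypothesis on \<open>l\<close> only provides integrality at some exponent:
  \<open>l\<close> grows with each removed letter while \<open>lde\<close> falls. The operator is
  generalised in the induction because removing a letter replaces \<open>U\<close> by
  \<open>dagger (Sgen j) ** U\<close>. Classes are traced back from the remaining matrix, whose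
  letters have already been analysed.\<close>

lemma recorded_analysis:
  assumes "recorded V Rs" "orthogonal_matrix V" "residues V l r" "so6_rep U V"
  shows "\<exists>js r. Rs = map Sgen js \<and> set js \<subseteq> {1..15} \<and> phase js \<noteq> 0 \<and> lde V = length js \<and>
    residues V (length js) r \<and> word_state js r \<and>
    (\<exists>V0. so6_rep (dagger (word_prod Rs) ** U) V0 \<and> (\<forall>i j. V0 $ i $ j \<in> \<int>))"
  using assms
proof (induction arbitrary: U l r rule: recorded.induct)
  case (stop V)
  then obtain r' where r': "residues V 0 r'" using lde_residues by metis
  then have "\<forall>i j. V $ i $ j \<in> \<int>" using residues_ex[of 0 V] by auto
  moreover have "independent r'" by (rule integral_independent[OF stop.prems(1) r'])
  ultimately show ?case
    using stop.hyps stop.prems(3) r'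
    by (intro exI[of _ "[]"] exI[of _ r'] conjI exI[of _ V]) simp_all
next
  case (step V j Rs)
  let ?W = "transpose (so6 (Sgen j)) ** V" and ?X = "transpose (smat j) ** V"
  note j = \<open>j \<in> {1..15}\<close>
  have W: "?W = ?X \<or> ?W = - ?X" by (rule so6_Sgen_mult[OF j])
  have oS: "orthogonal_matrix (so6 (Sgen j))"
    using so6_rep_level_props(1)[OF Sgen_level[OF j] so6_rep_so6[OF Sgen_rep(3)[OF j]]] .
  have oW: "orthogonal_matrix ?W"
    using oS step.prems(1) by (simp add: orthogonal_matrix_mul orthogonal_matrix_transpose)
  have q: "residues ?W (Suc l) (\<lambda>i. sym_diff (r i) (r (mate (arcs j) i)))"
    unfolding residues_sign[OF W] by (rule residues_step(2)[OF step.prems(2) j])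
  have rep: "so6_rep (dagger (Sgen j) ** U) ?W"
    by (rule so6_rep_mult[OF so6_rep_dagger[OF so6_rep_so6[OF Sgen_rep(3)[OF j]] Sgen_rep(1)[OF j]
        oS] step.prems(3)])
  from step.IH[OF oW q rep] obtain js r1 V0 where IH: "Rs = map Sgen js" "set js \<subseteq> {1..15}"
      "phase js \<noteq> 0"
    "lde ?W = length js" "residues ?W (length js) r1" "word_state js r1"
    "so6_rep (dagger (word_prod Rs) ** (dagger (Sgen j) ** U)) V0" "\<forall>i j. V0 $ i $ j \<in> \<int>"
    by blast
  have "residues ?X (length js) r1" using IH(5) unfolding residues_sign[OF W] .
  from residues_step(1)[OF this j] have r: "residues V (Suc (length js)) (add_mate j r1)"
    by (simp add: smat_inverse[OF j] add_mate_def)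
  have l: "lde V = Suc (length js)" using step.hyps(1,3) IH(4) by simp
  obtain r' x where "residues V (Suc (length js)) r'" "r' x \<noteq> {}"
    using lde_residues[OF step.prems(2,1)] unfolding l by blast
  then have x: "add_mate j r1 x \<noteq> {}" using residues_unique[OF r, of r'] by simp
  then have "r1 x \<noteq> r1 (mate (arcs j) x)" by (auto simp: add_mate_def)
  moreover have "\<exists>y. add_mate j r1 y \<noteq> add_mate j r1 (mate (arcs i) y)" if "i \<in> {1..<j}" for i
  proof -
    have i: "i \<in> {1..15}" using that j by auto
    have "lde (transpose (smat i) ** V) \<noteq> lde V - 1"
      unfolding lde_so6_Sgen_mult[OF i, symmetric] using step.hyps(4) that by blast
    moreover have "lde (transpose (smat i) ** V) = Suc (length js) - 1 \<longleftrightarrow>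
        (\<forall>y. add_mate j r1 y = add_mate j r1 (mate (arcs i) y))"
      by (rule lde_reduces_iff[OF step.prems(1) r x _ i]) simp
    ultimately show ?thesis unfolding l by blast
  qed
  ultimately have g: "greedy_step j r1" by (auto simp: greedy_step_def)
  note ws = word_state_step[OF IH(6,3) j]
  have p: "phase (j # js) \<noteq> 0" using g ws(1) by blast
  have "dagger (word_prod (Sgen j # Rs)) ** U = dagger (word_prod Rs) ** (dagger (Sgen j) ** U)"
    by (simp add: dagger_mult matrix_mul_assoc)
  then have "so6_rep (dagger (word_prod (Sgen j # Rs)) ** U) V0" using IH(7) by (simp only:)
  then show ?case
    using ws(2)[OF p] p r IH(8) l IH(1,2) j
    by (intro exI[of _ "j # js"] exI[of _ "add_mate j r1"] conjI exI[of _ V0]) simp_all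
qed

text \<open>The word is built up from its right end, starting at an integral \<open>V0\<close>. A
  nonzero phase makes every added letter a greedy step, which is exactly what forces the reduction
  to take off this letter next.\<close>

lemma recorded_word:
  assumes "set js \<subseteq> {1..15}" "phase js \<noteq> 0" "orthogonal_matrix V0" "\<And>i j. V0 $ i $ j \<in> \<int>"
  defines "V \<equiv> \<lambda>js. foldr (\<lambda>s X. smat s ** X) js V0"
  shows "recorded (V js) (map Sgen js) \<and> lde (V js) = length js \<and> orthogonal_matrix (V js) \<and>
    (\<exists>r. residues (V js) (length js) r \<and> word_state js r)"
  using assms(1,2)
proof (induction js)
  case Nil
  have "\<forall>i j. sqrt 2 ^ 0 * V0 $ i $ j \<in> \<int>" using assms(4) by simp
  then obtain r where r: "residues V0 0 r" unfolding residues_ex by blast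
  have "lde V0 = 0" unfolding lde_def by (rule Least_equality) (use assms(4) in auto)
  then show ?case
    using r integral_independent[OF assms(3) r] assms(3) by (auto simp: V_def intro: recorded.stop)
next
  case (Cons s js)
  then have s: "s \<in> {1..15}" and "set js \<subseteq> {1..15}" by auto
  have p: "phase js \<noteq> 0" using Cons.prems(2) by (cases js) (auto split: if_splits)
  from Cons.IH[OF \<open>set js \<subseteq> {1..15}\<close> p] obtain r where IH: "recorded (V js) (map Sgen js)"
    "lde (V js) = length js" "orthogonal_matrix (V js)" "residues (V js) (length js) r"
        "word_state js r"
    by blast
  have V: "V (s # js) = smat s ** V js" by (simp add: V_def)
  note ws = word_state_step[OF IH(5) p s]
  have g: "greedy_step s r" using ws(1) Cons.prems(2) by blast
  then obtain x where x: "r x \<noteq> r (mate (arcs s) x)" by (auto simp: greedy_step_def)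
  have l: "lde (V (s # js)) = Suc (length js)" unfolding V by (rule lde_smat_mult[OF IH(4) s x])
  have r: "residues (V (s # js)) (Suc (length js)) (add_mate s r)"
    using residues_step(1)[OF IH(4) s] by (simp add: V add_mate_def)
  have o: "orthogonal_matrix (V (s # js))" unfolding V
      by (rule orthogonal_matrix_mul[OF orthogonal_smat[OF s] IH(3)])
  have x': "add_mate s r x \<noteq> {}" using x by (auto simp: add_mate_def)
  have inv: "transpose (smat s) ** V (s # js) = V js" by (simp add: V smat_inverse[OF s])
  have W: "transpose (so6 (Sgen s)) ** V (s # js) = V js \<or>
      transpose (so6 (Sgen s)) ** V (s # js) = - V js"
    using so6_Sgen_mult[OF s, of "V (s # js)"] by (simp add: inv)
  have "lde (transpose (so6 (Sgen i)) ** V (s # js)) \<noteq> lde (V (s # js)) - 1" if "i \<in> {1..<s}" for i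
  proof -
    have i: "i \<in> {1..15}" using that s by auto
    have "\<exists>y. add_mate s r y \<noteq> add_mate s r (mate (arcs i) y)" using g that
        by (auto simp: greedy_step_def)
    moreover have "lde (transpose (smat i) ** V (s # js)) = Suc (length js) - 1 \<longleftrightarrow>
        (\<forall>y. add_mate s r y = add_mate s r (mate (arcs i) y))"
      by (rule lde_reduces_iff[OF o r x' _ i]) simp
    ultimately show ?thesis unfolding l lde_so6_Sgen_mult[OF i] by blast
  qed
  moreover have "recorded (transpose (so6 (Sgen s)) ** V (s # js)) (map Sgen js)"
    using W IH(1) recorded_minus by auto
  moreover have "lde (transpose (so6 (Sgen s)) ** V (s # js)) = lde (V (s # js)) - 1"
    using lde_so6_Sgen_mult[OF s] by (simp add: inv IH(2) l)
  ultimately have "recorded (V (s # js)) (map Sgen (s # js))"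
    using l s by (auto intro: recorded.step)
  then show ?case using l o r ws(2) Cons.prems(2) by auto
qed

section \<open>The letters as Clifford+CS operators\<close>

lemma clifford_CS_mult: "U \<in> clifford_CS \<Longrightarrow> W \<in> clifford_CS \<Longrightarrow> U ** W \<in> clifford_CS"
  unfolding clifford_CS_def by (metis generate.eng mult_U4(1))

lemma clifford_subset_CS: "clifford \<subseteq> clifford_CS"
  unfolding clifford_CS_def by (auto intro: generate.incl)

lemma residues_smat:
  assumes "s \<in> {1..15}"
  shows "residues (smat s) 1 (\<lambda>i. {i, mate (arcs s) i})"
proof -
  have "residues (mat 1) 0 (\<lambda>i. {i})"
    unfolding residues_def by (intro exI[of _ "\<lambda>i k. if i = k then 1 else 0"]) (auto simp: mat_def)
  from residues_step(1)[OF this assms]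
  have "residues (smat s) (Suc 0) (\<lambda>i. sym_diff {i} {mate (arcs s) i})" by simp
  moreover have "sym_diff {i} {mate (arcs s) i} = {i, mate (arcs s) i}" for i
    using matching_arcs[OF assms] by (auto simp: matching_def)
  ultimately show ?thesis by simp
qed

lemma rot90_mult_nth:
  assumes "a \<noteq> b"
  shows "(rot90 a b ** V) $ i $ k = (if i = a then V $ b $ k else if i =
      b then - V $ a $ k else V $ i $ k)"
proof -
  have "rot90 a b $ i $ j * V $ j $ k = (if j = (if i = a then b else if i = b then a else i)
      then (if i = b then - V $ j $ k else V $ j $ k) else 0)" for j
    using assms by (auto simp: rot90_def)
  then show ?thesis using assms by (simp add: matrix_matrix_mult_def)
qed

lemma Sgen_transport:
  assumes "clifford_mat (rot90 a b)" "a \<noteq> b" "i \<in> {1..15}" "j \<in> {1..15}" "Sgen j \<in> clifford_CS"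
    and t: "\<And>x. mate (arcs i) (Transposition.transpose a b x) =
        Transposition.transpose a b (mate (arcs j) x)"
  shows "Sgen i \<in> clifford_CS"
proof -
  let ?t = "Transposition.transpose a b" and ?V = "rot90 a b ** smat j"
  obtain C where C: "C \<in> clifford" "so6_rep C (rot90 a b)" using assms(1)
      by (auto simp: clifford_mat_def)
  obtain M where M: "\<And>x k. sqrt 2 ^ 1 * smat j $ x $ k = of_int (M x k)"
    "\<And>x k. k \<in> {x, mate (arcs j) x} \<longleftrightarrow> odd (M x k)"
    using residues_smat[OF assms(4)] unfolding residues_def by blast
  \<comment> \<open>Modulo 2 the quarter turn merely exchanges rows \<open>a\<close> and
    \<open>b\<close>, since its sign is invisible.\<close>
  define r where "r = (\<lambda>x. {?t x, mate (arcs j) (?t x)})"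
  have r: "residues ?V 1 r"
    unfolding residues_def
  proof (intro exI[of _ "\<lambda>x k. if x = b then - M a k else M (?t x) k"] allI conjI)
    fix x k
    show "sqrt 2 ^ 1 * ?V $ x $ k = of_int (if x = b then - M a k else M (?t x) k)"
      using M(1)[of a k] M(1)[of b k] M(1)[of x k] assms(2)
      by (auto simp: rot90_mult_nth Transposition.transpose_def)
    show "k \<in> r x \<longleftrightarrow> odd (if x = b then - M a k else M (?t x) k)"
      using M(2)[of k "?t x"] by (auto simp: r_def)
  qed
  have o: "orthogonal_matrix ?V"
    by (rule orthogonal_matrix_mul[OF clifford_mat_props(1)[OF assms(1)] orthogonal_smat[OF
        assms(4)]])
  let ?W = "transpose (smat i) ** ?V"
  have "r x = r (mate (arcs i) x)" for x
  proof -
    have "?t (mate (arcs i) x) = mate (arcs j) (?t x)"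
      using t[of "?t x"] by simp
    then show ?thesis
      using matching_arcs[OF assms(4)] by (auto simp: r_def matching_def)
  qed
  then have "lde ?W = 0"
    using lde_reduces_iff[OF o r, of 1 i] assms(3) by (simp add: r_def)
  moreover have oW: "orthogonal_matrix ?W"
    using o orthogonal_smat[OF assms(3)]
        by (simp add: orthogonal_matrix_mul orthogonal_matrix_transpose)
  ultimately obtain q where "residues ?W 0 q"
    using lde_residues[OF residues_step(2)[OF r assms(3)]] by metis
  then have int: "?W $ x $ y \<in> \<int>" for x y using residues_ex[of 0 ?W] by auto
  define X where "X = dagger (Sgen i) ** (C ** Sgen j)"
  have "so6_rep X ?W"
    unfolding X_def by (rule so6_rep_mult[OF so6_rep_dagger[OF Sgen_rep(3,1)[OF assms(3)]
        orthogonal_smat[OF assms(3)]]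
      so6_rep_mult[OF C(2) Sgen_rep(3)[OF assms(4)]]])
  moreover have "so6_level (1 + (0 + 1)) X"
    unfolding X_def by (intro so6_level_mult so6_level_dagger Sgen_level assms(3,4) clifford_level
        C(1))
  ultimately have X: "X \<in> clifford" using clifford_if_integral int by blast
  have "C ** Sgen j ** dagger X = (Sgen i ** dagger (Sgen i)) ** (C ** Sgen j) ** dagger X"
    using Sgen_rep(1)[OF assms(3)] by (simp add: unitary_def)
  also have "\<dots> = Sgen i ** (X ** dagger X)" by (simp add: X_def matrix_mul_assoc)
  also have "\<dots> = Sgen i" using clifford_unitary[OF X] by (simp add: unitary_def)
  finally have "Sgen i = C ** Sgen j ** dagger X" by simp
  then show ?thesis
    using clifford_CS_mult assms(5) C(1) clifford_dagger[OF X] clifford_subset_CS by (metis subsetD)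
qed

lemma Sgen_in_clifford_CS:
  assumes "s \<in> {1..15}"
  shows "Sgen s \<in> clifford_CS"
proof -
  have S3: "Sgen 3 \<in> clifford_CS"
    unfolding clifford_CS_def gateCS_eq[symmetric] by (auto intro: generate.incl)
  \<comment> \<open>A spanning tree on the 15 matchings with root 3, the letter equal to
    \<open>gateCS\<close>. An entry (i, j, a, b) says that exchanging a and b carries matching j to
    matching i. It exists because the five exchanges used, those along the path of axes, generate
    all permutations of six points.\<close>
  let ?tree = "[(4, 3, 3, 2), (5, 3, 6, 5), (7, 4, 2, 1), (2, 4, 6, 5), (6, 5, 3, 6), (8, 7, 6, 5),
    (12, 2, 3, 6), (9, 2, 5, 4), (14, 8, 3, 6), (1, 8, 5, 4), (15, 12, 3, 2), (13, 14, 3, 2),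
    (11, 14, 5, 4), (10, 13, 2, 1)] :: (nat \<times> nat \<times> 6 \<times> 6) list"
  have "list_all (\<lambda>(i, j, a, b). \<forall>x. mate (arcs i) (Transposition.transpose a b x) =
      Transposition.transpose a b (mate (arcs j) x)) ?tree"
    by (simp add: forall_6 arcs_def arcs_list_def Transposition.transpose_def)
  then have mates: "mate (arcs i) (Transposition.transpose a b x) =
      Transposition.transpose a b (mate (arcs j) x)"
    if "(i, j, a, b) \<in> set ?tree" for i j a b x
    using that unfolding list_all_iff by blast
  have tr: "Sgen i \<in> clifford_CS" if "(i, j, a, b) \<in> set ?tree" "Sgen j \<in> clifford_CS" for i j a b
  proof (rule Sgen_transport[of a b i j])
    show "Sgen j \<in> clifford_CS" by (fact that(2))
    show "clifford_mat (rot90 a b)" using that(1) clifford_mat_adjacent by auto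
    show "i \<in> {1..15}" "j \<in> {1..15}" "a \<noteq> b" using that(1) by auto
  qed (rule mates[OF that(1)])
  have S4: "Sgen 4 \<in> clifford_CS" by (rule tr[of 4 3 3 2]) (simp_all add: S3)
  have S5: "Sgen 5 \<in> clifford_CS" by (rule tr[of 5 3 6 5]) (simp_all add: S3)
  have S7: "Sgen 7 \<in> clifford_CS" by (rule tr[of 7 4 2 1]) (simp_all add: S4)
  have S2: "Sgen 2 \<in> clifford_CS" by (rule tr[of 2 4 6 5]) (simp_all add: S4)
  have S6: "Sgen 6 \<in> clifford_CS" by (rule tr[of 6 5 3 6]) (simp_all add: S5)
  have S8: "Sgen 8 \<in> clifford_CS" by (rule tr[of 8 7 6 5]) (simp_all add: S7)
  have S12: "Sgen 12 \<in> clifford_CS" by (rule tr[of 12 2 3 6]) (simp_all add: S2)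
  have S9: "Sgen 9 \<in> clifford_CS" by (rule tr[of 9 2 5 4]) (simp_all add: S2)
  have S14: "Sgen 14 \<in> clifford_CS" by (rule tr[of 14 8 3 6]) (simp_all add: S8)
  have S1: "Sgen 1 \<in> clifford_CS" by (rule tr[of 1 8 5 4]) (simp_all add: S8)
  have S15: "Sgen 15 \<in> clifford_CS" by (rule tr[of 15 12 3 2]) (simp_all add: S12)
  have S13: "Sgen 13 \<in> clifford_CS" by (rule tr[of 13 14 3 2]) (simp_all add: S14)
  have S11: "Sgen 11 \<in> clifford_CS" by (rule tr[of 11 14 5 4]) (simp_all add: S14)
  have S10: "Sgen 10 \<in> clifford_CS" by (rule tr[of 10 13 2 1]) (simp_all add: S13)
  show ?thesis
    using cases_15[OF assms] S1 S2 S3 S4 S5 S6 S7 S8 S9 S10 S11 S12 S13 S14 S15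
    by (elim disjE) simp_all
qed

section \<open>Automata\<close>

lemma nfa_path_append: "nfa_path A q u r \<Longrightarrow> nfa_path A r v t \<Longrightarrow> nfa_path A q (u @ v) t"
proof (induction rule: nfa_path.induct)
  case (eps r q w t)
  then show ?case by - (rule nfa_path.eps[of r], auto)
next
  case (letter r q a w t)
  then show ?case by - (simp, rule nfa_path.letter[of r], auto)
qed simp

lemma nfa_conc_simps [simp]:
  "alph (A \<circ>\<^sub>A A') = alph A \<union> alph A'" "states (A \<circ>\<^sub>A A') = states A <+> states A'"
  "initial (A \<circ>\<^sub>A A') = Inl ` initial A" "final (A \<circ>\<^sub>A A') = Inr ` final A'"
  "delta (A \<circ>\<^sub>A A') = conc_trans A A'"
  by (simp_all add: nfa_conc_def)

lemma nfa_path_Inl: "nfa_path A q w t \<Longrightarrow> nfa_path (A \<circ>\<^sub>A A') (Inl q) w (Inl t)"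
proof (induction rule: nfa_path.induct)
  case (eps r q w t)
  then show ?case by - (rule nfa_path.eps[where r = "Inl r"], auto)
next
  case (letter r q a w t)
  then show ?case by - (rule nfa_path.letter[where r = "Inl r"], auto)
qed (auto intro: nfa_path.refl)

lemma nfa_path_Inr: "nfa_path A' q w t \<Longrightarrow> nfa_path (A \<circ>\<^sub>A A') (Inr q) w (Inr t)"
proof (induction rule: nfa_path.induct)
  case (eps r q w t)
  then show ?case by - (rule nfa_path.eps[where r = "Inr r"], auto)
next
  case (letter r q a w t)
  then show ?case by - (rule nfa_path.letter[where r = "Inr r"], auto)
qed (auto intro: nfa_path.refl)

lemma nfa_path_conc_Inr:
  assumes "nfa_path (A \<circ>\<^sub>A A') x w y" "x = Inr q"
  shows "\<exists>t. y = Inr t \<and> nfa_path A' q w t"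
  using assms
proof (induction arbitrary: q rule: nfa_path.induct)
  case (refl x)
  then show ?case by (auto intro: nfa_path.refl)
next
  case (eps r x w t)
  then obtain p where p: "r = Inr p" "p \<in> delta A' q None" by auto
  from eps.IH[OF p(1)] obtain s where "t = Inr s" "nfa_path A' p w s" by blast
  with nfa_path.eps[OF p(2)] show ?case by blast
next
  case (letter r x a w t)
  then obtain p where p: "r = Inr p" "p \<in> delta A' q (Some a)" by auto
  from letter.IH[OF p(1)] obtain s where "t = Inr s" "nfa_path A' p w s" by blast
  with nfa_path.letter[OF p(2)] show ?case by blast
qed

text \<open>No transition leads back from the second summand to the first, so the path crosses over
  once, by a move that reads nothing; the word is cut there.\<close>

lemma nfa_path_conc_Inl:
  assumes "nfa_path (A \<circ>\<^sub>A A') x w y" "x = Inl q" "y = Inr t" and fin: "final A \<subseteq> states A"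
  shows "\<exists>u v f i. w = u @ v \<and> f \<in> final A \<and> i \<in> initial A' \<and> nfa_path A q u f \<and> nfa_path A' i v t"
  using assms(1-3)
proof (induction arbitrary: q rule: nfa_path.induct)
  case (refl x)
  then show ?case by simp
next
  case (eps r x w y)
  show ?case
  proof (cases r)
    case (Inl p)
    then have p: "p \<in> delta A q None" using eps.hyps(1) eps.prems by (auto split: if_splits)
    obtain u v f i where "w = u @ v" "f \<in> final A" "i \<in> initial A'" "nfa_path A p u f"
        "nfa_path A' i v t"
      using eps.IH[OF Inl eps.prems(2)] by blast
    with nfa_path.eps[OF p, of u f] show ?thesis by blast
  next
    case (Inr p)
    then have p: "q \<in> final A" "p \<in> initial A'" using eps.hyps(1) eps.prems
        by (auto split: if_splits)
    have "nfa_path A' p w t" using nfa_path_conc_Inr[OF eps.hyps(2) Inr] eps.prems(2) by auto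
    moreover have "nfa_path A q [] q" using p(1) fin by (auto intro: nfa_path.refl)
    ultimately show ?thesis using p by (metis append_Nil)
  qed
next
  case (letter r x a w y)
  then obtain p where p: "r = Inl p" "p \<in> delta A q (Some a)" by auto
  obtain u v f i where "w = u @ v" "f \<in> final A" "i \<in> initial A'" "nfa_path A p u f"
      "nfa_path A' i v t"
    using letter.IH[OF p(1) letter.prems(2)] by blast
  with nfa_path.letter[OF p(2), of u f] have "a # w = (a # u) @ v \<and> nfa_path A q (a # u) f" by simp
  with \<open>f \<in> final A\<close> \<open>i \<in> initial A'\<close> \<open>nfa_path A' i v t\<close> show ?case by blast
qed

lemma language_conc:
  assumes "final A \<subseteq> states A" "alph A = alph A'"
  shows "language (A \<circ>\<^sub>A A') = {u @ v | u v. u \<in> language A \<and> v \<in> language A'}"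
proof (intro equalityI subsetI)
  fix w assume "w \<in> language (A \<circ>\<^sub>A A')"
  then obtain q t where "w \<in> lists (alph A)" "q \<in> initial A" "t \<in> final A'"
    "nfa_path (A \<circ>\<^sub>A A') (Inl q) w (Inr t)"
    using assms(2) by (auto simp: language_def)
  moreover from nfa_path_conc_Inl[OF this(4) HOL.refl HOL.refl assms(1)] obtain u v f i where
    "w = u @ v" "f \<in> final A" "i \<in> initial A'" "nfa_path A q u f" "nfa_path A' i v t"
    by blast
  ultimately have "w = u @ v" "u \<in> language A" "v \<in> language A'"
    using assms(2) by (auto simp: language_def)
  then show "w \<in> {u @ v | u v. u \<in> language A \<and> v \<in> language A'}" by blast
next
  fix w assume "w \<in> {u @ v | u v. u \<in> language A \<and> v \<in> language A'}"
  then obtain u v q f i t where w: "w = u @ v" "u \<in> lists (alph A)" "v \<in> lists (alph A')"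
      "q \<in> initial A"
    "f \<in> final A" "i \<in> initial A'" "t \<in> final A'" "nfa_path A q u f" "nfa_path A' i v t"
    unfolding language_def by blast
  have "Inr i \<in> delta (A \<circ>\<^sub>A A') (Inl f) None" using w(5,6) by simp
  then have "nfa_path (A \<circ>\<^sub>A A') (Inl f) v (Inr t)"
    by (rule nfa_path.eps[OF _ nfa_path_Inr[OF w(9)]])
  then have "nfa_path (A \<circ>\<^sub>A A') (Inl q) w (Inr t)"
    unfolding w(1) by (rule nfa_path_append[OF nfa_path_Inl[OF w(8)]])
  then show "w \<in> language (A \<circ>\<^sub>A A')"
    using w assms(2) by (auto simp: language_def)
qed

section \<open>The words read by the component automata\<close>

lemma pattern_Sgen:
  assumes "s \<in> {1..15}"
  shows "pattern (so6 (Sgen s)) = (\<lambda>i. {i, mate (arcs s) i}) ` UNIV"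
proof -
  let ?m = "mate (arcs s)"
  have m: "?m (?m x) = x" for x using matching_arcs[OF assms] by (simp add: matching_def)
  have r: "residues (so6 (Sgen s)) 1 (\<lambda>i. {i, ?m i})"
    unfolding residues_sign[OF so6_Sgen[OF assms]] by (rule residues_smat[OF assms])
  then have l: "lde (so6 (Sgen s)) = 1" by (rule lde_eqI[of _ _ _ 1]) simp
  have "pattern (so6 (Sgen s)) = (\<lambda>i. {j. {j, ?m j} = {i, ?m i}}) ` UNIV"
    by (rule pattern_eq) (simp only: l r)
  moreover have "{j. {j, ?m j} = {i, ?m i}} = {i, ?m i}" for i
  proof (intro equalityI subsetI)
    fix j assume "j \<in> {i, ?m i}"
    then consider "j = i" | "j = ?m i" by blast
    then show "j \<in> {j. {j, ?m j} = {i, ?m i}}" by cases (simp_all add: m insert_commute)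
  next
    fix j assume "j \<in> {j. {j, ?m j} = {i, ?m i}}"
    then have "{j, ?m j} = {i, ?m i}" by simp
    moreover have "j \<in> {j, ?m j}" by simp
    ultimately show "j \<in> {i, ?m i}" by (simp only:)
  qed
  ultimately show ?thesis by (simp only:)
qed

lemma pattern_Sgen_disjoint_iff:
  assumes "s \<in> {1..15}" "t \<in> {1..15}"
  shows "pattern (so6 (Sgen s)) \<inter> pattern (so6 (Sgen t)) = {} \<longleftrightarrow> block_disjoint s t"
proof -
  define f g where "f = mate (arcs s)" and "g = mate (arcs t)"
  have g: "g (g x) = x" for x
    using matching_arcs[OF assms(2)] by (simp add: matching_def g_def)
  have *: "f x = g x" if "{x, f x} = {y, g y}" for x y
  proof -
    from that consider "x = y" "f x = g y" | "x = g y" "f x = y" unfolding doubleton_eq_iff by blast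
    then show ?thesis by cases (simp_all add: g)
  qed
  have "pattern (so6 (Sgen s)) \<inter> pattern (so6 (Sgen t)) = {} \<longleftrightarrow> (\<forall>x y. {x, f x} \<noteq> {y, g y})"
    unfolding pattern_Sgen[OF assms(1)] pattern_Sgen[OF assms(2)] f_def g_def by blast
  also have "\<dots> \<longleftrightarrow> (\<forall>x. f x \<noteq> g x)"
    using * by metis
  also have "\<dots> \<longleftrightarrow> block_disjoint s t"
    unfolding block_disjoint_iff[OF assms] f_def g_def ..
  finally show ?thesis .
qed

text \<open>The bound \<open>n\<close> concerns the first letter alone, since the transitions of the
  automaton lead to all of {1..m}. Later letters may be lower than \<open>n\<close>.\<close>

definition syllable :: "nat \<Rightarrow> nat \<Rightarrow> nat list \<Rightarrow> bool" where
  "syllable n m js \<longleftrightarrow> set js \<subseteq> {1..m} \<and> successively block_disjoint js \<and> (js = [] \<or> n \<le> hd js)"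

lemma syllable_nfa_delta:
  assumes "m \<le> 15" "s \<in> {1..m}"
  shows "delta (syllable_nfa n m) s x = (if x = Some (Sgen s) then {t \<in> {1..m}.
      block_disjoint s t} else {})"
proof -
  have "{t \<in> {1..m}. pattern (so6 (Sgen s)) \<inter> pattern (so6 (Sgen t)) = {}} = {t \<in> {1..m}.
      block_disjoint s t}"
    using pattern_Sgen_disjoint_iff[of s] assms by (intro Collect_cong conj_cong HOL.refl) simp
  then show ?thesis using assms(2) by (simp add: syllable_nfa_def)
qed

lemma syllable_path:
  assumes "nfa_path (syllable_nfa n m) s w t" "m \<le> 15"
  shows "s \<in> {1..m} \<and> (\<exists>js. w = map Sgen js \<and> set js \<subseteq> {1..m} \<and> successively block_disjoint js \<and>
      (js = [] \<or> hd js = s))"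
  using assms
proof (induction rule: nfa_path.induct)
  case (refl q)
  then show ?case by (auto simp: syllable_nfa_def)
next
  case (eps r q w t)
  then show ?case by (auto simp: syllable_nfa_def split: if_splits)
next
  case (letter r q a w t)
  have q: "q \<in> {1..m}" using letter.hyps(1) by (auto simp: syllable_nfa_def split: if_splits)
  have r: "a = Sgen q" "block_disjoint q r"
    using letter.hyps(1) unfolding syllable_nfa_delta[OF letter.prems q] by (auto split: if_splits)
  obtain js where "w = map Sgen js" "set js \<subseteq> {1..m}" "successively block_disjoint js"
      "js = [] \<or> hd js = r"
    using letter.IH letter.prems by blast
  then show ?case
    using q r by (intro conjI exI[of _ "q # js"]) (auto simp: successively_Cons)
qed

text \<open>Reading the last letter still needs a target state. One of the letters 1, 2, 3 serves,
  except for letter 10, which takes one block from each of their matchings; letter 4 serves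
  there.\<close>

lemma block_disjoint_ex:
  assumes "3 \<le> m" "s \<in> {1..m}" "m \<le> 15"
  shows "\<exists>t\<in>{1..m}. block_disjoint s t"
proof -
  have s: "s \<in> {1..15}" using assms by auto
  have "block_disjoint s 1 \<or> block_disjoint s 2 \<or> block_disjoint s 3 \<or> s = 10 \<and> block_disjoint s 4"
    using cases_15[of s, OF s]
    by (elim disjE) (simp_all add: block_disjoint_def mates_def mates_list_def)
  then show ?thesis using assms by auto
qed

lemma syllable_path_ex:
  assumes "3 \<le> m" "m \<le> 15" "set js \<subseteq> {1..m}" "successively block_disjoint js"
      "js = [] \<or> hd js = s" "s \<in> {1..m}"
  shows "\<exists>t\<in>{1..m}. nfa_path (syllable_nfa n m) s (map Sgen js) t"
  using assms(3-6)
proof (induction js arbitrary: s)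
  case Nil
  then have "nfa_path (syllable_nfa n m) s [] s"
      by (intro nfa_path.refl) (simp add: syllable_nfa_def)
  then show ?case using Nil by auto
next
  case (Cons q js)
  then have q: "q = s" "s \<in> {1..m}" by auto
  obtain r where r: "r \<in> {1..m}" "block_disjoint s r" "js = [] \<or> hd js = r"
  proof (cases js)
    case Nil
    with block_disjoint_ex[OF assms(1) q(2) assms(2)] that show ?thesis by blast
  next
    case (Cons r js')
    with Cons.prems q(1) that[of r] show ?thesis by auto
  qed
  then obtain t where t: "t \<in> {1..m}" "nfa_path (syllable_nfa n m) r (map Sgen js) t"
    using Cons.IH[of r] Cons.prems by (auto simp: successively_Cons)
  note t(2)
  moreover have "r \<in> delta (syllable_nfa n m) s (Some (Sgen s))"
    using r(1,2) by (simp add: syllable_nfa_delta[OF assms(2) q(2)])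
  ultimately have "nfa_path (syllable_nfa n m) s (Sgen s # map Sgen js) t"
      by - (rule nfa_path.letter)
  then show ?case using q(1) t(1) by auto
qed

lemma language_syllable_nfa:
  assumes "1 \<le> n" "n \<le> m" "3 \<le> m" "m \<le> 15"
  shows "language (syllable_nfa n m) = {map Sgen js | js. syllable n m js}"
proof (intro equalityI subsetI)
  fix w assume "w \<in> language (syllable_nfa n m)"
  then obtain s t where s: "s \<in> {n..m}" "nfa_path (syllable_nfa n m) s w t"
    by (auto simp: language_def syllable_nfa_def)
  with syllable_path[OF s(2) assms(4)] show "w \<in> {map Sgen js | js. syllable n m js}"
    by (auto simp: syllable_def)
next
  fix w assume "w \<in> {map Sgen js | js. syllable n m js}"
  then obtain js where js: "w = map Sgen js" "syllable n m js" by blast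
  define s where "s = (if js = [] then n else hd js)"
  have s: "s \<in> {n..m}" "js = [] \<or> hd js = s"
    using js(2) assms(2) by (cases js; auto simp: s_def syllable_def)+
  have "\<exists>t\<in>{1..m}. nfa_path (syllable_nfa n m) s w t"
    unfolding js(1) by (rule syllable_path_ex[OF assms(3,4)]) (use js(2) s assms(1) in \<open>auto simp:
        syllable_def\<close>)
  moreover have "w \<in> lists alphabet"
    using js assms(4) by (fastforce simp: syllable_def alphabet_def)
  ultimately show "w \<in> language (syllable_nfa n m)"
    using s(1) by (auto simp: language_def syllable_nfa_def)
qed

lemma language_clifford_nfa:
  assumes "bij_betw c {1..card clifford} clifford"
  shows "language (clifford_nfa c) = {[C] | C. C \<in> clifford}"
proof (intro equalityI subsetI)
  fix w assume "w \<in> language (clifford_nfa c)"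
  then obtain t where t: "t \<in> {1..card clifford}" "nfa_path (clifford_nfa c) 0 w t"
    by (auto simp: language_def clifford_nfa_def)
  from t(2) show "w \<in> {[C] | C. C \<in> clifford}"
  proof cases
    case refl
    then show ?thesis using t(1) by simp
  next
    case (eps r)
    then show ?thesis by (simp add: clifford_nfa_def)
  next
    case (letter r a w')
    then have r: "a = c r" "r \<in> {1..card clifford}" by (auto simp: clifford_nfa_def)
    from letter(3) have "w' = []"
    proof cases
      case (eps r')
      then show ?thesis by (simp add: clifford_nfa_def)
    next
      case (letter r' a' w'')
      then show ?thesis using r(2) by (simp add: clifford_nfa_def)
    qed
    then show ?thesis using letter(1) r bij_betw_apply[OF assms] by auto
  qed
next
  fix w assume "w \<in> {[C] | C. C \<in> clifford}"
  then obtain C where C: "w = [C]" "C \<in> clifford" by blast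
  then obtain j where j: "j \<in> {1..card clifford}" "C = c j"
    using assms unfolding bij_betw_def by (metis imageE)
  have "nfa_path (clifford_nfa c) 0 [C] j"
    by (rule nfa_path.letter[of j]) (use j in \<open>auto simp: clifford_nfa_def intro: nfa_path.refl\<close>)
  then show "w \<in> language (clifford_nfa c)"
    using C j by (auto simp: language_def clifford_nfa_def alphabet_def)
qed

section \<open>Phases of a word and its division into syllables\<close>

lemma bound_simps [simp]: "bound 1 = 3" "bound (Suc 0) = 3" "bound 2 = 9" "bound 3 = 15"
  by (simp_all add: bound_def)

lemma phase_syllable_high:
  "set ws \<subseteq> {1..15} \<Longrightarrow> successively block_disjoint ws \<Longrightarrow> phase ws = 3"
proof (induction ws rule: phase.induct)
  case (3 s t js)
  then show ?case by (auto simp: next_phase_def)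
qed auto

lemma next_phase_cases:
  assumes "next_phase s t p \<noteq> 0" "p \<in> {1, 2, 3}" "s \<le> 15"
  shows "next_phase s t p \<in> {1, 2, 3}" "s \<le> bound (next_phase s t p)"
  using assms by (auto simp: next_phase_def split: if_splits)

lemma phase_bound:
  "phase (s # js) \<noteq> 0 \<Longrightarrow> set (s # js) \<subseteq> {1..15} \<Longrightarrow>
    phase (s # js) \<in> {1, 2, 3} \<and> s \<le> bound (phase (s # js))"
proof (induction js arbitrary: s)
  case (Cons t js)
  then have t: "phase (t # js) \<noteq> 0" "next_phase s t (phase (t # js)) \<noteq> 0" by (auto split: if_splits)
  have "phase (t # js) \<in> {1, 2, 3}" using Cons.IH[OF t(1)] Cons.prems(2) by simp
  from next_phase_cases[OF t(2) this] Cons.prems(2) show ?case using t(1) by simp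
qed simp

text \<open>Phase 3 persists if \<open>vs\<close> is empty or if the junction happens to have no
  common block; only a common block at the junction leads to phase 2.\<close>

lemma phase_syllable_mid:
  assumes "phase ws = 3" "ws = [] \<or> 10 \<le> hd ws" "set vs \<subseteq> {1..9}" "successively block_disjoint vs"
  shows "phase (vs @ ws) \<in> {2, 3}"
  using assms(3,4)
proof (induction vs rule: phase.induct)
  case 1
  then show ?case using assms(1) by simp
next
  case (2 s)
  then show ?case using assms(1,2) by (cases ws) (auto simp: next_phase_def)
next
  case (3 s t js)
  then have "phase ((t # js) @ ws) \<in> {2, 3}" by simp
  then show ?case using 3 by (auto simp: next_phase_def)
qed

lemma phase_syllable_low:
  assumes "phase vs \<in> {2, 3}" "vs = [] \<or> 4 \<le> hd vs" "vs \<noteq> [] \<longrightarrow> phase vs = 2 \<longrightarrow> hd vs \<le> 9"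
    "set us \<subseteq> {1..3}" "successively block_disjoint us"
  shows "phase (us @ vs) \<noteq> 0"
  using assms(4,5)
proof (induction us rule: phase.induct)
  case 1
  then show ?case using assms(1) by auto
next
  case (2 s)
  then show ?case using assms(1-3) by (cases vs) (auto simp: next_phase_def)
next
  case (3 s t js)
  then have "phase ((t # js) @ vs) \<noteq> 0" by simp
  then show ?case using 3 by (auto simp: next_phase_def bound_def)
qed

lemma split_syllable:
  assumes "set xs \<subseteq> {1..m}" "successively block_disjoint xs"
  shows "\<exists>as bs. xs = as @ bs \<and> set as \<subseteq> {1..k} \<and> successively block_disjoint as \<and>
    successively block_disjoint bs \<and> set bs \<subseteq> {1..m} \<and> (bs = [] \<or> Suc k \<le> hd bs)"
proof (intro exI conjI)
  let ?a = "takeWhile (\<lambda>x. x \<le> k) xs" and ?b = "dropWhile (\<lambda>x. x \<le> k) xs"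
  show "xs = ?a @ ?b" by simp
  show "successively block_disjoint ?a" "successively block_disjoint ?b"
    using assms(2) successively_append_iff[of block_disjoint ?a ?b] by simp_all
  show "set ?a \<subseteq> {1..k}" using assms(1) set_takeWhileD[of _ "\<lambda>x. x \<le> k" xs] by fastforce
  show "set ?b \<subseteq> {1..m}" using assms(1) set_dropWhileD[of _ "\<lambda>x. x \<le> k" xs] by blast
  show "?b = [] \<or> Suc k \<le> hd ?b" by (metis hd_dropWhile not_less_eq_eq)
qed

text \<open>A common block forces a cut and lowers the phase. A cut without one leaves no trace in
  the phase, so phase 3 yields just a block-disjoint word; its cuts are supplied by
  \<open>split_syllable\<close>, in front of the first letter above the bound.\<close>

lemma phase_decompose_aux:
  assumes "set js \<subseteq> {1..15}"
  shows "(phase js = 3 \<longrightarrow> successively block_disjoint js) \<and>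
    (phase js = 2 \<longrightarrow> (\<exists>vs ws. js = vs @ ws \<and> vs \<noteq> [] \<and> set vs \<subseteq> {1..9} \<and> successively
        block_disjoint vs \<and> syllable 10 15 ws)) \<and>
    (phase js = 1 \<longrightarrow> (\<exists>us vs ws. js = us @ vs @ ws \<and> us \<noteq> [] \<and> syllable 1 3 us \<and> syllable 4 9 vs \<and>
        syllable 10 15 ws))"
  using assms
proof (induction js rule: phase.induct)
  case (3 s t js)
  have st: "set (t # js) \<subseteq> {1..15}" "s \<in> {1..15}" "t \<in> {1..15}" using 3(3) by simp_all
  note IH = 3(1)[OF st(1)]
  have p: "phase (s # t # js) = (if phase (t # js) = 0 then 0 else next_phase s t (phase (t # js)))"
    by simp
  show ?case
  proof (intro conjI impI)
    assume "phase (s # t # js) = 3"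
    then have "block_disjoint s t" "phase (t # js) = 3"
      unfolding p by (auto simp: next_phase_def simp del: phase.simps split: if_splits)
    then show "successively block_disjoint (s # t # js)" using IH by (simp del: phase.simps)
  next
    assume "phase (s # t # js) = 2"
    then consider "block_disjoint s t" "phase (t # js) = 2" "s \<le> 9" | "phase (t # js) = 3" "s \<le> 9"
        "10 \<le> t"
      unfolding p by (auto simp: next_phase_def simp del: phase.simps split: if_splits)
    then show "\<exists>vs ws. s # t # js = vs @ ws \<and> vs \<noteq> [] \<and> set vs \<subseteq> {1..9} \<and>
        successively block_disjoint vs \<and> syllable 10 15 ws"
    proof cases
      case 1
      then obtain vs ws where v: "t # js = vs @ ws" "vs \<noteq> []" "set vs \<subseteq> {1..9}"
          "successively block_disjoint vs" "syllable 10 15 ws"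
        using IH by blast
      then have "hd vs = t" by (cases vs) auto
      then have "successively block_disjoint (s # vs)" using v(4) 1(1)
          by (simp add: successively_Cons)
      moreover have "set (s # vs) \<subseteq> {1..9}" using v(3) 1(3) st(2) by simp
      moreover have "s # t # js = (s # vs) @ ws" using v(1) by simp
      ultimately show ?thesis using v(5) by blast
    next
      case 2
      then have "syllable 10 15 (t # js)" using IH st(1) unfolding syllable_def by simp
      moreover have "set [s] \<subseteq> {1..9}" using 2(2) st(2) by simp
      moreover have "s # t # js = [s] @ (t # js)" "successively block_disjoint [s]" by simp_all
      ultimately show ?thesis by blast
    qed
  next
    assume "phase (s # t # js) = 1"
    then consider "block_disjoint s t" "phase (t # js) = 1" "s \<le> 3"
      | "phase (t # js) \<ge> 2" "s \<le> 3" "4 \<le> t" "t \<le> 9"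
      unfolding p by (auto simp: next_phase_def simp del: phase.simps split: if_splits)
    then show "\<exists>us vs ws. s # t # js = us @ vs @ ws \<and> us \<noteq> [] \<and> syllable 1 3 us \<and>
        syllable 4 9 vs \<and> syllable 10 15 ws"
    proof cases
      case 1
      then obtain us vs ws where v: "t # js = us @ vs @ ws" "us \<noteq> []" "syllable 1 3 us"
          "syllable 4 9 vs" "syllable 10 15 ws"
        using IH by blast
      then have "hd us = t" by (cases us) auto
      then have "syllable 1 3 (s # us)"
        using v(3) 1(1,3) st(2) by (simp add: syllable_def successively_Cons)
      moreover have "s # t # js = (s # us) @ vs @ ws" using v(1) by simp
      ultimately show ?thesis using v(4,5) by blast
    next
      case 2
      have s: "syllable 1 3 [s]" using 2(2) st(2) by (simp add: syllable_def)
      have "phase (t # js) \<in> {1, 2, 3}" using phase_bound[OF _ st(1)] 2(1) by linarith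
      then consider "phase (t # js) = 2" | "phase (t # js) = 3" using 2(1) by fastforce
      then obtain vs ws where v: "t # js = vs @ ws" "set vs \<subseteq> {1..9}"
          "successively block_disjoint vs" "syllable 10 15 ws"
      proof cases
        case 1
        then show ?thesis using IH that by blast
      next
        case 2
        then have "successively block_disjoint (t # js)" using IH by blast
        from split_syllable[OF st(1) this, of 9] obtain vs ws where "t # js = vs @ ws"
            "set vs \<subseteq> {1..9}"
          "successively block_disjoint vs" "successively block_disjoint ws" "set ws \<subseteq> {1..15}"
              "ws = [] \<or> Suc 9 \<le> hd ws"
          by blast
        then show ?thesis using that[of vs ws] by (simp add: syllable_def)
      qed
      have "vs \<noteq> []"
      proof
        assume "vs = []"
        then have "hd ws = t" "ws \<noteq> []" using v(1) by (metis append_Nil list.sel(1), force)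
        then show False using v(4) 2(4) by (simp add: syllable_def)
      qed
      then have "hd vs = t" using v(1) by (cases vs) auto
      then have "syllable 4 9 vs" using v(2,3) 2(3) by (simp add: syllable_def)
      moreover have "s # t # js = [s] @ vs @ ws" using v(1) by simp
      ultimately show ?thesis using v(4) s by blast
    qed
  qed
qed auto

lemma phase_nonzero_iff:
  assumes "set js \<subseteq> {1..15}"
  shows "phase js \<noteq> 0 \<longleftrightarrow> (\<exists>us vs ws. js = us @ vs @ ws \<and> syllable 1 3 us \<and> syllable 4 9 vs \<and>
      syllable 10 15 ws)"
proof
  assume nz: "phase js \<noteq> 0"
  note aux = phase_decompose_aux[OF assms]
  have "phase js \<in> {1, 2, 3}" using nz phase_bound assms by (cases js) auto
  then consider "phase js = 1" | vs ws where "js = vs @ ws" "set vs \<subseteq> {1..9}"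
      "successively block_disjoint vs" "syllable 10 15 ws"
  proof (elim insertE emptyE)
    assume "phase js = 2"
    then show ?thesis using aux that(2) by blast
  next
    assume "phase js = 3"
    then have "successively block_disjoint js" using aux by simp
    from split_syllable[OF assms this, of 9] that(2) show ?thesis by (force simp: syllable_def)
  qed (use that in blast)
  then show "\<exists>us vs ws. js = us @ vs @ ws \<and> syllable 1 3 us \<and> syllable 4 9 vs \<and> syllable 10 15 ws"
  proof cases
    case 1
    then show ?thesis using aux by blast
  next
    case (2 vs ws)
    obtain as bs where ab: "vs = as @ bs" "set as \<subseteq> {1..3}" "successively block_disjoint as"
      "successively block_disjoint bs" "set bs \<subseteq> {1..9}" "bs = [] \<or> Suc 3 \<le> hd bs"
      using split_syllable[OF 2(2,3), of 3] by blast
    have "as = [] \<or> 1 \<le> hd as" using ab(2) by (cases as) auto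
    then show ?thesis using ab 2(1,4)
        by - (rule exI[of _ as], rule exI[of _ bs], rule exI[of _ ws], simp add: syllable_def)
  qed
next
  assume "\<exists>us vs ws. js = us @ vs @ ws \<and> syllable 1 3 us \<and> syllable 4 9 vs \<and> syllable 10 15 ws"
  then obtain us vs ws where d: "js = us @ vs @ ws" "syllable 1 3 us" "syllable 4 9 vs"
      "syllable 10 15 ws" by blast
  have 3: "phase ws = 3" by (rule phase_syllable_high) (use d(4) in \<open>simp_all add: syllable_def\<close>)
  have 2: "phase (vs @ ws) \<in> {2, 3}"
    using d(3,4) by (intro phase_syllable_mid[OF 3]) (auto simp: syllable_def)
  show "phase js \<noteq> 0"
    unfolding d(1)
  proof (rule phase_syllable_low[OF 2])
    show "vs @ ws = [] \<or> 4 \<le> hd (vs @ ws)" using d(3,4)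
        by (cases vs; cases ws) (auto simp: syllable_def)
    show "vs @ ws \<noteq> [] \<longrightarrow> phase (vs @ ws) = 2 \<longrightarrow> hd (vs @ ws) \<le> 9"
      using 3 d(3) by (cases vs) (auto simp: syllable_def)
  qed (use d(2) in \<open>auto simp: syllable_def\<close>)
qed

section \<open>Normal forms and the accepted language\<close>

lemma unitary_word_prod: "set js \<subseteq> {1..15} \<Longrightarrow> unitary (word_prod (map Sgen js))"
  by (induction js) (auto simp: unitary_mult Sgen_rep(1) unitary_def[of "mat 1"])

lemma unitary_matrix_inv: "unitary (U::op2) \<Longrightarrow> matrix_inv U = dagger U"
proof -
  assume U: "unitary U"
  then have "U ** dagger U = mat 1 \<and> dagger U ** U = mat 1" by (simp add: unitary_def)
  then have "U ** matrix_inv U = mat 1" unfolding matrix_inv_def by (rule someI2) simp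
  then have "dagger U ** (U ** matrix_inv U) = dagger U" by simp
  then show ?thesis using U by (simp add: matrix_mul_assoc unitary_def)
qed

lemma so6_level_word_prod:
  "set js \<subseteq> {1..15} \<Longrightarrow> \<exists>l. so6_level l (word_prod (map Sgen js))"
proof (induction js)
  case (Cons s js)
  then obtain l where "so6_level l (word_prod (map Sgen js))" by auto
  with so6_level_mult[OF Sgen_level[of s] this] Cons.prems show ?case by auto
qed (use so6_level_mat1 in auto)

lemma normal_forms_iff:
  "w \<in> normal_forms \<longleftrightarrow> (\<exists>js C. w = map Sgen js @ [C] \<and> set js \<subseteq> {1..15} \<and> phase js \<noteq> 0 \<and>
      C \<in> clifford)"
proof
  assume "w \<in> normal_forms"
  then obtain U Rs where U: "U \<in> clifford_CS" "recorded (so6 U) Rs"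
      "w = Rs @ [matrix_inv (word_prod Rs) ** U]"
    by (auto simp: normal_forms_def is_normal_form_def)
  obtain l where l: "so6_level l U" using clifford_CS_level[OF U(1)] by blast
  then have rep: "so6_rep U (so6 U)" using so6_rep_so6 by (auto simp: so6_level_def)
  note props = so6_rep_level_props[OF l rep]
  obtain r where "residues (so6 U) l r" using props(2) residues_ex by blast
  from recorded_analysis[OF U(2) props(1) this rep] obtain js V0 where js: "Rs = map Sgen js"
      "set js \<subseteq> {1..15}"
    "phase js \<noteq> 0" "so6_rep (dagger (word_prod Rs) ** U) V0" "\<forall>i j. V0 $ i $ j \<in> \<int>"
    by blast
  obtain k where "so6_level k (word_prod Rs)" using so6_level_word_prod[OF js(2)] js(1) by blast
  \<comment> \<open>The value of the level is irrelevant: integrality of \<open>V0\<close> makes it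
    even, and this gives the condition on the determinant needed for a Clifford operator.\<close>
  then have "so6_level (k + l) (dagger (word_prod Rs) ** U)"
      by (intro so6_level_mult so6_level_dagger l)
  then have "dagger (word_prod Rs) ** U \<in> clifford" using clifford_if_integral js(4,5) by blast
  moreover have "matrix_inv (word_prod Rs) = dagger (word_prod Rs)"
    unfolding js(1) by (rule unitary_matrix_inv[OF unitary_word_prod[OF js(2)]])
  ultimately show "\<exists>js C. w = map Sgen js @ [C] \<and> set js \<subseteq> {1..15} \<and> phase js \<noteq> 0 \<and> C \<in> clifford"
    using U(3) js(1-3) by auto
next
  assume "\<exists>js C. w = map Sgen js @ [C] \<and> set js \<subseteq> {1..15} \<and> phase js \<noteq> 0 \<and> C \<in> clifford"
  then obtain js C where js: "w = map Sgen js @ [C]" "set js \<subseteq> {1..15}" "phase js \<noteq> 0"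
      "C \<in> clifford" by blast
  define U where "U = word_prod (map Sgen js) ** C"
  have U_CS: "word_prod (map Sgen js) ** C \<in> clifford_CS"
    using js(2)
  proof (induction js)
    case Nil
    then show ?case using js(4) clifford_subset_CS by auto
  next
    case (Cons s js)
    then show ?case
      using clifford_CS_mult[OF Sgen_in_clifford_CS[of s]]
          by (simp add: matrix_mul_assoc[symmetric])
  qed
  have levC: "so6_level 0 C" by (rule clifford_level[OF js(4)])
  then have repC: "so6_rep C (so6 C)" using so6_rep_so6 by (auto simp: so6_level_def)
  note C = so6_rep_level_props[OF levC repC]
  let ?V = "foldr (\<lambda>s X. smat s ** X) js (so6 C)"
  have "so6_rep U ?V"
    unfolding U_def using js(2)
  proof (induction js)
    case Nil
    then show ?case using repC by simp
  next
    case (Cons s js)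
    then show ?case
      using so6_rep_mult[OF Sgen_rep(3)[of s]] by (simp add: matrix_mul_assoc[symmetric])
  qed
  then have "so6 U = ?V \<or> so6 U = - ?V" by (rule so6_cases)
  moreover have "recorded ?V (map Sgen js)"
    using recorded_word[OF js(2,3) C(1)] C(2) by simp
  ultimately have "recorded (so6 U) (map Sgen js)" using recorded_minus by auto
  moreover have "matrix_inv (word_prod (map Sgen js)) ** U = C"
    using unitary_word_prod[OF js(2)]
        unfolding U_def unitary_matrix_inv[OF unitary_word_prod[OF js(2)]]
    by (simp add: matrix_mul_assoc unitary_def)
  ultimately show "w \<in> normal_forms"
    using U_CS js(1) unfolding normal_forms_def is_normal_form_def U_def[symmetric] by fastforce
qed

theorem theorem5p17:
  fixes c :: "nat \<Rightarrow> op2" and U :: "op2 list"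
  assumes "bij_betw c {1..card clifford} clifford"
    and "U \<in> lists alphabet"
  shows "U \<in> language (syllable_nfa 1 3 \<circ>\<^sub>A syllable_nfa 4 9 \<circ>\<^sub>A syllable_nfa 10 15
              \<circ>\<^sub>A clifford_nfa c)
    \<longleftrightarrow> U \<in> normal_forms"
proof -
  have fin: "final (syllable_nfa n m) \<subseteq> states (syllable_nfa n m)"
      "alph (syllable_nfa n m) = alphabet"
    "alph (clifford_nfa c) = alphabet" for n m
    by (auto simp: syllable_nfa_def clifford_nfa_def)
  have L: "language (syllable_nfa 1 3) = {map Sgen js | js. syllable 1 3 js}"
    "language (syllable_nfa 4 9) = {map Sgen js | js. syllable 4 9 js}"
    "language (syllable_nfa 10 15) = {map Sgen js | js. syllable 10 15 js}"
    "language (clifford_nfa c) = {[C] | C. C \<in> clifford}"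
    by (simp_all only: language_clifford_nfa[OF assms(1)]) (rule language_syllable_nfa; simp)+
  have "language (syllable_nfa 1 3 \<circ>\<^sub>A syllable_nfa 4 9 \<circ>\<^sub>A syllable_nfa 10 15 \<circ>\<^sub>A clifford_nfa c) =
    {u @ v |u v. u \<in> {u @ v |u v. u \<in> {u @ v |u v. u \<in> language (syllable_nfa 1 3) \<and> v \<in> language
        (syllable_nfa 4 9)}
      \<and> v \<in> language (syllable_nfa 10 15)} \<and> v \<in> language (clifford_nfa c)}"
    using fin by (subst language_conc, force, force)+ (rule HOL.refl)
  also have "\<dots> = {map Sgen (us @ vs @ ws) @ [C] | us vs ws C. syllable 1 3 us \<and> syllable 4 9 vs \<and>
      syllable 10 15 ws \<and> C \<in> clifford}"
    (is "?L = ?R")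
  proof (intro equalityI subsetI)
    fix w assume "w \<in> ?L"
    then obtain us vs ws C where "w = ((map Sgen us @ map Sgen vs) @ map Sgen ws) @ [C]"
      "syllable 1 3 us" "syllable 4 9 vs" "syllable 10 15 ws" "C \<in> clifford"
      unfolding L by blast
    then show "w \<in> ?R" by auto
  next
    fix w assume "w \<in> ?R"
    then obtain us vs ws C where "w = ((map Sgen us @ map Sgen vs) @ map Sgen ws) @ [C]"
      "syllable 1 3 us" "syllable 4 9 vs" "syllable 10 15 ws" "C \<in> clifford"
      by auto
    then show "w \<in> ?L" unfolding L by blast
  qed
  also have "\<dots> = normal_forms"
  proof (intro equalityI subsetI)
    fix w assume "w \<in> {map Sgen (us @ vs @ ws) @ [C] | us vs ws C. syllable 1 3 us \<and>
        syllable 4 9 vs \<and> syllable 10 15 ws \<and> C \<in> clifford}"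
    then obtain us vs ws C where w: "w = map Sgen (us @ vs @ ws) @ [C]" "syllable 1 3 us"
        "syllable 4 9 vs"
      "syllable 10 15 ws" "C \<in> clifford" by blast
    have s: "set (us @ vs @ ws) \<subseteq> {1..15}" using w(2-4) by (fastforce simp: syllable_def)
    then have "phase (us @ vs @ ws) \<noteq> 0" using phase_nonzero_iff w(2-4) by blast
    then show "w \<in> normal_forms" unfolding normal_forms_iff using w(1,5) s by blast
  next
    fix w assume "w \<in> normal_forms"
    then show "w \<in> {map Sgen (us @ vs @ ws) @ [C] | us vs ws C. syllable 1 3 us \<and>
        syllable 4 9 vs \<and> syllable 10 15 ws \<and> C \<in> clifford}"
      unfolding normal_forms_iff using phase_nonzero_iff by fastforce
  qed
  finally show ?thesis by simp
qed

end
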